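(* For each $d$, let $\boldsymbol\theta^{(d)}\in\mathcal S^{d-1}_1$ and $\boldsymbol x^{(d)}\in\mathcal S^{d-1}_d$, let $\boldsymbol X^{(d)}=\{\boldsymbol X^{(d)}_t\}_{t\ge 0}$ be spherical Brownian motion on $\mathcal S^{d-1}_d$ started at $\boldsymbol X^{(d)}_0=\boldsymbol x^{(d)}$, and set $Y^{(d)}_t:=\langle\boldsymbol\theta^{(d)},\boldsymbol X^{(d)}_t\rangle$ and $y^{(d)}:=Y^{(d)}_0=\langle\boldsymbol\theta^{(d)},\boldsymbol x^{(d)}\rangle$. Let $u\in\mathbb R$ and let $U=\{U_t\}_{t\ge0}$ be the Ornstein-Uhlenbeck process with generator $\frac{\partial^2}{\partial u^2}-u\frac{\partial}{\partial u}$ started at $U_0=u$. If $y^{(d)}\to u$ as $d\to\infty$, then the processes $Y^{(d)}=\{Y^{(d)}_t\}_{t\ge0}$ converge weakly (in distribution, as processes) to $U$ as $d\to\infty$.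
   Context: $\mathcal S^{d-1}_r\subset\mathbb R^d$ denotes the sphere centred at the origin of radius $\sqrt r$; thus $\mathcal S^{d-1}_1$ is the unit sphere and $\mathcal S^{d-1}_d$ has radius $\sqrt d$. $\langle\cdot,\cdot\rangle$ is the standard inner product on $\mathbb R^d$. Spherical Brownian motion on $\mathcal S^{d-1}_d$ is the unique diffusion process on $\mathcal S^{d-1}_d$ with infinitesimal generator $$\Delta_d=\sum_{i=1}^d\frac{\partial^2}{\partial x_i^2}-\frac1d\sum_{i,j=1}^d x_ix_j\frac{\partial^2}{\partial x_i\partial x_j}-\frac{d-1}{d}\sum_{i=1}^d x_i\frac{\partial}{\partial x_i}.$$ The Ornstein-Uhlenbeck process $U$ is the one-dimensional diffusion with drift coefficient $b(u)=-u$ and diffusion coefficient $a(u)=2$ (so that its generator is $\frac{\partial^2}{\partial u^2}-u\frac{\partial}{\partial u}$), started at a deterministic point. Weak convergence of processes means weak convergence of their laws on path space; here all processes have continuous paths, and the path space is $C([0,\infty),\mathbb R)$ with the topology of uniform convergence on compact sets. *)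

theory Defs
  imports "HOL-Probability.Probability"
begin

text \<open>The state space is a set \<open>E\<close> (closed and locally compact in the applications) of a
  topological space, with the subspace topology and its Borel sets.\<close>

abbreviation borel_on :: "'a::topological_space set \<Rightarrow> 'a measure" where
  "borel_on E \<equiv> restrict_space borel E"

definition C0_on :: "'a::topological_space set \<Rightarrow> ('a \<Rightarrow> real) set" where
  "C0_on E = {f. continuous_on E f \<and>
     (\<forall>\<epsilon>>0. \<exists>K. compact K \<and> K \<subseteq> E \<and> (\<forall>x\<in>E - K. \<bar>f x\<bar> < \<epsilon>))}"

definition semigroup_op ::
    "(real \<Rightarrow> 'a \<Rightarrow> 'a measure) \<Rightarrow> real \<Rightarrow> ('a \<Rightarrow> real) \<Rightarrow> 'a \<Rightarrow> real" where
  "semigroup_op P t f x = (\<integral>y. f y \<partial>P t x)"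

definition feller_semigroup ::
    "'a::topological_space set \<Rightarrow> (real \<Rightarrow> 'a \<Rightarrow> 'a measure) \<Rightarrow> bool" where
  "feller_semigroup E P \<longleftrightarrow>
     (\<forall>t\<ge>0. P t \<in> borel_on E \<rightarrow>\<^sub>M prob_algebra (borel_on E)) \<and>
     (\<forall>x\<in>E. P 0 x = return (borel_on E) x) \<and>
     (\<forall>s\<ge>0. \<forall>t\<ge>0. \<forall>x\<in>E. P (s + t) x = P s x \<bind> P t) \<and>
     (\<forall>f\<in>C0_on E. \<forall>t\<ge>0. semigroup_op P t f \<in> C0_on E) \<and>
     (\<forall>f\<in>C0_on E. uniform_limit E (\<lambda>t. semigroup_op P t f) f (at_right 0))"

text \<open>\<open>f\<close> lies in the domain of the infinitesimal generator of \<open>P\<close>, and the generator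
  maps it to \<open>g\<close>.\<close>

definition has_generator_value ::
    "'a::topological_space set \<Rightarrow> (real \<Rightarrow> 'a \<Rightarrow> 'a measure) \<Rightarrow> ('a \<Rightarrow> real) \<Rightarrow> ('a \<Rightarrow> real) \<Rightarrow> bool"
  where
  "has_generator_value E P f g \<longleftrightarrow> f \<in> C0_on E \<and> g \<in> C0_on E \<and>
     uniform_limit E (\<lambda>t x. (semigroup_op P t f x - f x) / t) g (at_right 0)"

definition natural_filtration ::
    "'w measure \<Rightarrow> (real \<Rightarrow> 'w \<Rightarrow> 'a::topological_space) \<Rightarrow> real \<Rightarrow> 'w measure" where
  "natural_filtration M X s =
     sigma (space M) {X r -` B \<inter> space M | r B. 0 \<le> r \<and> r \<le> s \<and> B \<in> sets borel}"

definition markov_process ::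
    "'a::topological_space set \<Rightarrow> (real \<Rightarrow> 'a \<Rightarrow> 'a measure) \<Rightarrow> 'w measure \<Rightarrow>
     (real \<Rightarrow> 'w \<Rightarrow> 'a) \<Rightarrow> bool" where
  "markov_process E P M X \<longleftrightarrow>
     (\<forall>t\<ge>0. X t \<in> M \<rightarrow>\<^sub>M borel_on E) \<and>
     (\<forall>s t B. 0 \<le> s \<longrightarrow> s \<le> t \<longrightarrow> B \<in> sets (borel_on E) \<longrightarrow>
        (AE \<omega> in M. real_cond_exp M (natural_filtration M X s) (\<lambda>\<omega>. indicator B (X t \<omega>)) \<omega> =
           measure (P (t - s) (X s \<omega>)) B))"

text \<open>Diffusion in \<open>E\<close> started at \<open>x0\<close> whose generator is the differential operator \<open>L\<close>, given
  on the class \<open>D\<close> of smooth test functions: a Feller process (hence strong Markov) with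
  continuous paths whose infinitesimal generator extends \<open>L\<close> on \<open>D\<close>.  Elements of \<open>D\<close> may be
  defined beyond \<open>E\<close>, so that \<open>L\<close> can be written in ambient coordinates.\<close>

definition diffusion_process ::
    "'a::topological_space set \<Rightarrow> ('a \<Rightarrow> real) set \<Rightarrow> (('a \<Rightarrow> real) \<Rightarrow> 'a \<Rightarrow> real) \<Rightarrow> 'a \<Rightarrow>
     'w measure \<Rightarrow> (real \<Rightarrow> 'w \<Rightarrow> 'a) \<Rightarrow> bool" where
  "diffusion_process E D L x0 M X \<longleftrightarrow>
     prob_space M \<and>
     (\<exists>P. feller_semigroup E P \<and> (\<forall>f\<in>D. has_generator_value E P f (L f)) \<and>
          markov_process E P M X) \<and>
     (\<forall>\<omega>\<in>space M. continuous_on {0..} (\<lambda>t. X t \<omega>)) \<and>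
     (AE \<omega> in M. X 0 \<omega> = x0)"

text \<open>As in \<open>Euclidean_space\<close>, a vector of \<open>\<real>\<^sup>d\<close> is a function \<open>nat \<Rightarrow> real\<close> vanishing from
  index \<open>d\<close> on; the product topology restricts to the usual one.\<close>

abbreviation Rn :: "nat \<Rightarrow> (nat \<Rightarrow> real) set" where
  "Rn d \<equiv> topspace (Euclidean_space d)"

definition dotp :: "nat \<Rightarrow> (nat \<Rightarrow> real) \<Rightarrow> (nat \<Rightarrow> real) \<Rightarrow> real" where
  "dotp d x y = (\<Sum>i<d. x i * y i)"

text \<open>The sphere in \<open>\<real>\<^sup>d\<close> of radius \<open>sqrt r\<close> (not \<open>r\<close>).\<close>

definition sphere_sqrt :: "nat \<Rightarrow> real \<Rightarrow> (nat \<Rightarrow> real) set" where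
  "sphere_sqrt d r = {x \<in> Rn d. sqrt (dotp d x x) = sqrt r}"

definition partial :: "nat \<Rightarrow> ((nat \<Rightarrow> real) \<Rightarrow> real) \<Rightarrow> (nat \<Rightarrow> real) \<Rightarrow> real" where
  "partial i f x = deriv (\<lambda>h. f (x(i := h))) (x i)"

definition C1_Rn :: "nat \<Rightarrow> ((nat \<Rightarrow> real) \<Rightarrow> real) set" where
  "C1_Rn d = {f. continuous_on (Rn d) f \<and>
     (\<forall>i<d. (\<forall>x\<in>Rn d. (\<lambda>h. f (x(i := h))) differentiable at (x i)) \<and>
            continuous_on (Rn d) (partial i f))}"

definition C2_Rn :: "nat \<Rightarrow> ((nat \<Rightarrow> real) \<Rightarrow> real) set" where
  "C2_Rn d = {f \<in> C1_Rn d. \<forall>i<d. partial i f \<in> C1_Rn d}"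

definition spherical_generator ::
    "nat \<Rightarrow> ((nat \<Rightarrow> real) \<Rightarrow> real) \<Rightarrow> (nat \<Rightarrow> real) \<Rightarrow> real" where
  "spherical_generator d f x =
     (\<Sum>i<d. partial i (partial i f) x)
     - 1 / real d * (\<Sum>i<d. \<Sum>j<d. x i * x j * partial i (partial j f) x)
     - (real d - 1) / real d * (\<Sum>i<d. x i * partial i f x)"

text \<open>Every \<open>C\<^sup>2\<close> function on the sphere is the restriction of an element of \<open>C2_Rn\<close>; the operator
  is tangential, so its value on the sphere does not depend on the extension.\<close>

definition spherical_BM ::
    "nat \<Rightarrow> (nat \<Rightarrow> real) \<Rightarrow> 'w measure \<Rightarrow> (real \<Rightarrow> 'w \<Rightarrow> nat \<Rightarrow> real) \<Rightarrow> bool" where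
  "spherical_BM d = diffusion_process (sphere_sqrt d (real d)) (C2_Rn d) (spherical_generator d)"

definition C2c_real :: "(real \<Rightarrow> real) set" where
  "C2c_real = {f. (\<forall>x. f differentiable at x) \<and> (\<forall>x. deriv f differentiable at x) \<and>
     continuous_on UNIV (deriv (deriv f)) \<and> (\<exists>K. compact K \<and> (\<forall>x. x \<notin> K \<longrightarrow> f x = 0))}"

definition OU_generator :: "(real \<Rightarrow> real) \<Rightarrow> real \<Rightarrow> real" where
  "OU_generator f u = deriv (deriv f) u - u * deriv f u"

definition OU_process :: "real \<Rightarrow> 'w measure \<Rightarrow> (real \<Rightarrow> 'w \<Rightarrow> real) \<Rightarrow> bool" where
  "OU_process = diffusion_process UNIV C2c_real OU_generator"

text \<open>Paths in \<open>C([0,\<infinity>), \<real>)\<close> are represented by functions on \<open>real\<close> that are \<open>undefined\<close> at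
  negative times.\<close>

definition path_space :: "(real \<Rightarrow> real) set" where
  "path_space = {w \<in> extensional {0..}. continuous_on {0..} w}"

definition path_topology :: "(real \<Rightarrow> real) topology" where
  "path_topology = topology_generated_by
     {{v \<in> path_space. \<forall>t\<in>K. \<bar>v t - w t\<bar> < \<epsilon>} | w K \<epsilon>.
        w \<in> path_space \<and> compact K \<and> K \<subseteq> {0..} \<and> \<epsilon> > 0}"

definition borel_sigma :: "'a topology \<Rightarrow> 'a measure" where
  "borel_sigma T = sigma (topspace T) {U. openin T U}"

definition path_law :: "'w measure \<Rightarrow> (real \<Rightarrow> 'w \<Rightarrow> real) \<Rightarrow> (real \<Rightarrow> real) measure" where
  "path_law M Y = distr M (borel_sigma path_topology) (\<lambda>\<omega>. \<lambda>t\<in>{0..}. Y t \<omega>)"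

definition weakly_converges ::
    "'a topology \<Rightarrow> (nat \<Rightarrow> 'a measure) \<Rightarrow> 'a measure \<Rightarrow> bool" where
  "weakly_converges T \<mu> \<nu> \<longleftrightarrow>
     (\<forall>\<Phi>. continuous_map T euclideanreal \<Phi> \<and> (\<exists>B. \<forall>w\<in>topspace T. \<bar>\<Phi> w\<bar> \<le> B) \<longrightarrow>
        (\<lambda>n. \<integral>w. \<Phi> w \<partial>\<mu> n) \<longlonglongrightarrow> (\<integral>w. \<Phi> w \<partial>\<nu>))"

definition converge_weakly_as_processes ::
    "(nat \<Rightarrow> 'w measure) \<Rightarrow> (nat \<Rightarrow> real \<Rightarrow> 'w \<Rightarrow> real) \<Rightarrow> 'v measure \<Rightarrow>
     (real \<Rightarrow> 'v \<Rightarrow> real) \<Rightarrow> bool" where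
  "converge_weakly_as_processes M Y N U \<longleftrightarrow>
     weakly_converges path_topology (\<lambda>d. path_law (M d) (Y d)) (path_law N U)"

end

theory Submission
  imports Defs
begin

text \<open>Let \<open>T\<^sub>t\<close> be the Ornstein-Uhlenbeck semigroup.  It maps Gaussians
  \<open>exp (c + b x - a x\<^sup>2)\<close>, \<open>a > 0\<close>, to Gaussians with explicit parameters, and products of
  Gaussians are Gaussians.  On functions of the projection \<open>p = \<langle>\<theta>, x\<rangle>\<close> the spherical generator
  acts as \<open>(1 - p\<^sup>2 / d) \<partial>\<^sup>2 - (d - 1) / d p \<partial>\<close>, which differs from the Ornstein-Uhlenbeck
  generator by \<open>O(1 / d)\<close> on Gaussians.  Duhamel's formula therefore gives
  \<open>E[g(Y\<^sub>t) | F\<^sub>s] = T\<^sub>t\<^sub>-\<^sub>s g (Y\<^sub>s) + O(1 / d)\<close> for every Gaussian \<open>g\<close>, and the same identity without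
  error for the limit process, where Gaussians are reached by cutting off.  By induction on the
  number of times, expectations of products of Gaussians of \<open>Y\<^sub>t\<^sub>1, \<dots>, Y\<^sub>t\<^sub>k\<close> converge.

  The generator also yields a fourth moment bound for the increments, hence by chaining a bound
  on the modulus of continuity that is uniform in \<open>d\<close>.  So up to small probability all paths lie
  in one compact set on which, by Stone-Weierstrass, every continuous functional is approximated
  by the algebra generated by the Gaussian functionals; composing with a polynomial close to a
  truncation keeps the approximant bounded off the compact set.  No Prokhorov theorem is needed.\<close>

section \<open>Feller semigroups and Duhamel's formula\<close>

text \<open>The limit process is given only through its generator on compactly supported functions,
  and the approximating processes live on spheres that grow with \<open>d\<close>. The test
  functions must therefore be explicit under the limiting semigroup, closed under products, separate
  points, and decay so fast that the difference of the generators,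
  \<open>(p g' - p^2 g'') / d\<close> for a function \<open>g\<close> of the projection
  \<open>p\<close>, is \<open>O(1 / d)\<close> uniformly in \<open>p\<close>. Gaussians with
  \<open>a > 0\<close> have all these properties, and \<open>a\<close> keeps a positive lower bound
  on bounded time intervals, which makes the constants uniform. Tightness has two sources: for the
  projections a moment bound that depends on \<open>d\<close> only through the bounded starting
  values \<open>y d\<close>, for the limit nothing but the continuity of its paths. Both have to
  lead to the same compact set, since one approximant must serve all laws at once; hence the modulus
  of continuity is phrased by grids, which can be chosen fine enough for both.\<close>

lemma nonincreasing_of_right_increments:
  fixes \<phi> :: "real \<Rightarrow> real"
  assumes ab: "a \<le> b" and cont: "continuous_on {a..b} \<phi>"
    and incr: "\<And>s e. a \<le> s \<Longrightarrow> s < b \<Longrightarrow> e > 0 \<Longrightarrow>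
      eventually (\<lambda>h. \<phi> (s + h) \<le> \<phi> s + e * h) (at_right 0)"
  shows "\<phi> b \<le> \<phi> a"
proof (rule field_le_epsilon)
  fix e0 :: real assume e0: "e0 > 0"
  \<comment> \<open>The slack \<open>e0\<close> is spread evenly over the interval; the
    \<open>+ 1\<close> keeps the quotient harmless when \<open>a = b\<close>.\<close>
  define e where "e = e0 / (b - a + 1)"
  have e: "e > 0" using e0 ab by (simp add: e_def)
  \<comment> \<open>Closed by continuity, so it has a largest element \<open>m\<close>. If
    \<open>m < b\<close>, the hypothesis at \<open>m\<close> would produce a larger one; hence
    \<open>m = b\<close>.\<close>
  define S where "S = {s \<in> {a..b}. \<phi> s - e * (s - a) \<le> \<phi> a}"
  have "closed S"
    unfolding S_def
    by (intro continuous_on_closed_Collect_le continuous_intros cont)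
  moreover have "S \<subseteq> {a..b}" by (auto simp: S_def)
  ultimately have compS: "compact S"
    using compact_Int_closed[of "{a..b}" S] by (simp add: Int_absorb1)
  have aS: "a \<in> S" using ab by (simp add: S_def)
  obtain m where m: "m \<in> S" "\<And>s. s \<in> S \<Longrightarrow> s \<le> m"
    using compact_attains_sup[OF compS] aS by blast
  have "m = b"
  proof (rule ccontr)
    assume "m \<noteq> b"
    then have mb: "a \<le> m" "m < b" using m(1) by (auto simp: S_def)
    have "eventually (\<lambda>h. \<phi> (m + h) \<le> \<phi> m + e * h) (at_right 0)"
      using incr[OF mb e] .
    moreover have "eventually (\<lambda>h::real. h \<in> {0<..<b - m}) (at_right 0)"
      using mb by (intro eventually_at_right_real) auto
    ultimately have "eventually (\<lambda>h. \<phi> (m + h) \<le> \<phi> m + e * h \<and> h \<in> {0<..<b - m}) (at_right 0)"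
      by eventually_elim auto
    then obtain h where h: "\<phi> (m + h) \<le> \<phi> m + e * h" "0 < h" "h < b - m"
      using eventually_happens'[OF trivial_limit_at_right_real]
      by (metis (no_types, lifting) greaterThanLessThan_iff)
    have "m + h \<in> S" using h m(1) mb by (auto simp: S_def algebra_simps)
    then show False using m(2) h(2) by force
  qed
  then have "\<phi> b \<le> \<phi> a + e * (b - a)" using m(1) by (simp add: S_def)
  also have "e * (b - a) \<le> e0"
  proof -
    have "(b - a) / (b - a + 1) \<le> 1" using ab by simp
    then show ?thesis unfolding e_def using e0 mult_left_mono[of "(b - a) / (b - a + 1)" 1 e0] by simp
  qed
  finally show "\<phi> b \<le> \<phi> a + e0" by simp
qed

lemma C0_on_bounded:
  assumes "f \<in> C0_on E"
  obtains B where "B \<ge> 0" "\<And>x. x \<in> E \<Longrightarrow> \<bar>f x\<bar> \<le> B"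
proof -
  have c: "continuous_on E f" using assms by (simp add: C0_on_def)
  have "\<exists>K. compact K \<and> K \<subseteq> E \<and> (\<forall>x\<in>E - K. \<bar>f x\<bar> < 1)"
    using assms by (simp add: C0_on_def)
  then obtain K where K: "compact K" "K \<subseteq> E" "\<forall>x\<in>E - K. \<bar>f x\<bar> < 1" by blast
  have "bounded (f ` K)"
    using K continuous_on_subset[OF c] by (simp add: compact_imp_bounded compact_continuous_image)
  then obtain B where "\<forall>y\<in>f ` K. norm y \<le> B" unfolding bounded_iff by blast
  then have B: "\<bar>f x\<bar> \<le> B" if "x \<in> K" for x using that by simp
  show ?thesis
  proof (rule that[of "max B 1"])
    fix x assume "x \<in> E"
    then consider "x \<in> K" | "x \<in> E - K" by blast
    then show "\<bar>f x\<bar> \<le> max B 1"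
    proof cases
      case 1
      then show ?thesis using B[of x] by simp
    next
      case 2
      then have "\<bar>f x\<bar> < 1" using K(3) by blast
      then show ?thesis by simp
    qed
  qed simp
qed

lemma C0_on_measurable: "f \<in> C0_on E \<Longrightarrow> f \<in> borel_measurable (borel_on E)"
  by (simp add: C0_on_def borel_measurable_continuous_on_restrict)

lemma C0_on_uminus: "f \<in> C0_on E \<Longrightarrow> (\<lambda>x. - f x) \<in> C0_on E"
  by (auto simp: C0_on_def intro: continuous_intros)

lemma has_generator_value_uminus:
  assumes "has_generator_value E P f g"
  shows "has_generator_value E P (\<lambda>x. - f x) (\<lambda>x. - g x)"
proof -
  have "uniform_limit E (\<lambda>t x. (semigroup_op P t f x - f x) / t) g (at_right 0)"
    using assms by (simp add: has_generator_value_def)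
  then have "uniform_limit E (\<lambda>t x. - ((semigroup_op P t f x - f x) / t)) (\<lambda>x. - g x) (at_right 0)"
    by (rule uniform_limit_uminus)
  also have "(\<lambda>t x. - ((semigroup_op P t f x - f x) / t)) =
      (\<lambda>t x. (semigroup_op P t (\<lambda>x. - f x) x - - f x) / t)"
    by (auto simp: semigroup_op_def fun_eq_iff minus_divide_left)
  finally show ?thesis
    using assms by (auto simp: has_generator_value_def C0_on_uminus)
qed

section \<open>Operators of a Feller semigroup\<close>

locale feller =
  fixes E :: "'a::topological_space set" and P :: "real \<Rightarrow> 'a \<Rightarrow> 'a measure"
  assumes feller: "feller_semigroup E P"
begin

abbreviation op :: "real \<Rightarrow> ('a \<Rightarrow> real) \<Rightarrow> 'a \<Rightarrow> real" where
  "op \<equiv> semigroup_op P"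

lemma kernel_measurable: "0 \<le> t \<Longrightarrow> P t \<in> borel_on E \<rightarrow>\<^sub>M prob_algebra (borel_on E)"
  using feller by (simp add: feller_semigroup_def)

lemma kernel_measurable_subprob:
  "0 \<le> t \<Longrightarrow> P t \<in> borel_on E \<rightarrow>\<^sub>M subprob_algebra (borel_on E)"
  by (intro measurable_prob_algebraD kernel_measurable)

lemma kernel_prob_space: "0 \<le> t \<Longrightarrow> x \<in> E \<Longrightarrow> prob_space (P t x)"
  using measurable_space[OF kernel_measurable, of t x]
  by (auto simp: space_prob_algebra space_restrict_space)

lemma sets_transition: "0 \<le> t \<Longrightarrow> x \<in> E \<Longrightarrow> sets (P t x) = sets (borel_on E)"
  using measurable_space[OF kernel_measurable, of t x]
  by (auto simp: space_prob_algebra space_restrict_space)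

lemma space_kernel: "0 \<le> t \<Longrightarrow> x \<in> E \<Longrightarrow> space (P t x) = E"
  using sets_eq_imp_space_eq[OF sets_transition] by (simp add: space_restrict_space)

lemma integrable_kernel:
  fixes f :: "'a \<Rightarrow> real"
  assumes "0 \<le> t" "x \<in> E" "f \<in> borel_measurable (borel_on E)" "\<And>y. y \<in> E \<Longrightarrow> \<bar>f y\<bar> \<le> B"
  shows "integrable (P t x) f"
proof -
  interpret prob_space "P t x" using assms by (intro kernel_prob_space)
  show ?thesis
  proof (rule integrable_const_bound[of _ B])
    show "AE y in P t x. norm (f y) \<le> B"
      using assms by (intro AE_I2) (simp add: space_kernel)
    show "f \<in> borel_measurable (P t x)"
      using assms by (simp add: measurable_cong_sets[OF sets_transition refl])
  qed
qed

lemma integrable_C0: "0 \<le> t \<Longrightarrow> x \<in> E \<Longrightarrow> f \<in> C0_on E \<Longrightarrow> integrable (P t x) f"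
  by (metis C0_on_bounded C0_on_measurable integrable_kernel)

lemma op_const: "0 \<le> t \<Longrightarrow> x \<in> E \<Longrightarrow> op t (\<lambda>_. c) x = c"
proof -
  assume "0 \<le> t" "x \<in> E"
  then interpret prob_space "P t x" by (intro kernel_prob_space)
  show ?thesis by (simp add: semigroup_op_def prob_space)
qed

lemma op_0:
  assumes "x \<in> E" "f \<in> borel_measurable (borel_on E)"
  shows "op 0 f x = f x"
  using feller assms
  by (simp add: semigroup_op_def feller_semigroup_def integral_return space_restrict_space)

lemma op_mono:
  assumes "0 \<le> t" "x \<in> E" "integrable (P t x) f" "integrable (P t x) g"
    "\<And>y. y \<in> E \<Longrightarrow> f y \<le> g y"
  shows "op t f x \<le> op t g x"
  unfolding semigroup_op_def using assms by (intro integral_mono) (auto simp: space_kernel)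

lemma op_diff_le:
  assumes t: "0 \<le> t" and x: "x \<in> E" and ig: "integrable (P t x) f" "integrable (P t x) g"
    and le: "\<And>y. y \<in> E \<Longrightarrow> \<bar>f y - g y\<bar> \<le> c"
  shows "\<bar>op t f x - op t g x\<bar> \<le> c"
proof -
  interpret prob_space "P t x" using t x by (rule kernel_prob_space)
  have *: "f y \<le> g y + c" "g y \<le> f y + c" if "y \<in> E" for y using le[OF that] by linarith+
  have "op t f x \<le> op t (\<lambda>y. g y + c) x" "op t g x \<le> op t (\<lambda>y. f y + c) x"
    using t x ig * by (auto intro!: op_mono)
  then show ?thesis using ig by (simp add: semigroup_op_def prob_space abs_le_iff)
qed

lemma op_add:
  assumes "0 \<le> s" "0 \<le> t" "x \<in> E" "f \<in> borel_measurable (borel_on E)"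
    "\<And>y. y \<in> E \<Longrightarrow> \<bar>f y\<bar> \<le> B"
  shows "op (s + t) f x = op s (op t f) x"
proof -
  interpret prob_space "P s x" using assms by (intro kernel_prob_space)
  have *: "P (s + t) x = P s x \<bind> P t"
    using feller assms by (simp add: feller_semigroup_def)
  have E: "E \<noteq> {}" using assms by auto
  have "op (s + t) f x = (\<integral>y. \<integral>z. f z \<partial>P t y \<partial>P s x)"
    unfolding semigroup_op_def *
  proof (rule integral_bind[where K = "borel_on E" and B' = 1 and B = B])
    show "P t \<in> P s x \<rightarrow>\<^sub>M subprob_algebra (borel_on E)"
      using kernel_measurable_subprob[of t] assms
      by (simp add: measurable_cong_sets[OF sets_transition refl])
    show "AE y in P s x. emeasure (P t y) (space (P t y)) \<le> ennreal 1"
    proof (rule AE_I2)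
      fix y assume "y \<in> space (P s x)"
      then have "prob_space (P t y)" using assms by (intro kernel_prob_space) (auto simp: space_kernel)
      then show "emeasure (P t y) (space (P t y)) \<le> ennreal 1"
        by (simp add: prob_space.emeasure_space_1)
    qed
    show "f \<in> borel_measurable (borel_on E)" by fact
    show "\<And>y. y \<in> space (borel_on E) \<Longrightarrow> \<bar>f y\<bar> \<le> B"
      using assms by (simp add: space_restrict_space)
    show "finite_measure (P s x)" by unfold_locales
  qed
  then show ?thesis by (simp add: semigroup_op_def)
qed

lemma op_C0: "0 \<le> t \<Longrightarrow> f \<in> C0_on E \<Longrightarrow> op t f \<in> C0_on E"
  using feller by (simp add: feller_semigroup_def)

lemma op_strong_continuity:
  assumes "f \<in> C0_on E" "e > 0"
  shows "eventually (\<lambda>h. \<forall>x\<in>E. \<bar>op h f x - f x\<bar> < e) (at_right 0)"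
proof -
  have "uniform_limit E (\<lambda>t. op t f) f (at_right 0)"
    using feller assms by (simp add: feller_semigroup_def)
  then show ?thesis using assms(2) by (simp add: uniform_limit_iff dist_real_def)
qed

text \<open>Duhamel's argument: the right derivative of \<open>s \<mapsto> P\<^sub>s f\<^sub>s\<close> is \<open>P\<^sub>s (A f\<^sub>s + \<partial>\<^sub>s f\<^sub>s)\<close>.\<close>

lemma duhamel_le:
  fixes f A D :: "real \<Rightarrow> 'a \<Rightarrow> real"
  assumes T: "0 \<le> T" and x: "x \<in> E"
    and gen: "\<And>s. 0 \<le> s \<Longrightarrow> s \<le> T \<Longrightarrow> has_generator_value E P (f s) (A s)"
    and D: "\<And>s. 0 \<le> s \<Longrightarrow> s \<le> T \<Longrightarrow> D s \<in> C0_on E"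
    and diff: "\<And>e. e > 0 \<Longrightarrow> \<exists>\<delta>>0. \<forall>s r. 0 \<le> s \<longrightarrow> s \<le> r \<longrightarrow> r \<le> T \<longrightarrow> r \<le> s + \<delta> \<longrightarrow>
      (\<forall>y\<in>E. \<bar>f r y - f s y - (r - s) * D s y\<bar> \<le> e * (r - s))"
    and bound: "\<And>s y. 0 \<le> s \<Longrightarrow> s \<le> T \<Longrightarrow> y \<in> E \<Longrightarrow> \<bar>D s y\<bar> \<le> B"
    and err: "\<And>s y. 0 \<le> s \<Longrightarrow> s \<le> T \<Longrightarrow> y \<in> E \<Longrightarrow> A s y + D s y \<le> e0"
  shows "op T (f T) x \<le> f 0 x + e0 * T"
proof -
  have fC0: "f s \<in> C0_on E" if "0 \<le> s" "s \<le> T" for s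
    using gen[OF that] by (simp add: has_generator_value_def)
  have op_sum: "op (s + h) g x = op s (op h g) x" if "0 \<le> s" "0 \<le> h" "g \<in> C0_on E" for s h g
  proof -
    obtain B where "\<And>y. y \<in> E \<Longrightarrow> \<bar>g y\<bar> \<le> B" using C0_on_bounded[OF \<open>g \<in> C0_on E\<close>] by blast
    then show ?thesis using that x by (intro op_add[where B = B] C0_on_measurable)
  qed
  \<comment> \<open>The function to be shown nonincreasing; comparing its values at \<open>0\<close>
    and \<open>T\<close> is the claim.\<close>
  define \<phi> where "\<phi> s = op s (f s) x - e0 * s" for s
  obtain \<delta>1 where \<delta>1: "\<delta>1 > 0" "\<forall>s r. 0 \<le> s \<longrightarrow> s \<le> r \<longrightarrow> r \<le> T \<longrightarrow> r \<le> s + \<delta>1 \<longrightarrow>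
      (\<forall>y\<in>E. \<bar>f r y - f s y - (r - s) * D s y\<bar> \<le> 1 * (r - s))"
    using diff[OF zero_less_one] by (elim exE conjE)
  have lip: "\<bar>f r y - f s y\<bar> \<le> (B + 1) * (r - s)"
    if "0 \<le> s" "s \<le> r" "r \<le> T" "r \<le> s + \<delta>1" "y \<in> E" for s r y
  proof -
    have "\<bar>(r - s) * D s y\<bar> \<le> (r - s) * B"
      using bound[of s y] that by (simp add: abs_mult mult_left_mono)
    moreover have "\<bar>f r y - f s y - (r - s) * D s y\<bar> \<le> 1 * (r - s)"
      using \<delta>1(2) that by blast
    moreover have "(B + 1) * (r - s) = (r - s) * B + 1 * (r - s)" by (simp add: algebra_simps)
    ultimately show ?thesis by linarith
  qed
  have B0: "B \<ge> 0" using bound[of 0 x] T x by force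
  \<comment> \<open>Writing the operator at time \<open>q\<close> as the one at \<open>p\<close>
    after the one at \<open>q - p\<close> reduces the difference to a supremum over
    \<open>E\<close>. The disjunction lets strong continuity be used for the function at either end:
    in the continuity proof the fixed time may be the earlier or the later one, and only its
    function is under control.\<close>
  have cont_aux: "\<bar>op q (f q) x - op p (f p) x\<bar> \<le> c + (B + 1) * (q - p)"
    if "0 \<le> p" "p \<le> q" "q \<le> T" "q \<le> p + \<delta>1"
      and c: "(\<forall>y\<in>E. \<bar>op (q - p) (f q) y - f q y\<bar> \<le> c) \<or> (\<forall>y\<in>E. \<bar>op (q - p) (f p) y - f p y\<bar> \<le> c)"
    for p q c
  proof -
    have 1: "op q (f q) x = op p (op (q - p) (f q)) x"
      using op_sum[of p "q - p" "f q"] that fC0 by simp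
    have fq: "f q \<in> C0_on E" and fp: "f p \<in> C0_on E" using fC0 that by auto
    have "\<bar>op (q - p) (f q) y - f p y\<bar> \<le> c + (B + 1) * (q - p)" if y: "y \<in> E" for y
      using c
    proof
      assume "\<forall>y\<in>E. \<bar>op (q - p) (f q) y - f q y\<bar> \<le> c"
      then have "\<bar>op (q - p) (f q) y - f q y\<bar> \<le> c" using y by blast
      moreover have "\<bar>f q y - f p y\<bar> \<le> (B + 1) * (q - p)"
        using \<open>0 \<le> p\<close> \<open>p \<le> q\<close> \<open>q \<le> T\<close> \<open>q \<le> p + \<delta>1\<close> y by (intro lip) auto
      ultimately show ?thesis by linarith
    next
      assume a: "\<forall>y\<in>E. \<bar>op (q - p) (f p) y - f p y\<bar> \<le> c"
      have "\<bar>f q z - f p z\<bar> \<le> (B + 1) * (q - p)" if "z \<in> E" for z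
        using \<open>0 \<le> p\<close> \<open>p \<le> q\<close> \<open>q \<le> T\<close> \<open>q \<le> p + \<delta>1\<close> that by (intro lip) auto
      then have "\<bar>op (q - p) (f q) y - op (q - p) (f p) y\<bar> \<le> (B + 1) * (q - p)"
        using \<open>p \<le> q\<close> y fq fp by (intro op_diff_le integrable_C0) auto
      moreover have "\<bar>op (q - p) (f p) y - f p y\<bar> \<le> c" using a y by blast
      ultimately show ?thesis by linarith
    qed
    then show ?thesis
      unfolding 1 using that x fq fp by (intro op_diff_le integrable_C0 op_C0) auto
  qed
  have cont: "continuous_on {0..T} \<phi>"
  proof -
    have "continuous_on {0..T} (\<lambda>s. op s (f s) x)"
      unfolding continuous_on_iff
    proof (intro ballI allI impI)
      fix p e :: real assume p: "p \<in> {0..T}" and e: "e > 0"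
      have "eventually (\<lambda>h. \<forall>y\<in>E. \<bar>op h (f p) y - f p y\<bar> < e / 3) (at_right 0)"
        using p e by (intro op_strong_continuity fC0) auto
      then obtain b where b: "b > 0" "\<And>h y. 0 < h \<Longrightarrow> h < b \<Longrightarrow> y \<in> E \<Longrightarrow> \<bar>op h (f p) y - f p y\<bar> < e / 3"
        unfolding eventually_at_right_field by blast
      have b': "\<bar>op h (f p) y - f p y\<bar> \<le> e / 3" if "0 \<le> h" "h < b" "y \<in> E" for h y
        using b(2)[of h y] that e op_0[of y "f p"] C0_on_measurable[OF fC0[of p]] p
        by (cases "h = 0") auto
      define \<delta> where "\<delta> = min (min b \<delta>1) (e / (3 * (B + 1)))"
      have "e / (3 * (B + 1)) > 0" using e B0 by simp
      then have \<delta>: "\<delta> > 0" "\<delta> \<le> b" "\<delta> \<le> \<delta>1" "\<delta> \<le> e / (3 * (B + 1))"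
        using b(1) \<delta>1(1) by (auto simp: \<delta>_def)
      have "(B + 1) * \<delta> \<le> (B + 1) * (e / (3 * (B + 1)))"
        using \<delta>(4) B0 by (intro mult_left_mono) auto
      also have "\<dots> = e / 3" using B0 by (simp add: field_simps)
      finally have \<delta>B: "(B + 1) * \<delta> \<le> e / 3" .
      show "\<exists>\<delta>>0. \<forall>q\<in>{0..T}. dist q p < \<delta> \<longrightarrow> dist (op q (f q) x) (op p (f p) x) < e"
      proof (intro exI[of _ \<delta>] conjI ballI impI)
        fix q assume q: "q \<in> {0..T}" "dist q p < \<delta>"
        have qp: "(B + 1) * \<bar>q - p\<bar> \<le> e / 3"
          using mult_left_mono[of "\<bar>q - p\<bar>" \<delta> "B + 1"] q \<delta>B B0 unfolding dist_real_def by linarith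
        show "dist (op q (f q) x) (op p (f p) x) < e"
        proof (cases "p \<le> q")
          case True
          have "\<bar>op q (f q) x - op p (f p) x\<bar> \<le> e / 3 + (B + 1) * (q - p)"
            using True p q \<delta> b'[of "q - p"] by (intro cont_aux) (auto simp: dist_real_def)
          then show ?thesis using qp True e by (simp add: dist_real_def)
        next
          case False
          have "\<bar>op p (f p) x - op q (f q) x\<bar> \<le> e / 3 + (B + 1) * (p - q)"
            using False p q \<delta> b'[of "p - q"] by (intro cont_aux) (auto simp: dist_real_def)
          then show ?thesis using qp False e by (simp add: dist_real_def)
        qed
      qed (use \<delta> in auto)
    qed
    then show ?thesis unfolding \<phi>_def by (intro continuous_intros)
  qed
  have incr: "eventually (\<lambda>h. \<phi> (s + h) \<le> \<phi> s + e * h) (at_right 0)"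
    if s: "0 \<le> s" "s < T" and e: "e > 0" for s e
  proof -
    have g: "uniform_limit E (\<lambda>t x. (op t (f s) x - f s x) / t) (A s) (at_right 0)"
      using gen[of s] s by (simp add: has_generator_value_def)
    have 1: "eventually (\<lambda>h. \<forall>y\<in>E. \<bar>(op h (f s) y - f s y) / h - A s y\<bar> < e / 3) (at_right 0)"
      using uniform_limitD[OF g, of "e / 3"] e by (simp add: dist_real_def)
    have 2: "eventually (\<lambda>h. \<forall>y\<in>E. \<bar>op h (D s) y - D s y\<bar> < e / 3) (at_right 0)"
      using s e by (intro op_strong_continuity D) auto
    have e3: "e / 3 > 0" using e by simp
    obtain \<delta> where \<delta>: "\<delta> > 0" "\<forall>s r. 0 \<le> s \<longrightarrow> s \<le> r \<longrightarrow> r \<le> T \<longrightarrow> r \<le> s + \<delta> \<longrightarrow>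
        (\<forall>y\<in>E. \<bar>f r y - f s y - (r - s) * D s y\<bar> \<le> e / 3 * (r - s))"
      using diff[OF e3] by (elim exE conjE)
    have 3: "eventually (\<lambda>h. h \<in> {0<..<min \<delta> (T - s)}) (at_right 0)"
      using s \<delta> by (intro eventually_at_right_real) auto
    show ?thesis using 1 2 3
    proof eventually_elim
      case (elim h)
      have h: "0 < h" "h < \<delta>" "s + h \<le> T" using elim(3) by auto
      have fs: "f s \<in> C0_on E" "f (s + h) \<in> C0_on E" "D s \<in> C0_on E"
        using fC0 D s h by auto
      \<comment> \<open>Three first-order expansions, each with error \<open>e / 3\<close>: of
        \<open>f\<close> in time, of the operator applied to \<open>f s\<close>, and of the operator
        applied to \<open>D s\<close>. The sum of the linear terms is at most \<open>e0\<close> by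
        \<open>err\<close>, and positivity of the operator at time \<open>s\<close> carries the
        inequality to \<open>x\<close>.\<close>
      have key: "op h (f (s + h)) y \<le> f s y + (e0 + e) * h" if y: "y \<in> E" for y
      proof -
        interpret prob_space "P h y" using h y by (intro kernel_prob_space) auto
        have ig: "integrable (P h y) (f s)" "integrable (P h y) (f (s + h))" "integrable (P h y) (D s)"
          using h y fs by (auto intro: integrable_C0)
        have "op h (f (s + h)) y \<le> op h (\<lambda>z. f s z + h * D s z + e / 3 * h) y"
        proof (intro op_mono)
          fix z assume "z \<in> E"
          then have "\<bar>f (s + h) z - f s z - (s + h - s) * D s z\<bar> \<le> e / 3 * (s + h - s)"
            using \<delta>(2)[rule_format, of s "s + h" z] s h by simp
          moreover have "s + h - s = h" by simp
          ultimately show "f (s + h) z \<le> f s z + h * D s z + e / 3 * h"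
            by (metis abs_le_D1 diff_le_eq add.commute add.assoc)
        qed (use h y ig in auto)
        also have "\<dots> = op h (f s) y + h * op h (D s) y + e / 3 * h"
          using ig by (simp add: semigroup_op_def prob_space)
        also have "op h (f s) y \<le> f s y + h * (A s y + e / 3)"
        proof -
          have "(op h (f s) y - f s y) / h \<le> A s y + e / 3"
            using elim(1)[rule_format, OF y] unfolding abs_less_iff by linarith
          then show ?thesis using h by (simp add: field_simps)
        qed
        also have "h * op h (D s) y \<le> h * (D s y + e / 3)"
          using elim(2)[rule_format, OF y] h by (intro mult_left_mono) linarith+
        finally have "op h (f (s + h)) y \<le> f s y + h * (A s y + D s y) + e * h"
          by (simp add: algebra_simps)
        also have "h * (A s y + D s y) \<le> h * e0"
          using err[of s y] s y h by (intro mult_left_mono) auto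
        finally show ?thesis by (simp add: algebra_simps)
      qed
      interpret prob_space "P s x" using s x by (intro kernel_prob_space)
      have ig: "integrable (P s x) (f s)" "integrable (P s x) (op h (f (s + h)))"
        using s x h fs by (auto intro!: integrable_C0 op_C0)
      have "op (s + h) (f (s + h)) x = op s (op h (f (s + h))) x"
        using s h fs by (intro op_sum) auto
      also have "\<dots> \<le> op s (\<lambda>y. f s y + (e0 + e) * h) x"
        using s x ig key by (intro op_mono) auto
      also have "\<dots> = op s (f s) x + (e0 + e) * h"
        using ig by (simp add: semigroup_op_def prob_space)
      finally show ?case by (simp add: \<phi>_def algebra_simps)
    qed
  qed
  have "\<phi> T \<le> \<phi> 0"
    by (rule nonincreasing_of_right_increments[OF T cont incr])
  then show ?thesis
    using op_0[OF x C0_on_measurable[OF fC0[of 0]]] T by (simp add: \<phi>_def)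
qed

text \<open>The one-sided bound is applied to \<open>f\<close> and to its negative. In the intended
  use \<open>f s\<close> is a function evolved by another semigroup over the remaining time
  \<open>T - s\<close>; then \<open>A s + D s\<close> is the difference of the two generators
  applied to \<open>f s\<close>, so closeness of generators becomes closeness of semigroups.\<close>

lemma duhamel:
  fixes f A D :: "real \<Rightarrow> 'a \<Rightarrow> real"
  assumes T: "0 \<le> T" and x: "x \<in> E"
    and gen: "\<And>s. 0 \<le> s \<Longrightarrow> s \<le> T \<Longrightarrow> has_generator_value E P (f s) (A s)"
    and D: "\<And>s. 0 \<le> s \<Longrightarrow> s \<le> T \<Longrightarrow> D s \<in> C0_on E"
    and diff: "\<And>e. e > 0 \<Longrightarrow> \<exists>\<delta>>0. \<forall>s r. 0 \<le> s \<longrightarrow> s \<le> r \<longrightarrow> r \<le> T \<longrightarrow> r \<le> s + \<delta> \<longrightarrow>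
      (\<forall>y\<in>E. \<bar>f r y - f s y - (r - s) * D s y\<bar> \<le> e * (r - s))"
    and bound: "\<And>s y. 0 \<le> s \<Longrightarrow> s \<le> T \<Longrightarrow> y \<in> E \<Longrightarrow> \<bar>D s y\<bar> \<le> B"
    and err: "\<And>s y. 0 \<le> s \<Longrightarrow> s \<le> T \<Longrightarrow> y \<in> E \<Longrightarrow> \<bar>A s y + D s y\<bar> \<le> e0"
  shows "\<bar>op T (f T) x - f 0 x\<bar> \<le> e0 * T"
proof -
  have 1: "op T (f T) x \<le> f 0 x + e0 * T"
    using err by (intro duhamel_le[OF T x gen D diff bound]) (auto simp: abs_le_iff)
  have eq: "\<bar>- f r y - - f s y - (r - s) * - D s y\<bar> = \<bar>f r y - f s y - (r - s) * D s y\<bar>" for r s y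
    by (simp add: abs_if algebra_simps)
  have 2: "op T (\<lambda>y. - f T y) x \<le> - f 0 x + e0 * T"
  proof (rule duhamel_le[where f = "\<lambda>s y. - f s y" and A = "\<lambda>s y. - A s y" and D = "\<lambda>s y. - D s y" and B = B])
    fix e :: real assume "e > 0"
    from diff[OF this] show "\<exists>\<delta>>0. \<forall>s r. 0 \<le> s \<longrightarrow> s \<le> r \<longrightarrow> r \<le> T \<longrightarrow> r \<le> s + \<delta> \<longrightarrow>
      (\<forall>y\<in>E. \<bar>- f r y - - f s y - (r - s) * - D s y\<bar> \<le> e * (r - s))" unfolding eq .
  next
    fix s y assume "0 \<le> s" "s \<le> T" "y \<in> E"
    then show "- A s y + - D s y \<le> e0" using err[of s y] by (simp add: abs_le_iff)
  qed (use T x gen D bound in \<open>auto intro: has_generator_value_uminus C0_on_uminus\<close>)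
  show ?thesis using 1 2 by (simp add: semigroup_op_def abs_le_iff)
qed

end

section \<open>Gaussians under the Ornstein-Uhlenbeck semigroup\<close>

text \<open>The constant sits in the exponent, so that products and the semigroup act on the
  parameters \<open>a\<close>, \<open>b\<close>, \<open>c\<close> alone.\<close>

definition gauss :: "real \<Rightarrow> real \<Rightarrow> real \<Rightarrow> real \<Rightarrow> real" where
  "gauss a b c x = exp (c + b * x - a * x\<^sup>2)"

definition gauss' :: "real \<Rightarrow> real \<Rightarrow> real \<Rightarrow> real \<Rightarrow> real" where
  "gauss' a b c x = (b - 2 * a * x) * gauss a b c x"

definition gauss'' :: "real \<Rightarrow> real \<Rightarrow> real \<Rightarrow> real \<Rightarrow> real" where
  "gauss'' a b c x = ((b - 2 * a * x)\<^sup>2 - 2 * a) * gauss a b c x"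

text \<open>The Ornstein-Uhlenbeck generator applied to \<open>gauss a b c\<close>.\<close>

definition gaussL :: "real \<Rightarrow> real \<Rightarrow> real \<Rightarrow> real \<Rightarrow> real" where
  "gaussL a b c x = gauss'' a b c x - x * gauss' a b c x"

lemma gauss_pos [simp]: "0 < gauss a b c x"
  by (simp add: gauss_def)

lemma DERIV_gauss: "(gauss a b c has_real_derivative gauss' a b c x) (at x)"
  unfolding gauss_def[abs_def] gauss'_def gauss_def
  by (rule derivative_eq_intros refl | simp)+

lemma DERIV_gauss': "(gauss' a b c has_real_derivative gauss'' a b c x) (at x)"
  unfolding gauss'_def[abs_def] gauss''_def
  by (rule derivative_eq_intros DERIV_gauss refl | simp)+
     (simp add: gauss'_def power2_eq_square algebra_simps)

lemma continuous_on_gauss'': "continuous_on A (gauss'' a b c)"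
  unfolding gauss''_def[abs_def] gauss_def by (intro continuous_intros)

text \<open>The Ornstein-Uhlenbeck semigroup maps \<open>gauss a b c\<close> to another function of this shape;
  the parameters below solve \<open>a' = - 4 a\<^sup>2 - 2 a\<close>, \<open>b' = - 4 a b - b\<close>, \<open>c' = b\<^sup>2 - 2 a\<close>.\<close>

definition ou_den :: "real \<Rightarrow> real \<Rightarrow> real" where
  "ou_den a t = 1 + 2 * a * (1 - exp (- 2 * t))"

definition ou_a :: "real \<Rightarrow> real \<Rightarrow> real" where
  "ou_a a t = a * exp (- 2 * t) / ou_den a t"

definition ou_b :: "real \<Rightarrow> real \<Rightarrow> real \<Rightarrow> real" where
  "ou_b a b t = b * exp (- t) / ou_den a t"

definition ou_c :: "real \<Rightarrow> real \<Rightarrow> real \<Rightarrow> real \<Rightarrow> real" where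
  "ou_c a b c t = c - ln (ou_den a t) / 2 + b\<^sup>2 * (1 - exp (- 2 * t)) / (2 * ou_den a t)"

text \<open>Mehler's formula: from \<open>x\<close> the process at time \<open>t\<close> is normal
  with mean \<open>x exp (- t)\<close> and variance \<open>1 - exp (- 2 t)\<close>, and integrating
  \<open>gauss a b c\<close> against this law yields these parameters, with \<open>ou_den\<close>
  equal to 1 plus \<open>2 a\<close> times the variance.\<close>

definition ou_gauss :: "real \<Rightarrow> real \<Rightarrow> real \<Rightarrow> real \<Rightarrow> real \<Rightarrow> real" where
  "ou_gauss a b c t = gauss (ou_a a t) (ou_b a b t) (ou_c a b c t)"

lemma ou_params_0 [simp]: "ou_a a 0 = a" "ou_b a b 0 = b" "ou_c a b c 0 = c"
  by (simp_all add: ou_a_def ou_b_def ou_c_def ou_den_def)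

lemma ou_den_ge_1: "0 \<le> a \<Longrightarrow> 0 \<le> t \<Longrightarrow> 1 \<le> ou_den a t"
  by (simp add: ou_den_def)

lemma ou_a_pos: "0 < a \<Longrightarrow> 0 \<le> t \<Longrightarrow> 0 < ou_a a t"
  using ou_den_ge_1[of a t] by (simp add: ou_a_def)

lemma ou_a_bounds:
  assumes "0 < a" "0 \<le> t"
  shows "0 \<le> ou_a a t" "ou_a a t \<le> a"
proof -
  show "0 \<le> ou_a a t" using ou_a_pos[OF assms] by simp
  have "a * exp (- 2 * t) / ou_den a t \<le> a * 1 / 1"
    using assms ou_den_ge_1[of a t] by (intro frac_le mult_left_mono) auto
  then show "ou_a a t \<le> a" by (simp add: ou_a_def)
qed

lemma abs_ou_b_le:
  assumes "0 < a" "0 \<le> t"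
  shows "\<bar>ou_b a b t\<bar> \<le> \<bar>b\<bar>"
proof -
  have D: "ou_den a t \<ge> 1" using assms by (intro ou_den_ge_1) auto
  then have "\<bar>b\<bar> * exp (- t) / ou_den a t \<le> \<bar>b\<bar> * 1 / 1"
    using assms by (intro frac_le mult_left_mono) auto
  then show ?thesis using D by (simp add: ou_b_def abs_mult)
qed

lemma DERIV_ou_den: "(ou_den a has_real_derivative 4 * a * exp (- 2 * t)) (at t)"
  unfolding ou_den_def[abs_def] by (rule derivative_eq_intros refl | simp)+

lemma DERIV_ou_params:
  assumes "0 < a" "0 \<le> t"
  shows "(ou_a a has_real_derivative - 4 * (ou_a a t)\<^sup>2 - 2 * ou_a a t) (at t)"
    and "(ou_b a b has_real_derivative - 4 * ou_a a t * ou_b a b t - ou_b a b t) (at t)"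
    and "(ou_c a b c has_real_derivative (ou_b a b t)\<^sup>2 - 2 * ou_a a t) (at t)"
proof -
  define X where "X = exp (- t)"
  have X: "exp (- 2 * t) = X\<^sup>2" by (simp add: X_def exp_double[symmetric])
  define D where "D = ou_den a t"
  have D: "ou_den a t = D" "D > 0" using ou_den_ge_1[of a t] assms by (auto simp: D_def)
  \<comment> \<open>The definition of \<open>ou_den\<close> solved for \<open>1 - X^2\<close>; it
    collapses the numerator of the quotient rule for \<open>ou_c\<close> to
    \<open>4 b^2 X^2\<close>.\<close>
  have Deq: "2 * a * (1 - X\<^sup>2) = D - 1" unfolding D_def ou_den_def X by simp
  have dD: "(ou_den a has_real_derivative 4 * a * X\<^sup>2) (at t)"
    using DERIV_ou_den[of a t] unfolding X .
  have dX: "((\<lambda>t. exp (- t)) has_real_derivative - X) (at t)"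
    unfolding X_def by (rule derivative_eq_intros refl | simp)+
  have dX2: "((\<lambda>t. exp (- 2 * t)) has_real_derivative - 2 * X\<^sup>2) (at t)"
    unfolding X[symmetric] by (rule derivative_eq_intros refl | simp)+
  have ne: "ou_den a t \<noteq> 0" using D by simp
  show "(ou_a a has_real_derivative - 4 * (ou_a a t)\<^sup>2 - 2 * ou_a a t) (at t)"
    unfolding ou_a_def
    by (rule DERIV_cong[OF DERIV_divide[OF DERIV_cmult[OF dX2] dD ne]])
       (unfold X D(1), use D in \<open>simp add: field_simps power2_eq_square\<close>)
  show "(ou_b a b has_real_derivative - 4 * ou_a a t * ou_b a b t - ou_b a b t) (at t)"
    unfolding ou_b_def ou_a_def
    by (rule DERIV_cong[OF DERIV_divide[OF DERIV_cmult[OF dX] dD ne]])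
       (unfold X X_def[symmetric] D(1), use D in \<open>simp add: field_simps power2_eq_square\<close>)
  have dln: "((\<lambda>t. ln (ou_den a t) / 2) has_real_derivative 2 * a * X\<^sup>2 / D) (at t)"
    using DERIV_cdivide[OF DERIV_chain2[OF DERIV_ln_divide dD], of 2] D by (simp add: mult.assoc)
  have "((\<lambda>t. b\<^sup>2 * (1 - exp (- 2 * t)) / (2 * ou_den a t)) has_real_derivative
      (b\<^sup>2 * (0 - - 2 * X\<^sup>2) * (2 * D) - b\<^sup>2 * (1 - X\<^sup>2) * (2 * (4 * a * X\<^sup>2))) /
      (2 * D * (2 * D))) (at t)"
    by (rule DERIV_cong[OF DERIV_divide[OF DERIV_cmult[OF DERIV_diff[OF DERIV_const dX2]]
        DERIV_cmult[OF dD]]]) (unfold X D(1), use D in simp_all)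
  moreover have "b\<^sup>2 * (0 - - 2 * X\<^sup>2) * (2 * D) - b\<^sup>2 * (1 - X\<^sup>2) * (2 * (4 * a * X\<^sup>2)) =
      4 * b\<^sup>2 * X\<^sup>2"
    using Deq by algebra
  ultimately have "((\<lambda>t. b\<^sup>2 * (1 - exp (- 2 * t)) / (2 * ou_den a t)) has_real_derivative
      (b * X / D)\<^sup>2) (at t)"
    using D by (simp add: power2_eq_square mult.commute mult.left_commute)
  from DERIV_add[OF DERIV_diff[OF DERIV_const dln, of c] this]
  show "(ou_c a b c has_real_derivative (ou_b a b t)\<^sup>2 - 2 * ou_a a t) (at t)"
    unfolding ou_c_def ou_a_def ou_b_def X X_def[symmetric] D(1) by (simp add: mult.assoc)
qed

definition ou_gaussL :: "real \<Rightarrow> real \<Rightarrow> real \<Rightarrow> real \<Rightarrow> real \<Rightarrow> real" where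
  "ou_gaussL a b c t = gaussL (ou_a a t) (ou_b a b t) (ou_c a b c t)"

text \<open>The backward equation: the time derivative is the generator in space. Comparing the
  coefficients of 1, \<open>x\<close> and \<open>x^2\<close> in front of the Gaussian gives exactly
  the differential equations of the three parameters.\<close>

lemma DERIV_ou_gauss_time:
  assumes "0 < a" "0 \<le> t"
  shows "((\<lambda>t. ou_gauss a b c t x) has_real_derivative ou_gaussL a b c t x) (at t)"
  unfolding ou_gauss_def gauss_def
  by (rule derivative_eq_intros DERIV_ou_params assms refl | simp)+
     (simp add: ou_gaussL_def gaussL_def gauss''_def gauss'_def gauss_def power2_eq_square algebra_simps)

lemma continuous_on_ou_gaussL:
  assumes "0 < a"
  shows "continuous_on ({0..} \<times> UNIV) (\<lambda>(t, x). ou_gaussL a b c t x)"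
proof -
  have *: "continuous_on ({0..} \<times> (UNIV::real set)) (\<lambda>p. f (fst p))"
    if "\<And>t. 0 \<le> t \<Longrightarrow> (f has_real_derivative g t) (at t)" for f g
  proof -
    have "continuous_on {0..} f"
      using that by (auto intro!: continuous_at_imp_continuous_on DERIV_isCont)
    then show ?thesis
      by (rule continuous_on_compose2[OF _ continuous_on_fst]) (auto intro: continuous_intros)
  qed
  show ?thesis
    unfolding ou_gaussL_def gaussL_def gauss''_def gauss'_def gauss_def case_prod_beta
    using assms
    by (intro continuous_intros *[OF DERIV_ou_params(1)] *[OF DERIV_ou_params(2)] *[OF DERIV_ou_params(3)])
qed

section \<open>Decay of evolved Gaussians, uniform on bounded time intervals\<close>

lemma abs_le_one_plus_square: "\<bar>x\<bar> \<le> 1 + (x::real)\<^sup>2"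
proof -
  have "0 \<le> (\<bar>x\<bar> - 1)\<^sup>2" by simp
  then have "2 * \<bar>x\<bar> \<le> 1 + x\<^sup>2" by (simp add: power2_diff)
  then show ?thesis by simp
qed

text \<open>With \<open>m\<close> as chosen,
  \<open>m (1 + x^2) \<le> 1 + k / 3 x^2 \<le> exp (k / 3 x^2)\<close>; cubing this and dividing
  gives the bound.\<close>

lemma polynomial_times_gauss_bounded:
  fixes k :: real
  assumes "k > 0"
  obtains C where "C > 0" "\<And>x. (1 + x\<^sup>2) ^ 3 * exp (- k * x\<^sup>2) \<le> C"
proof
  define m where "m = min 1 (k / 3)"
  have m: "m > 0" "m \<le> 1" "m \<le> k / 3" using assms by (auto simp: m_def)
  show "1 / m ^ 3 > 0" using m by simp
  fix x :: real
  have "m * (1 + x\<^sup>2) \<le> 1 + k / 3 * x\<^sup>2"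
    using m mult_right_mono[of m "k / 3" "x\<^sup>2"] by (simp add: algebra_simps)
  also have "\<dots> \<le> exp (k / 3 * x\<^sup>2)" by (rule exp_ge_add_one_self)
  finally have "(m * (1 + x\<^sup>2)) ^ 3 \<le> exp (k / 3 * x\<^sup>2) ^ 3"
    using m by (intro power_mono) auto
  also have "\<dots> = exp (k * x\<^sup>2)" by (simp add: exp_of_nat_mult[symmetric])
  finally have "m ^ 3 * (1 + x\<^sup>2) ^ 3 \<le> exp (k * x\<^sup>2)" by (simp add: power_mult_distrib)
  then have "m ^ 3 * (1 + x\<^sup>2) ^ 3 * exp (- k * x\<^sup>2) \<le> exp (k * x\<^sup>2) * exp (- k * x\<^sup>2)"
    by (intro mult_right_mono) auto
  also have "\<dots> = 1" by (simp add: exp_add[symmetric])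
  finally show "(1 + x\<^sup>2) ^ 3 * exp (- k * x\<^sup>2) \<le> 1 / m ^ 3"
    using m by (simp add: field_simps)
qed

text \<open>On \<open>[0, T]\<close> the quadratic coefficient is at least \<open>k\<close>, the
  linear one at most \<open>\<bar>b\<bar>\<close> in modulus and the constant one bounded above, so
  one Gaussian dominates all of them. The third power leaves room for the polynomial prefactors of
  the derivatives and for one further weight \<open>1 + x^2\<close>.\<close>

lemma ou_gauss_decay:
  assumes a: "0 < a"
  obtains C where "C > 0" "\<And>t x. 0 \<le> t \<Longrightarrow> t \<le> T \<Longrightarrow> (1 + x\<^sup>2) ^ 3 * ou_gauss a b c t x \<le> C"
proof -
  define k where "k = a * exp (- 2 * T) / (1 + 2 * a)"
  have k: "k > 0" using a by (simp add: k_def)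
  obtain C where C: "C > 0" "\<And>x. (1 + x\<^sup>2) ^ 3 * exp (- (k / 2) * x\<^sup>2) \<le> C"
    using polynomial_times_gauss_bounded[of "k / 2"] k by auto
  define K where "K = exp (c + b\<^sup>2 / 2 + b\<^sup>2 / (2 * k))"
  show ?thesis
  proof (rule that[of "C * K"])
    show "C * K > 0" using C by (simp add: K_def)
    fix t x :: real assume t: "0 \<le> t" "t \<le> T"
    have D: "ou_den a t \<ge> 1" "ou_den a t \<le> 1 + 2 * a"
      using ou_den_ge_1[of a t] a t by (auto simp: ou_den_def algebra_simps)
    have 1: "k \<le> ou_a a t"
      unfolding k_def ou_a_def using a t D by (intro frac_le mult_left_mono) auto
    note 2 = abs_ou_b_le[OF a t(1), of b]
    have 3: "ou_c a b c t \<le> c + b\<^sup>2 / 2"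
    proof -
      have "b\<^sup>2 * (1 - exp (- 2 * t)) / (2 * ou_den a t) \<le> b\<^sup>2 * 1 / (2 * 1)"
        using t D by (intro frac_le mult_left_mono mult_nonneg_nonneg) auto
      moreover have "ln (ou_den a t) \<ge> 0" using D by simp
      ultimately show ?thesis by (simp add: ou_c_def)
    qed
    \<comment> \<open>Young's inequality: half of the quadratic decay \<open>k x^2\<close> pays for
      the linear term.\<close>
    have 4: "ou_b a b t * x \<le> k / 2 * x\<^sup>2 + b\<^sup>2 / (2 * k)"
    proof -
      have "ou_b a b t * x \<le> \<bar>b\<bar> * \<bar>x\<bar>"
        using 2 mult_right_mono[OF 2, of "\<bar>x\<bar>"] abs_le_D1[of "ou_b a b t * x" "\<bar>ou_b a b t\<bar> * \<bar>x\<bar>"]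
        by (simp add: abs_mult)
      also have "\<dots> \<le> k / 2 * x\<^sup>2 + b\<^sup>2 / (2 * k)"
      proof -
        have "0 \<le> (k * \<bar>x\<bar> - \<bar>b\<bar>)\<^sup>2 / (2 * k)" using k by simp
        also have "\<dots> = k / 2 * x\<^sup>2 + b\<^sup>2 / (2 * k) - \<bar>b\<bar> * \<bar>x\<bar>"
          using k by (simp add: power2_diff power_mult_distrib field_simps power2_eq_square)
        finally show ?thesis by simp
      qed
      finally show ?thesis .
    qed
    have 5: "k * x\<^sup>2 \<le> ou_a a t * x\<^sup>2" using 1 by (intro mult_right_mono) auto
    have "ou_gauss a b c t x \<le> K * exp (- (k / 2) * x\<^sup>2)"
      unfolding ou_gauss_def gauss_def K_def exp_add[symmetric] exp_le_cancel_iff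
      using 3 4 5 by linarith
    then have "(1 + x\<^sup>2) ^ 3 * ou_gauss a b c t x \<le> (1 + x\<^sup>2) ^ 3 * (K * exp (- (k / 2) * x\<^sup>2))"
      by (intro mult_left_mono) auto
    also have "\<dots> = ((1 + x\<^sup>2) ^ 3 * exp (- (k / 2) * x\<^sup>2)) * K" by simp
    also have "\<dots> \<le> C * K" by (intro mult_right_mono C(2)) (simp add: K_def)
    finally show "(1 + x\<^sup>2) ^ 3 * ou_gauss a b c t x \<le> C * K" .
  qed
qed

definition ou_gauss' :: "real \<Rightarrow> real \<Rightarrow> real \<Rightarrow> real \<Rightarrow> real \<Rightarrow> real" where
  "ou_gauss' a b c t = gauss' (ou_a a t) (ou_b a b t) (ou_c a b c t)"

definition ou_gauss'' :: "real \<Rightarrow> real \<Rightarrow> real \<Rightarrow> real \<Rightarrow> real \<Rightarrow> real" where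
  "ou_gauss'' a b c t = gauss'' (ou_a a t) (ou_b a b t) (ou_c a b c t)"

lemma ou_gaussL_eq: "ou_gaussL a b c t x = ou_gauss'' a b c t x - x * ou_gauss' a b c t x"
  by (simp add: ou_gaussL_def gaussL_def ou_gauss'_def ou_gauss''_def)

text \<open>The weight \<open>1 + x^2\<close> is what makes error terms such as
  \<open>x g' / d\<close> and \<open>x^2 g'' / d\<close>, and the terms created by a cutoff, bounded
  independently of \<open>x\<close>.\<close>

lemma ou_gauss_bounds:
  assumes a: "0 < a"
  obtains C where "C > 0"
    "\<And>t x. 0 \<le> t \<Longrightarrow> t \<le> T \<Longrightarrow> (1 + x\<^sup>2) * ou_gauss a b c t x \<le> C"
    "\<And>t x. 0 \<le> t \<Longrightarrow> t \<le> T \<Longrightarrow> (1 + x\<^sup>2) * \<bar>ou_gauss' a b c t x\<bar> \<le> C"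
    "\<And>t x. 0 \<le> t \<Longrightarrow> t \<le> T \<Longrightarrow> (1 + x\<^sup>2) * \<bar>ou_gauss'' a b c t x\<bar> \<le> C"
    "\<And>t x. 0 \<le> t \<Longrightarrow> t \<le> T \<Longrightarrow> (1 + x\<^sup>2) * \<bar>ou_gaussL a b c t x\<bar> \<le> C"
proof -
  obtain C where C: "C > 0" "\<And>t x. 0 \<le> t \<Longrightarrow> t \<le> T \<Longrightarrow> (1 + x\<^sup>2) ^ 3 * ou_gauss a b c t x \<le> C"
    using ou_gauss_decay[OF a] by metis
  \<comment> \<open>\<open>m1 (1 + x^2)\<close> bounds the prefactor \<open>p\<close> of the first
    derivative as well as \<open>x p\<close>; \<open>m2 (1 + x^2)\<close> bounds the prefactor
    \<open>p^2 - 2 a\<close> of the second, where \<open>a\<close> stands for the evolved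
    coefficient.\<close>
  define m1 where "m1 = \<bar>b\<bar> + 2 * a"
  define m2 where "m2 = 2 * b\<^sup>2 + 8 * a\<^sup>2 + 2 * a"
  define m where "m = 1 + m1 + m2"
  have m: "m1 \<ge> 0" "m2 \<ge> 0" "m \<ge> 1" "m1 \<le> m" "m2 \<le> m" "m1 + m2 \<le> m"
    using a by (auto simp: m1_def m2_def m_def)
  have key: "(1 + x\<^sup>2) * \<bar>z\<bar> \<le> C * m" if t: "0 \<le> t" "t \<le> T" and z: "\<bar>z\<bar> \<le> m * (1 + x\<^sup>2)\<^sup>2 * ou_gauss a b c t x"
    for t x z
  proof -
    have "(1 + x\<^sup>2) * \<bar>z\<bar> \<le> (1 + x\<^sup>2) * (m * (1 + x\<^sup>2)\<^sup>2 * ou_gauss a b c t x)"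
      using z by (intro mult_left_mono) auto
    also have "\<dots> = ((1 + x\<^sup>2) ^ 3 * ou_gauss a b c t x) * m"
      by (simp add: power3_eq_cube power2_eq_square)
    also have "\<dots> \<le> C * m" using m by (intro mult_right_mono C t) auto
    finally show ?thesis .
  qed
  have *: "\<bar>ou_gauss a b c t x\<bar> \<le> m * (1 + x\<^sup>2)\<^sup>2 * ou_gauss a b c t x"
       "\<bar>ou_gauss' a b c t x\<bar> \<le> m * (1 + x\<^sup>2)\<^sup>2 * ou_gauss a b c t x"
       "\<bar>ou_gauss'' a b c t x\<bar> \<le> m * (1 + x\<^sup>2)\<^sup>2 * ou_gauss a b c t x"
       "\<bar>ou_gaussL a b c t x\<bar> \<le> m * (1 + x\<^sup>2)\<^sup>2 * ou_gauss a b c t x"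
    if t: "0 \<le> t" "t \<le> T" for t x
  proof -
    have pos: "ou_gauss a b c t x > 0" by (simp add: ou_gauss_def)
    note A = ou_a_bounds[OF a t(1)] and B = abs_ou_b_le[OF a t(1), of b]
    note x1 = abs_le_one_plus_square[of x]
    have s1: "1 \<le> 1 + x\<^sup>2" by simp
    have s2: "1 + x\<^sup>2 \<le> (1 + x\<^sup>2)\<^sup>2" using mult_left_mono[OF s1, of "1 + x\<^sup>2"] by (simp add: power2_eq_square)
    define p where "p = ou_b a b t - 2 * ou_a a t * x"
    have "\<bar>p\<bar> \<le> \<bar>ou_b a b t\<bar> + \<bar>2 * ou_a a t * x\<bar>" unfolding p_def by (rule abs_triangle_ineq4)
    also have "\<dots> \<le> \<bar>b\<bar> + 2 * a * \<bar>x\<bar>"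
      using A B by (intro add_mono) (auto simp: abs_mult mult_right_mono)
    finally have p: "\<bar>p\<bar> \<le> \<bar>b\<bar> + 2 * a * \<bar>x\<bar>" .
    have p1: "\<bar>p\<bar> \<le> m1 * (1 + x\<^sup>2)"
    proof -
      have "0 \<le> \<bar>b\<bar> * x\<^sup>2" by simp
      moreover have "2 * a * \<bar>x\<bar> \<le> 2 * a * (1 + x\<^sup>2)" using a by (intro mult_left_mono x1) auto
      moreover have "m1 * (1 + x\<^sup>2) = \<bar>b\<bar> + \<bar>b\<bar> * x\<^sup>2 + 2 * a * (1 + x\<^sup>2)"
        by (simp add: m1_def algebra_simps)
      ultimately show ?thesis using p by linarith
    qed
    have px: "\<bar>x * p\<bar> \<le> m1 * (1 + x\<^sup>2)"
    proof -
      have "\<bar>x * p\<bar> \<le> \<bar>x\<bar> * (\<bar>b\<bar> + 2 * a * \<bar>x\<bar>)"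
        unfolding abs_mult by (intro mult_left_mono p) auto
      also have "\<dots> = \<bar>b\<bar> * \<bar>x\<bar> + 2 * a * x\<^sup>2" by (simp add: algebra_simps power2_eq_square)
      also have "\<dots> \<le> \<bar>b\<bar> * (1 + x\<^sup>2) + 2 * a * (1 + x\<^sup>2)"
        using a by (intro add_mono mult_left_mono x1) auto
      finally show ?thesis by (simp add: m1_def algebra_simps)
    qed
    have pp: "\<bar>p\<^sup>2 - 2 * ou_a a t\<bar> \<le> m2 * (1 + x\<^sup>2)"
    proof -
      have "p\<^sup>2 \<le> (\<bar>b\<bar> + 2 * a * \<bar>x\<bar>)\<^sup>2" using p by (metis abs_ge_zero power2_abs power_mono)
      also have "\<dots> \<le> 2 * b\<^sup>2 + 8 * a\<^sup>2 * x\<^sup>2"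
      proof -
        have "0 \<le> (\<bar>b\<bar> - 2 * a * \<bar>x\<bar>)\<^sup>2" by simp
        then show ?thesis by (simp add: power2_diff power2_sum power_mult_distrib)
      qed
      finally have "p\<^sup>2 \<le> 2 * b\<^sup>2 + 8 * a\<^sup>2 * x\<^sup>2" .
      moreover have "\<bar>p\<^sup>2 - 2 * ou_a a t\<bar> \<le> p\<^sup>2 + 2 * a" using A zero_le_power2[of p] by linarith
      moreover have "0 \<le> 2 * b\<^sup>2 * x\<^sup>2 + 8 * a\<^sup>2 + 2 * a * x\<^sup>2" using a by simp
      ultimately show ?thesis unfolding m2_def by (simp add: algebra_simps)
    qed
    have up: "\<bar>q * ou_gauss a b c t x\<bar> \<le> m * (1 + x\<^sup>2)\<^sup>2 * ou_gauss a b c t x"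
      if "\<bar>q\<bar> \<le> m * (1 + x\<^sup>2)" for q
    proof -
      have "\<bar>q\<bar> \<le> m * (1 + x\<^sup>2)\<^sup>2"
        using that mult_left_mono[OF s2, of m] m by linarith
      then show ?thesis using pos by (simp add: abs_mult mult_right_mono)
    qed
    have mono: "m1 * (1 + x\<^sup>2) \<le> m * (1 + x\<^sup>2)" "m2 * (1 + x\<^sup>2) \<le> m * (1 + x\<^sup>2)"
      "(m1 + m2) * (1 + x\<^sup>2) \<le> m * (1 + x\<^sup>2)" "1 * 1 \<le> m * (1 + x\<^sup>2)"
      using m s1 by (intro mult_right_mono mult_mono; simp)+
    show "\<bar>ou_gauss a b c t x\<bar> \<le> m * (1 + x\<^sup>2)\<^sup>2 * ou_gauss a b c t x"
      using up[of 1] mono by simp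
    have e1: "ou_gauss' a b c t x = p * ou_gauss a b c t x"
      by (simp add: ou_gauss'_def gauss'_def ou_gauss_def p_def)
    have e2: "ou_gauss'' a b c t x = (p\<^sup>2 - 2 * ou_a a t) * ou_gauss a b c t x"
      by (simp add: ou_gauss''_def gauss''_def ou_gauss_def p_def)
    have e3: "ou_gaussL a b c t x = (p\<^sup>2 - 2 * ou_a a t - x * p) * ou_gauss a b c t x"
      by (simp add: ou_gaussL_eq e1 e2 algebra_simps)
    show "\<bar>ou_gauss' a b c t x\<bar> \<le> m * (1 + x\<^sup>2)\<^sup>2 * ou_gauss a b c t x"
      unfolding e1 using p1 mono by (intro up) linarith
    show "\<bar>ou_gauss'' a b c t x\<bar> \<le> m * (1 + x\<^sup>2)\<^sup>2 * ou_gauss a b c t x"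
      unfolding e2 using pp mono by (intro up) linarith
    have "\<bar>p\<^sup>2 - 2 * ou_a a t - x * p\<bar> \<le> \<bar>p\<^sup>2 - 2 * ou_a a t\<bar> + \<bar>x * p\<bar>" by (rule abs_triangle_ineq4)
    also have "\<dots> \<le> (m1 + m2) * (1 + x\<^sup>2)" using pp px by (simp add: algebra_simps)
    finally show "\<bar>ou_gaussL a b c t x\<bar> \<le> m * (1 + x\<^sup>2)\<^sup>2 * ou_gauss a b c t x"
      unfolding e3 using mono by (intro up) linarith
  qed
  show ?thesis
  proof (rule that[of "C * m"])
    show "C * m > 0" using C m by simp
    fix t x :: real assume t: "0 \<le> t" "t \<le> T"
    have "ou_gauss a b c t x > 0" by (simp add: ou_gauss_def)
    then show "(1 + x\<^sup>2) * ou_gauss a b c t x \<le> C * m" using key[OF t *(1)[OF t, of x]] by simp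
  qed (use key * in blast)+
qed

lemma ou_gauss_time_uniform:
  assumes a: "0 < a" and e: "0 < e"
  obtains \<delta> where "\<delta> > 0"
    "\<And>s r x. s \<in> {0..T} \<Longrightarrow> r \<in> {0..T} \<Longrightarrow> \<bar>r - s\<bar> < \<delta> \<Longrightarrow>
      \<bar>ou_gauss a b c r x - ou_gauss a b c s x - (r - s) * ou_gaussL a b c s x\<bar> \<le> e * \<bar>r - s\<bar>"
proof -
  obtain C where C: "C > 0" "\<And>t x. 0 \<le> t \<Longrightarrow> t \<le> T \<Longrightarrow> (1 + x\<^sup>2) * \<bar>ou_gaussL a b c t x\<bar> \<le> C"
    using ou_gauss_bounds[OF a] by metis
  \<comment> \<open>Beyond \<open>R\<close> the weight exceeds \<open>2 C / e\<close>, so each value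
    of the time derivative is at most \<open>e / 2\<close>; inside, uniform continuity on a compact
    rectangle applies. Together they give a modulus in time that is uniform on the whole
    line.\<close>
  define R where "R = 1 + 2 * C / e"
  have R: "R \<ge> 1" using C e by (simp add: R_def)
  define S where "S = {0..T} \<times> {-R..R}"
  have "uniformly_continuous_on S (\<lambda>(t, x). ou_gaussL a b c t x)"
    unfolding S_def
    by (intro compact_uniformly_continuous continuous_on_subset[OF continuous_on_ou_gaussL[OF a]]
        compact_Times compact_Icc) auto
  then obtain \<delta> where \<delta>: "\<delta> > 0" "\<And>p q. p \<in> S \<Longrightarrow> q \<in> S \<Longrightarrow> dist q p < \<delta> \<Longrightarrow>
      dist (case q of (t, x) \<Rightarrow> ou_gaussL a b c t x) (case p of (t, x) \<Rightarrow> ou_gaussL a b c t x) < e"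
    using e unfolding uniformly_continuous_on_def by metis
  have close: "\<bar>ou_gaussL a b c r x - ou_gaussL a b c s x\<bar> \<le> e"
    if sr: "s \<in> {0..T}" "r \<in> {0..T}" "\<bar>r - s\<bar> < \<delta>" for s r x
  proof (cases "\<bar>x\<bar> \<le> R")
    case True
    then have "dist (ou_gaussL a b c r x) (ou_gaussL a b c s x) < e"
      using \<delta>(2)[of "(s, x)" "(r, x)"] sr by (auto simp: S_def dist_Pair_Pair dist_real_def abs_le_iff)
    then show ?thesis by (simp add: dist_real_def)
  next
    case False
    have small: "\<bar>ou_gaussL a b c t x\<bar> \<le> e / 2" if "t \<in> {0..T}" for t
    proof -
      have "R \<le> R\<^sup>2" using R by (simp add: power2_eq_square)
      also have "R\<^sup>2 \<le> x\<^sup>2" using False R by (metis abs_le_square_iff abs_of_pos le_cases less_le_trans zero_less_one)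
      finally have "2 * C / e \<le> 1 + x\<^sup>2" by (simp add: R_def)
      then have "2 * C / e * \<bar>ou_gaussL a b c t x\<bar> \<le> (1 + x\<^sup>2) * \<bar>ou_gaussL a b c t x\<bar>"
        by (intro mult_right_mono) auto
      also have "\<dots> \<le> C" using C that by simp
      finally show ?thesis using C e by (simp add: field_simps)
    qed
    show ?thesis using small[of r] small[of s] sr by linarith
  qed
  show ?thesis
  proof (rule that[OF \<delta>(1)])
    fix s r x :: real assume s: "s \<in> {0..T}" and r: "r \<in> {0..T}" and d: "\<bar>r - s\<bar> < \<delta>"
    define I where "I = {0..T} \<inter> ball s \<delta>"
    \<comment> \<open>Mean value inequality for the evolved Gaussian minus its tangent slope at time
      \<open>s\<close>, whose derivative is at most \<open>e\<close> near \<open>s\<close>.\<close>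
    have "norm ((ou_gauss a b c r x - r * ou_gaussL a b c s x) - (ou_gauss a b c s x - s * ou_gaussL a b c s x))
        \<le> e * norm (r - s)"
    proof (rule field_differentiable_bound)
      show "convex I" unfolding I_def by (intro convex_Int convex_real_interval convex_ball)
      fix z assume z: "z \<in> I"
      then show "((\<lambda>t. ou_gauss a b c t x - t * ou_gaussL a b c s x) has_real_derivative
          ou_gaussL a b c z x - ou_gaussL a b c s x) (at z within I)"
        by (auto simp: I_def intro!: derivative_eq_intros
            has_field_derivative_at_within[OF DERIV_ou_gauss_time[OF a]])
      show "norm (ou_gaussL a b c z x - ou_gaussL a b c s x) \<le> e"
        using close[OF s, of z x] z by (simp add: I_def dist_real_def abs_minus_commute)
    qed (use s r d \<delta> in \<open>auto simp: I_def dist_real_def\<close>)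
    then show "\<bar>ou_gauss a b c r x - ou_gauss a b c s x - (r - s) * ou_gaussL a b c s x\<bar> \<le> e * \<bar>r - s\<bar>"
      by (simp add: algebra_simps)
  qed
qed

section \<open>Projections of spherical Brownian motion\<close>

text \<open>The derivatives are carried along as functions, so that generators of compositions and
  products come out as explicit expressions.\<close>

definition C2_derivs :: "(real \<Rightarrow> real) \<Rightarrow> (real \<Rightarrow> real) \<Rightarrow> (real \<Rightarrow> real) \<Rightarrow> bool" where
  "C2_derivs f f' f'' \<longleftrightarrow> (\<forall>x. (f has_real_derivative f' x) (at x)) \<and>
     (\<forall>x. (f' has_real_derivative f'' x) (at x)) \<and> continuous_on UNIV f''"

lemma C2_derivs_continuous:
  assumes "C2_derivs f f' f''"
  shows "continuous_on A f" "continuous_on A f'" "continuous_on A f''"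
proof -
  show "continuous_on A f" "continuous_on A f'"
    using assms by (auto simp: C2_derivs_def intro!: continuous_at_imp_continuous_on DERIV_isCont)
  show "continuous_on A f''"
    using assms continuous_on_subset[of UNIV f'' A] by (simp add: C2_derivs_def)
qed

lemma C2_derivs_mult:
  assumes f: "C2_derivs f f' f''" and g: "C2_derivs g g' g''"
  shows "C2_derivs (\<lambda>x. f x * g x) (\<lambda>x. f' x * g x + f x * g' x)
    (\<lambda>x. f'' x * g x + 2 * (f' x * g' x) + f x * g'' x)"
  unfolding C2_derivs_def
proof (intro conjI allI)
  note cont = C2_derivs_continuous[OF f] C2_derivs_continuous[OF g]
  note der = f[unfolded C2_derivs_def] g[unfolded C2_derivs_def]
  show "((\<lambda>x. f x * g x) has_real_derivative f' x * g x + f x * g' x) (at x)" for x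
    using der by (auto intro!: derivative_eq_intros)
  show "((\<lambda>x. f' x * g x + f x * g' x) has_real_derivative
      f'' x * g x + 2 * (f' x * g' x) + f x * g'' x) (at x)" for x
  proof -
    have "((\<lambda>x. f' x * g x + f x * g' x) has_real_derivative
      (f'' x * g x + g' x * f' x) + (f' x * g' x + g'' x * f x)) (at x)"
      using der by (intro DERIV_add DERIV_mult) auto
    then show ?thesis by (simp add: algebra_simps)
  qed
  show "continuous_on UNIV (\<lambda>x. f'' x * g x + 2 * (f' x * g' x) + f x * g'' x)"
    by (intro continuous_intros cont)
qed

lemma C2_derivs_gauss: "C2_derivs (gauss a b c) (gauss' a b c) (gauss'' a b c)"
  by (simp add: C2_derivs_def DERIV_gauss DERIV_gauss' continuous_on_gauss'')

lemma C2_derivs_poly: "C2_derivs (poly p) (poly (pderiv p)) (poly (pderiv (pderiv p)))"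
  by (auto simp: C2_derivs_def poly_DERIV intro: continuous_intros)

lemma gaussL_eq_poly_gauss:
  "gaussL a b c = (\<lambda>x. poly [: b\<^sup>2 - 2 * a, - 4 * a * b - b, 4 * a\<^sup>2 + 2 * a :] x * gauss a b c x)"
  by (simp add: fun_eq_iff gaussL_def gauss''_def gauss'_def algebra_simps power2_eq_square)

text \<open>Only the existence of two derivatives matters: it places the time derivative of
  \<open>ou_gauss\<close>, composed with the projection or cut off, in the domain of a generator and
  thereby in \<open>C0_on\<close>, as Duhamel's formula requires.\<close>

lemma C2_derivs_gaussL: obtains f' f'' where "C2_derivs (gaussL a b c) f' f''"
  by (rule that, unfold gaussL_eq_poly_gauss, rule C2_derivs_mult[OF C2_derivs_poly C2_derivs_gauss])

text \<open>Changing one coordinate moves \<open>dotp d \<theta> x\<close> affinely, so each partial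
  derivative just produces a factor \<open>\<theta> i\<close>. The double sum then factors into the
  square of \<open>dotp d \<theta> x\<close>, and the Laplacian contributes
  \<open>dotp d \<theta> \<theta>\<close>.\<close>

lemma C2_derivs_compose_dotp:
  assumes f: "C2_derivs f f' f''"
  shows "(\<lambda>x. f (dotp d \<theta> x)) \<in> C2_Rn d"
    and "spherical_generator d (\<lambda>x. f (dotp d \<theta> x)) x =
      f'' (dotp d \<theta> x) * (dotp d \<theta> \<theta> - (dotp d \<theta> x)\<^sup>2 / real d)
      - (real d - 1) / real d * dotp d \<theta> x * f' (dotp d \<theta> x)"
proof -
  have cont_dotp: "continuous_on A (dotp d \<theta>)" for A
    unfolding dotp_def[abs_def]
    by (intro continuous_intros continuous_on_subset[OF continuous_on_product_coordinates]) auto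
  have upd: "dotp d \<theta> (x(i := h)) = dotp d \<theta> x + \<theta> i * (h - x i)" if "i < d" for i x h
  proof -
    have "dotp d \<theta> (x(i := h)) = \<theta> i * h + (\<Sum>j\<in>{..<d} - {i}. \<theta> j * x j)"
      unfolding dotp_def using that by (subst sum.remove[of _ i]) auto
    moreover have "dotp d \<theta> x = \<theta> i * x i + (\<Sum>j\<in>{..<d} - {i}. \<theta> j * x j)"
      unfolding dotp_def using that by (subst sum.remove[of _ i]) auto
    ultimately show ?thesis by (simp add: algebra_simps)
  qed
  have der: "((\<lambda>h. g (dotp d \<theta> (x(i := h)))) has_real_derivative \<theta> i * g' (dotp d \<theta> x)) (at (x i))"
    if "i < d" and g: "\<And>x. (g has_real_derivative g' x) (at x)" for i x and g g' :: "real \<Rightarrow> real"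
  proof -
    have "((\<lambda>h. dotp d \<theta> x + \<theta> i * (h - x i)) has_real_derivative \<theta> i) (at (x i))"
      by (auto intro!: derivative_eq_intros)
    from DERIV_chain2[OF _ this, of g "g' (dotp d \<theta> x)"] g[of "dotp d \<theta> x"]
    show ?thesis using \<open>i < d\<close> by (simp add: upd mult.commute)
  qed
  have f12: "\<And>x. (f has_real_derivative f' x) (at x)" "\<And>x. (f' has_real_derivative f'' x) (at x)"
    using f by (auto simp: C2_derivs_def)
  have p1: "partial i (\<lambda>x. f (dotp d \<theta> x)) = (\<lambda>x. \<theta> i * f' (dotp d \<theta> x))" if "i < d" for i
    unfolding partial_def fun_eq_iff using der[OF that f12(1)] by (auto intro: DERIV_imp_deriv)
  have der2: "((\<lambda>h. \<theta> j * f' (dotp d \<theta> (x(i := h)))) has_real_derivative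
      \<theta> j * (\<theta> i * f'' (dotp d \<theta> x))) (at (x i))" if "i < d" for i j x
    by (intro DERIV_cmult der that f12)
  have p2: "partial i (\<lambda>x. \<theta> j * f' (dotp d \<theta> x)) = (\<lambda>x. \<theta> j * (\<theta> i * f'' (dotp d \<theta> x)))"
    if "i < d" for i j
    unfolding partial_def fun_eq_iff using der2[OF that] by (auto intro: DERIV_imp_deriv)
  have c: "continuous_on A (\<lambda>x. g (dotp d \<theta> x))" if "continuous_on UNIV g" for A and g :: "real \<Rightarrow> real"
    by (rule continuous_on_compose2[OF that cont_dotp]) auto
  note cf = C2_derivs_continuous[OF f]
  have "(\<lambda>x. f (dotp d \<theta> x)) \<in> C1_Rn d"
    unfolding C1_Rn_def using der[OF _ f12(1)]
    by (auto simp: p1 intro!: c cf continuous_intros simp: real_differentiable_def)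
  moreover have "(\<lambda>x. \<theta> j * f' (dotp d \<theta> x)) \<in> C1_Rn d" for j
    unfolding C1_Rn_def using der2
    by (auto simp: p2 intro!: c cf continuous_intros simp: real_differentiable_def)
  ultimately show "(\<lambda>x. f (dotp d \<theta> x)) \<in> C2_Rn d"
    by (simp add: C2_Rn_def p1)
  have "(\<Sum>i<d. \<Sum>j<d. x i * x j * partial i (partial j (\<lambda>x. f (dotp d \<theta> x))) x) =
      (\<Sum>i<d. \<Sum>j<d. (\<theta> i * x i) * (\<theta> j * x j) * f'' (dotp d \<theta> x))"
    by (intro sum.cong refl) (simp add: p1 p2)
  also have "\<dots> = (dotp d \<theta> x)\<^sup>2 * f'' (dotp d \<theta> x)"
    unfolding dotp_def[of d \<theta> x] power2_eq_square sum_product by (simp add: sum_distrib_right)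
  finally have s2: "(\<Sum>i<d. \<Sum>j<d. x i * x j * partial i (partial j (\<lambda>x. f (dotp d \<theta> x))) x) =
      (dotp d \<theta> x)\<^sup>2 * f'' (dotp d \<theta> x)" .
  have s1: "(\<Sum>i<d. partial i (partial i (\<lambda>x. f (dotp d \<theta> x))) x) = dotp d \<theta> \<theta> * f'' (dotp d \<theta> x)"
    unfolding dotp_def[of d \<theta> \<theta>] sum_distrib_right
    by (intro sum.cong refl) (simp add: p1 p2)
  have "(\<Sum>i<d. x i * partial i (\<lambda>x. f (dotp d \<theta> x)) x) = (\<Sum>i<d. \<theta> i * x i * f' (dotp d \<theta> x))"
    by (intro sum.cong refl) (simp add: p1)
  then have s0: "(\<Sum>i<d. x i * partial i (\<lambda>x. f (dotp d \<theta> x)) x) = dotp d \<theta> x * f' (dotp d \<theta> x)"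
    by (simp add: sum_distrib_right[symmetric]) (simp add: dotp_def)
  show "spherical_generator d (\<lambda>x. f (dotp d \<theta> x)) x =
      f'' (dotp d \<theta> x) * (dotp d \<theta> \<theta> - (dotp d \<theta> x)\<^sup>2 / real d)
      - (real d - 1) / real d * dotp d \<theta> x * f' (dotp d \<theta> x)"
    unfolding spherical_generator_def s0 s1 s2 by (simp add: algebra_simps)
qed

section \<open>The projected spherical semigroup\<close>

locale spherical_semigroup = feller "sphere_sqrt d (real d)" P
  for d :: nat and P :: "real \<Rightarrow> (nat \<Rightarrow> real) \<Rightarrow> (nat \<Rightarrow> real) measure" +
  fixes \<theta> :: "nat \<Rightarrow> real"
  assumes d: "d \<ge> 1" and \<theta>: "\<theta> \<in> sphere_sqrt d 1"
    and generator: "\<And>f. f \<in> C2_Rn d \<Longrightarrow>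
      has_generator_value (sphere_sqrt d (real d)) P f (spherical_generator d f)"
begin

abbreviation "E \<equiv> sphere_sqrt d (real d)"

abbreviation "proj \<equiv> dotp d \<theta>"

lemma \<theta>_unit: "dotp d \<theta> \<theta> = 1"
  using \<theta> by (simp add: sphere_sqrt_def)

lemma generator_proj:
  assumes "C2_derivs f f' f''"
  shows "has_generator_value E P (\<lambda>x. f (proj x))
    (\<lambda>x. f'' (proj x) * (1 - (proj x)\<^sup>2 / real d) - (real d - 1) / real d * proj x * f' (proj x))"
  using generator[OF C2_derivs_compose_dotp(1)[OF assms, where \<theta> = \<theta> and d = d]]
  by (simp add: C2_derivs_compose_dotp(2)[OF assms, abs_def, where d = d and \<theta> = \<theta>] \<theta>_unit)

text \<open>Membership in \<open>C0_on\<close> is read off from \<open>has_generator_value\<close>,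
  of which it is a part.\<close>

lemma C0_on_proj: "C2_derivs f f' f'' \<Longrightarrow> (\<lambda>x. f (proj x)) \<in> C0_on E"
  using generator_proj by (simp add: has_generator_value_def)

text \<open>Duhamel's formula with the Gaussian evolved over the remaining time
  \<open>t - s\<close>. The time derivative cancels the Ornstein-Uhlenbeck part of the spherical
  generator; what is left is \<open>(p u - p^2 v) / d\<close> with \<open>u\<close>,
  \<open>v\<close> the first two derivatives at \<open>p\<close>. The weighted bounds give at most
  \<open>C\<close> for each of the two terms, hence the factor 2.\<close>

lemma op_gauss_approx:
  assumes a: "0 < a" and t: "0 \<le> t" and x: "x \<in> E"
    and C': "\<And>s x. 0 \<le> s \<Longrightarrow> s \<le> t \<Longrightarrow> (1 + x\<^sup>2) * \<bar>ou_gauss' a b c s x\<bar> \<le> C"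
    and C'': "\<And>s x. 0 \<le> s \<Longrightarrow> s \<le> t \<Longrightarrow> (1 + x\<^sup>2) * \<bar>ou_gauss'' a b c s x\<bar> \<le> C"
    and CL: "\<And>s x. 0 \<le> s \<Longrightarrow> s \<le> t \<Longrightarrow> (1 + x\<^sup>2) * \<bar>ou_gaussL a b c s x\<bar> \<le> C"
  shows "\<bar>op t (\<lambda>x. gauss a b c (proj x)) x - ou_gauss a b c t (proj x)\<bar> \<le> 2 * C / real d * t"
proof -
  have der: "C2_derivs (ou_gauss a b c s) (ou_gauss' a b c s) (ou_gauss'' a b c s)" for s
    unfolding ou_gauss_def ou_gauss'_def ou_gauss''_def by (rule C2_derivs_gauss)
  have "\<bar>op t (\<lambda>x. ou_gauss a b c (t - t) (proj x)) x - ou_gauss a b c (t - 0) (proj x)\<bar> \<le> 2 * C / real d * t"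
  proof (rule duhamel[where f = "\<lambda>s x. ou_gauss a b c (t - s) (proj x)"
        and D = "\<lambda>s x. - ou_gaussL a b c (t - s) (proj x)" and B = C, OF t x generator_proj[OF der]])
    fix s assume s: "0 \<le> s" "s \<le> t"
    obtain f' f'' where "C2_derivs (ou_gaussL a b c (t - s)) f' f''"
      unfolding ou_gaussL_def by (rule C2_derivs_gaussL)
    then show "(\<lambda>x. - ou_gaussL a b c (t - s) (proj x)) \<in> C0_on E"
      by (intro C0_on_uminus C0_on_proj)
    fix y
    let ?p = "proj y"
    have le: "z \<le> (1 + ?p\<^sup>2) * z" if "z \<ge> 0" for z
      using mult_right_mono[of 1 "1 + ?p\<^sup>2" z] that by simp
    have st: "0 \<le> t - s" "t - s \<le> t" using s by auto
    show "\<bar>- ou_gaussL a b c (t - s) ?p\<bar> \<le> C"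
      using CL[OF st, of ?p] le[of "\<bar>ou_gaussL a b c (t - s) ?p\<bar>"] by simp
    define u v where "u = ou_gauss' a b c (t - s) ?p" and "v = ou_gauss'' a b c (t - s) ?p"
    have "\<bar>v * (1 - ?p\<^sup>2 / real d) - (real d - 1) / real d * ?p * u - (v - ?p * u)\<bar> =
        \<bar>?p * u - ?p\<^sup>2 * v\<bar> / real d"
    proof -
      have "v * (1 - ?p\<^sup>2 / real d) - (real d - 1) / real d * ?p * u - (v - ?p * u) = (?p * u - ?p\<^sup>2 * v) / real d"
        using d by (simp add: field_simps)
      then show ?thesis by simp
    qed
    also have "\<bar>?p * u - ?p\<^sup>2 * v\<bar> \<le> \<bar>?p * u\<bar> + \<bar>?p\<^sup>2 * v\<bar>" by (rule abs_triangle_ineq4)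
    also have "\<bar>?p * u\<bar> \<le> (1 + ?p\<^sup>2) * \<bar>u\<bar>"
      unfolding abs_mult by (intro mult_right_mono abs_le_one_plus_square) simp
    also have "\<bar>?p\<^sup>2 * v\<bar> \<le> (1 + ?p\<^sup>2) * \<bar>v\<bar>" by (simp add: abs_mult mult_right_mono)
    also have "(1 + ?p\<^sup>2) * \<bar>u\<bar> \<le> C" unfolding u_def by (rule C'[OF st])
    also have "(1 + ?p\<^sup>2) * \<bar>v\<bar> \<le> C" unfolding v_def by (rule C''[OF st])
    finally have "\<bar>v * (1 - ?p\<^sup>2 / real d) - (real d - 1) / real d * ?p * u - (v - ?p * u)\<bar> \<le> 2 * C / real d"
      by (simp add: divide_right_mono)
    then show "\<bar>ou_gauss'' a b c (t - s) ?p * (1 - ?p\<^sup>2 / real d)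
        - (real d - 1) / real d * ?p * ou_gauss' a b c (t - s) ?p + - ou_gaussL a b c (t - s) ?p\<bar> \<le> 2 * C / real d"
      by (simp add: ou_gaussL_eq u_def v_def)
  next
    fix e :: real assume e: "e > 0"
    obtain \<delta> where \<delta>: "\<delta> > 0"
      "\<And>s r x. s \<in> {0..t} \<Longrightarrow> r \<in> {0..t} \<Longrightarrow> \<bar>r - s\<bar> < \<delta> \<Longrightarrow>
        \<bar>ou_gauss a b c r x - ou_gauss a b c s x - (r - s) * ou_gaussL a b c s x\<bar> \<le> e * \<bar>r - s\<bar>"
      using ou_gauss_time_uniform[OF a e] by metis
    show "\<exists>\<delta>>0. \<forall>s r. 0 \<le> s \<longrightarrow> s \<le> r \<longrightarrow> r \<le> t \<longrightarrow> r \<le> s + \<delta> \<longrightarrow>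
      (\<forall>y\<in>E. \<bar>ou_gauss a b c (t - r) (proj y) - ou_gauss a b c (t - s) (proj y) -
         (r - s) * - ou_gaussL a b c (t - s) (proj y)\<bar> \<le> e * (r - s))"
    \<comment> \<open>Halving turns the condition \<open>r \<le> s + \<delta> / 2\<close> into the
      strict inequality under which \<open>\<delta>\<close> was obtained.\<close>
    proof (intro exI[of _ "\<delta> / 2"] conjI allI impI ballI)
      fix s r y assume "0 \<le> s" "s \<le> r" "r \<le> t" "r \<le> s + \<delta> / 2"
      then show "\<bar>ou_gauss a b c (t - r) (proj y) - ou_gauss a b c (t - s) (proj y) -
         (r - s) * - ou_gaussL a b c (t - s) (proj y)\<bar> \<le> e * (r - s)"
        using \<delta>(2)[of "t - s" "t - r" "proj y"] \<delta>(1) by (simp add: algebra_simps)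
    qed (use \<delta> in simp)
  qed
  then show ?thesis by (simp add: ou_gauss_def)
qed

end

section \<open>The semigroup of the Ornstein-Uhlenbeck process\<close>

text \<open>A bump supported in \<open>[- R, R]\<close>: the cube is the lowest integer power of the
  positive part that is twice continuously differentiable at the edge. It gives access to
  \<open>C2c_real\<close>, and its second derivative is \<open>O(1 / R^2)\<close>.\<close>

definition cutoff :: "real \<Rightarrow> real \<Rightarrow> real" where
  "cutoff R x = (max 0 (1 - x\<^sup>2 / R\<^sup>2)) ^ 3"

definition cutoff' :: "real \<Rightarrow> real \<Rightarrow> real" where
  "cutoff' R x = - 6 * x / R\<^sup>2 * (max 0 (1 - x\<^sup>2 / R\<^sup>2)) ^ 2"

definition cutoff'' :: "real \<Rightarrow> real \<Rightarrow> real" where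
  "cutoff'' R x = 24 * x\<^sup>2 / R\<^sup>2 / R\<^sup>2 * max 0 (1 - x\<^sup>2 / R\<^sup>2) - 6 / R\<^sup>2 * (max 0 (1 - x\<^sup>2 / R\<^sup>2)) ^ 2"

text \<open>Away from 0 the function is locally a power or constant. At 0 the difference quotient is
  at most \<open>\<bar>h\<bar> ^ (n - 1)\<close>, which tends to 0 since
  \<open>n \<ge> 2\<close>.\<close>

lemma DERIV_max_0_power:
  assumes "n \<ge> 2"
  shows "((\<lambda>z::real. (max 0 z) ^ n) has_real_derivative real n * (max 0 z) ^ (n - 1)) (at z)"
proof -
  consider "z > 0" | "z < 0" | "z = 0" by linarith
  then show ?thesis
  proof cases
    case 1
    have "((\<lambda>z::real. z ^ n) has_real_derivative real n * z ^ (n - 1)) (at z)"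
      by (auto intro!: derivative_eq_intros)
    then have "((\<lambda>z::real. (max 0 z) ^ n) has_real_derivative real n * z ^ (n - 1)) (at z)"
      by (rule has_field_derivative_transform_within_open[of _ _ _ "{0<..}"]) (use 1 in \<open>auto simp: max_def\<close>)
    then show ?thesis using 1 by (simp add: max_def)
  next
    case 2
    have "((\<lambda>z::real. 0) has_real_derivative 0) (at z)" by simp
    then have "((\<lambda>z::real. (max 0 z) ^ n) has_real_derivative 0) (at z)"
      by (rule has_field_derivative_transform_within_open[of _ _ _ "{..<0}"])
         (use 2 assms in \<open>auto simp: max_def zero_power\<close>)
    then show ?thesis using 2 assms by (simp add: max_def zero_power)
  next
    case 3
    have "((\<lambda>h::real. (max 0 h) ^ n / h) \<longlongrightarrow> 0) (at 0)"
    proof (rule Lim_null_comparison[of _ "\<lambda>h. \<bar>h\<bar> ^ (n - 1)"])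
      show "\<forall>\<^sub>F h in at 0. norm ((max 0 h) ^ n / h) \<le> \<bar>h\<bar> ^ (n - 1)" for h :: real
      proof (rule always_eventually, rule allI)
        fix h :: real
        show "norm ((max 0 h) ^ n / h) \<le> \<bar>h\<bar> ^ (n - 1)"
        proof (cases "h > 0")
          case True
          then have "h ^ n / h = h ^ (n - 1)" using assms by (cases n) auto
          then show ?thesis using True by (simp add: max_def)
        qed (use assms in \<open>simp add: max_def zero_power\<close>)
      qed
      have "((\<lambda>h::real. \<bar>h\<bar> ^ (n - 1)) \<longlongrightarrow> \<bar>0\<bar> ^ (n - 1)) (at 0)"
        by (intro tendsto_intros)
      then show "((\<lambda>h::real. \<bar>h\<bar> ^ (n - 1)) \<longlongrightarrow> 0) (at 0)" using assms by (simp add: zero_power)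
    qed
    then show ?thesis using 3 assms by (simp add: DERIV_def zero_power)
  qed
qed

lemma C2_derivs_cutoff:
  assumes R: "R > 0"
  shows "C2_derivs (cutoff R) (cutoff' R) (cutoff'' R)"
  unfolding C2_derivs_def
proof (intro conjI allI)
  fix x
  have in': "((\<lambda>x. 1 - x\<^sup>2 / R\<^sup>2) has_real_derivative - (2 * x / R\<^sup>2)) (at x)"
    by (rule DERIV_cong[OF DERIV_diff[OF DERIV_const DERIV_cdivide[OF DERIV_pow]]]) simp
  show "(cutoff R has_real_derivative cutoff' R x) (at x)"
    unfolding cutoff_def[abs_def] cutoff'_def
    by (rule DERIV_cong[OF DERIV_chain2[OF DERIV_max_0_power in']]) auto
  have sq: "((\<lambda>x. (max 0 (1 - x\<^sup>2 / R\<^sup>2)) ^ 2) has_real_derivative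
      real 2 * (max 0 (1 - x\<^sup>2 / R\<^sup>2)) ^ (2 - 1) * - (2 * x / R\<^sup>2)) (at x)"
    by (rule DERIV_chain2[OF DERIV_max_0_power in']) simp
  have lin: "((\<lambda>x. - 6 * x / R\<^sup>2) has_real_derivative - 6 / R\<^sup>2) (at x)"
    by (rule DERIV_cong[OF DERIV_cdivide[OF DERIV_cmult[OF DERIV_ident]]]) simp
  show "(cutoff' R has_real_derivative cutoff'' R x) (at x)"
    unfolding cutoff'_def[abs_def] cutoff''_def
    by (rule DERIV_cong[OF DERIV_mult[OF lin sq]]) (use R in \<open>simp add: field_simps power2_eq_square\<close>)
next
  show "continuous_on UNIV (cutoff'' R)"
    unfolding cutoff''_def[abs_def] using R by (intro continuous_intros) auto
qed

text \<open>Put \<open>q = x^2 / R^2\<close> and \<open>m = max 0 (1 - q)\<close>: both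
  \<open>m\<close> and \<open>m q\<close> lie in \<open>[0, 1]\<close>. Bernoulli's inequality gives
  \<open>1 - m^3 \<le> 3 q\<close>, and the constant of the second derivative is
  \<open>24 + 6 = 30\<close>.\<close>

lemma cutoff_bounds:
  assumes R: "R > 0"
  shows "0 \<le> cutoff R x" "cutoff R x \<le> 1" "1 - cutoff R x \<le> 3 * x\<^sup>2 / R\<^sup>2"
    and "\<bar>cutoff' R x\<bar> \<le> 6 * \<bar>x\<bar> / R\<^sup>2" "\<bar>cutoff'' R x\<bar> \<le> 30 / R\<^sup>2"
    and "\<bar>x\<bar> \<ge> R \<Longrightarrow> cutoff R x = 0"
proof -
  define q where "q = x\<^sup>2 / R\<^sup>2"
  define m where "m = max 0 (1 - q)"
  have q: "q \<ge> 0" by (simp add: q_def)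
  have m: "0 \<le> m" "m \<le> 1" using q by (auto simp: m_def)
  have m2: "m\<^sup>2 \<le> 1" using m by (simp add: power_le_one)
  have mq: "m * q \<le> 1" "m * q \<ge> 0"
  proof -
    show "m * q \<ge> 0" using m q by simp
    show "m * q \<le> 1"
    proof (cases "q \<le> 1")
      case True
      then show ?thesis using m q by (simp add: mult_le_one)
    qed (simp add: m_def)
  qed
  show "0 \<le> cutoff R x" "cutoff R x \<le> 1"
    using m by (auto simp: cutoff_def q_def[symmetric] m_def[symmetric] power_le_one)
  show "1 - cutoff R x \<le> 3 * x\<^sup>2 / R\<^sup>2"
  proof -
    have "1 - 3 * q \<le> m ^ 3"
    proof (cases "q \<le> 1")
      case True
      then have "1 + real 3 * (- q) \<le> (1 + (- q)) ^ 3" by (intro Bernoulli_inequality) simp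
      then show ?thesis using True by (simp add: m_def)
    qed (use m in \<open>simp add: m_def\<close>)
    then show ?thesis by (simp add: cutoff_def q_def[symmetric] m_def[symmetric]) (simp add: q_def)
  qed
  have "\<bar>cutoff' R x\<bar> = 6 * \<bar>x\<bar> / R\<^sup>2 * m\<^sup>2"
    by (simp add: cutoff'_def q_def[symmetric] m_def[symmetric] abs_mult)
  also have "\<dots> \<le> 6 * \<bar>x\<bar> / R\<^sup>2 * 1" using m2 by (intro mult_left_mono) auto
  finally show "\<bar>cutoff' R x\<bar> \<le> 6 * \<bar>x\<bar> / R\<^sup>2" by simp
  have "cutoff'' R x = (24 * (m * q) - 6 * m\<^sup>2) / R\<^sup>2"
    by (simp add: cutoff''_def q_def[symmetric] m_def[symmetric] diff_divide_distrib) (simp add: q_def)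
  moreover have "\<bar>24 * (m * q) - 6 * m\<^sup>2\<bar> \<le> 30" using mq m2 zero_le_power2[of m] by linarith
  ultimately show "\<bar>cutoff'' R x\<bar> \<le> 30 / R\<^sup>2" by (simp add: divide_right_mono)
  show "cutoff R x = 0" if "\<bar>x\<bar> \<ge> R"
  proof -
    have "R\<^sup>2 \<le> x\<^sup>2" using that R abs_le_square_iff[of R x] by simp
    then have "q \<ge> 1" using R by (simp add: q_def)
    then show ?thesis by (simp add: cutoff_def q_def[symmetric])
  qed
qed

text \<open>The product rule is grouped into the cutoff times the generator of \<open>f\<close>, and
  a remainder in which every term contains a derivative of the cutoff and is therefore small for
  large \<open>R\<close> when \<open>f\<close> decays.\<close>

lemma C2c_real_cutoff_mult:
  assumes R: "R > 0" and f: "C2_derivs f f' f''"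
  shows "(\<lambda>x. cutoff R x * f x) \<in> C2c_real"
    and "OU_generator (\<lambda>x. cutoff R x * f x) x = cutoff R x * (f'' x - x * f' x)
      + (cutoff'' R x * f x + 2 * (cutoff' R x * f' x) - x * cutoff' R x * f x)"
proof -
  define h h' h'' where "h = (\<lambda>x. cutoff R x * f x)"
    and "h' = (\<lambda>x. cutoff' R x * f x + cutoff R x * f' x)"
    and "h'' = (\<lambda>x. cutoff'' R x * f x + 2 * (cutoff' R x * f' x) + cutoff R x * f'' x)"
  have h: "C2_derivs h h' h''"
    unfolding h_def h'_def h''_def by (rule C2_derivs_mult[OF C2_derivs_cutoff[OF R] f])
  have d1: "deriv h = h'" and d2: "deriv h' = h''"
    using h by (auto simp: fun_eq_iff C2_derivs_def intro: DERIV_imp_deriv)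
  have "h \<in> C2c_real"
    unfolding C2c_real_def
  proof (intro CollectI conjI exI[of _ "cball 0 R"])
    show "\<forall>x. x \<notin> cball 0 R \<longrightarrow> h x = 0"
      using cutoff_bounds(6)[OF R] by (auto simp: h_def)
  qed (use h in \<open>auto simp: d1 d2 C2_derivs_def real_differentiable_def\<close>)
  then show "(\<lambda>x. cutoff R x * f x) \<in> C2c_real" by (simp add: h_def)
  have "OU_generator h x = h'' x - x * h' x" by (simp add: OU_generator_def d1 d2)
  then show "OU_generator (\<lambda>x. cutoff R x * f x) x = cutoff R x * (f'' x - x * f' x)
      + (cutoff'' R x * f x + 2 * (cutoff' R x * f' x) - x * cutoff' R x * f x)"
    by (simp add: h_def h'_def h''_def algebra_simps)
qed

locale ou_semigroup = feller "UNIV :: real set" P for P :: "real \<Rightarrow> real \<Rightarrow> real measure" +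
  assumes generator: "\<And>f. f \<in> C2c_real \<Longrightarrow> has_generator_value UNIV P f (OU_generator f)"
begin

text \<open>In Duhamel's formula the time derivative cancels the cutoff times the generator, leaving
  only the terms with a derivative of the cutoff. With \<open>y^2 g\<close> and
  \<open>\<bar>y g'\<bar>\<close> bounded by \<open>C\<close>, they amount to
  \<open>30 + 12 + 6 = 48\<close> times \<open>C / R^2\<close>.\<close>

lemma op_cutoff_gauss_approx:
  assumes a: "0 < a" and t: "0 \<le> t" and R: "R > 0"
    and C: "\<And>s x. 0 \<le> s \<Longrightarrow> s \<le> t \<Longrightarrow> (1 + x\<^sup>2) * ou_gauss a b c s x \<le> C"
    and C': "\<And>s x. 0 \<le> s \<Longrightarrow> s \<le> t \<Longrightarrow> (1 + x\<^sup>2) * \<bar>ou_gauss' a b c s x\<bar> \<le> C"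
    and CL: "\<And>s x. 0 \<le> s \<Longrightarrow> s \<le> t \<Longrightarrow> (1 + x\<^sup>2) * \<bar>ou_gaussL a b c s x\<bar> \<le> C"
  shows "\<bar>op t (\<lambda>x. cutoff R x * gauss a b c x) x - cutoff R x * ou_gauss a b c t x\<bar> \<le> 48 * C / R\<^sup>2 * t"
proof -
  have der: "C2_derivs (ou_gauss a b c s) (ou_gauss' a b c s) (ou_gauss'' a b c s)" for s
    unfolding ou_gauss_def ou_gauss'_def ou_gauss''_def by (rule C2_derivs_gauss)
  have "\<bar>op t (\<lambda>x. cutoff R x * ou_gauss a b c (t - t) x) x - cutoff R x * ou_gauss a b c (t - 0) x\<bar>
      \<le> 48 * C / R\<^sup>2 * t"
  proof (rule duhamel[where f = "\<lambda>s x. cutoff R x * ou_gauss a b c (t - s) x"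
        and A = "\<lambda>s. OU_generator (\<lambda>x. cutoff R x * ou_gauss a b c (t - s) x)"
        and D = "\<lambda>s x. - (cutoff R x * ou_gaussL a b c (t - s) x)" and B = C, OF t UNIV_I])
    fix s assume s: "0 \<le> s" "s \<le> t"
    show "has_generator_value UNIV P (\<lambda>x. cutoff R x * ou_gauss a b c (t - s) x)
        (OU_generator (\<lambda>x. cutoff R x * ou_gauss a b c (t - s) x))"
      by (intro generator C2c_real_cutoff_mult(1)[OF R der])
    obtain f' f'' where "C2_derivs (ou_gaussL a b c (t - s)) f' f''"
      unfolding ou_gaussL_def by (rule C2_derivs_gaussL)
    then have "(\<lambda>x. cutoff R x * ou_gaussL a b c (t - s) x) \<in> C0_on UNIV"
      using generator[OF C2c_real_cutoff_mult(1)[OF R]] by (simp add: has_generator_value_def)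
    then show "(\<lambda>x. - (cutoff R x * ou_gaussL a b c (t - s) x)) \<in> C0_on UNIV"
      by (rule C0_on_uminus)
    fix y :: real
    have le: "z \<le> (1 + y\<^sup>2) * z" if "z \<ge> 0" for z
      using mult_right_mono[of 1 "1 + y\<^sup>2" z] that by simp
    have st: "0 \<le> t - s" "t - s \<le> t" using s by auto
    note cb = cutoff_bounds[OF R, of y]
    have "\<bar>cutoff R y * ou_gaussL a b c (t - s) y\<bar> \<le> 1 * \<bar>ou_gaussL a b c (t - s) y\<bar>"
      unfolding abs_mult using cb by (intro mult_right_mono) auto
    then show "\<bar>- (cutoff R y * ou_gaussL a b c (t - s) y)\<bar> \<le> C"
      using CL[OF st, of y] le[of "\<bar>ou_gaussL a b c (t - s) y\<bar>"] by simp
    define g u where "g = ou_gauss a b c (t - s) y" and "u = ou_gauss' a b c (t - s) y"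
    have g0: "g \<ge> 0" by (simp add: g_def ou_gauss_def less_imp_le)
    moreover have "g + y\<^sup>2 * g \<le> C" using C[OF st, of y] by (simp add: g_def algebra_simps)
    moreover have "0 \<le> y\<^sup>2 * g" using g0 by simp
    ultimately have g: "g \<ge> 0" "g \<le> C" "y\<^sup>2 * g \<le> C" by linarith+
    have "\<bar>y\<bar> * \<bar>u\<bar> \<le> (1 + y\<^sup>2) * \<bar>u\<bar>" by (intro mult_right_mono abs_le_one_plus_square) simp
    then have u: "\<bar>y\<bar> * \<bar>u\<bar> \<le> C" using C'[OF st, of y] by (simp add: u_def)
    have "OU_generator (\<lambda>x. cutoff R x * ou_gauss a b c (t - s) x) y + - (cutoff R y * ou_gaussL a b c (t - s) y) =
        cutoff'' R y * g + 2 * (cutoff' R y * u) - y * cutoff' R y * g"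
      unfolding C2c_real_cutoff_mult(2)[OF R der] ou_gaussL_eq g_def u_def by simp
    moreover have "\<bar>cutoff'' R y * g\<bar> \<le> 30 / R\<^sup>2 * C"
      unfolding abs_mult using cb g R by (intro mult_mono) auto
    moreover have "\<bar>cutoff' R y * u\<bar> \<le> 6 / R\<^sup>2 * C"
    proof -
      have "\<bar>cutoff' R y * u\<bar> \<le> 6 * \<bar>y\<bar> / R\<^sup>2 * \<bar>u\<bar>"
        unfolding abs_mult using cb by (intro mult_right_mono) auto
      also have "\<dots> = 6 / R\<^sup>2 * (\<bar>y\<bar> * \<bar>u\<bar>)" by simp
      also have "\<dots> \<le> 6 / R\<^sup>2 * C" using u by (intro mult_left_mono) auto
      finally show ?thesis .
    qed
    moreover have "\<bar>y * cutoff' R y * g\<bar> \<le> 6 / R\<^sup>2 * C"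
    proof -
      have "\<bar>y * cutoff' R y * g\<bar> = \<bar>y\<bar> * \<bar>cutoff' R y\<bar> * g" using g by (simp add: abs_mult)
      also have "\<dots> \<le> \<bar>y\<bar> * (6 * \<bar>y\<bar> / R\<^sup>2) * g"
        by (intro mult_right_mono[OF _ g(1)] mult_left_mono[OF cb(4)]) simp
      also have "\<dots> = 6 / R\<^sup>2 * (y\<^sup>2 * g)" by (simp add: power2_eq_square)
      also have "\<dots> \<le> 6 / R\<^sup>2 * C" using g by (intro mult_left_mono) auto
      finally show ?thesis .
    qed
    ultimately show "\<bar>OU_generator (\<lambda>x. cutoff R x * ou_gauss a b c (t - s) x) y +
        - (cutoff R y * ou_gaussL a b c (t - s) y)\<bar> \<le> 48 * C / R\<^sup>2"
      by (simp add: abs_le_iff)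
  next
    fix e :: real assume e: "e > 0"
    obtain \<delta> where \<delta>: "\<delta> > 0"
      "\<And>s r x. s \<in> {0..t} \<Longrightarrow> r \<in> {0..t} \<Longrightarrow> \<bar>r - s\<bar> < \<delta> \<Longrightarrow>
        \<bar>ou_gauss a b c r x - ou_gauss a b c s x - (r - s) * ou_gaussL a b c s x\<bar> \<le> e * \<bar>r - s\<bar>"
      using ou_gauss_time_uniform[OF a e] by metis
    show "\<exists>\<delta>>0. \<forall>s r. 0 \<le> s \<longrightarrow> s \<le> r \<longrightarrow> r \<le> t \<longrightarrow> r \<le> s + \<delta> \<longrightarrow>
      (\<forall>y\<in>UNIV. \<bar>cutoff R y * ou_gauss a b c (t - r) y - cutoff R y * ou_gauss a b c (t - s) y -
         (r - s) * - (cutoff R y * ou_gaussL a b c (t - s) y)\<bar> \<le> e * (r - s))"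
    proof (intro exI[of _ "\<delta> / 2"] conjI allI impI ballI)
      fix s r y assume sr: "0 \<le> s" "s \<le> r" "r \<le> t" "r \<le> s + \<delta> / 2"
      define z where "z = ou_gauss a b c (t - r) y - ou_gauss a b c (t - s) y + (r - s) * ou_gaussL a b c (t - s) y"
      have "\<bar>z\<bar> \<le> e * (r - s)"
        using \<delta>(2)[of "t - s" "t - r" y] \<delta>(1) sr by (simp add: z_def algebra_simps)
      moreover have "\<bar>cutoff R y * z\<bar> \<le> 1 * \<bar>z\<bar>"
        unfolding abs_mult using cutoff_bounds[OF R, of y] by (intro mult_right_mono) auto
      moreover have "cutoff R y * ou_gauss a b c (t - r) y - cutoff R y * ou_gauss a b c (t - s) y -
         (r - s) * - (cutoff R y * ou_gaussL a b c (t - s) y) = cutoff R y * z"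
        by (simp add: z_def algebra_simps)
      ultimately show "\<bar>cutoff R y * ou_gauss a b c (t - r) y - cutoff R y * ou_gauss a b c (t - s) y -
         (r - s) * - (cutoff R y * ou_gaussL a b c (t - s) y)\<bar> \<le> e * (r - s)"
        by linarith
    qed (use \<delta> in simp)
  qed
  then show ?thesis by (simp add: ou_gauss_def)
qed

text \<open>Removing the cutoff by \<open>R \<rightarrow> \<infinity>\<close> identifies the
  semigroup on Gaussians exactly; this is where the hypothesis on the generator of the limit process
  turns into knowledge of its transition probabilities.\<close>

lemma op_gauss:
  assumes a: "0 < a" and t: "0 \<le> t"
  shows "op t (gauss a b c) x = ou_gauss a b c t x"
proof -
  obtain C where C: "C > 0"
    "\<And>s x. 0 \<le> s \<Longrightarrow> s \<le> t \<Longrightarrow> (1 + x\<^sup>2) * ou_gauss a b c s x \<le> C"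
    "\<And>s x. 0 \<le> s \<Longrightarrow> s \<le> t \<Longrightarrow> (1 + x\<^sup>2) * \<bar>ou_gauss' a b c s x\<bar> \<le> C"
    "\<And>s x. 0 \<le> s \<Longrightarrow> s \<le> t \<Longrightarrow> (1 + x\<^sup>2) * \<bar>ou_gaussL a b c s x\<bar> \<le> C"
    using ou_gauss_bounds[OF a] by metis
  have cut: "\<bar>ou_gauss a b c s y - cutoff R y * ou_gauss a b c s y\<bar> \<le> 3 * C / R\<^sup>2"
    if "0 \<le> s" "s \<le> t" "R > 0" for s R y
  proof -
    note cb = cutoff_bounds[OF \<open>R > 0\<close>, of y]
    have pos: "ou_gauss a b c s y \<ge> 0" by (simp add: ou_gauss_def less_imp_le)
    have "\<bar>ou_gauss a b c s y - cutoff R y * ou_gauss a b c s y\<bar> = (1 - cutoff R y) * ou_gauss a b c s y"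
      using cb pos mult_right_mono[of "cutoff R y" 1 "ou_gauss a b c s y"] by (simp add: algebra_simps)
    also have "\<dots> \<le> 3 * y\<^sup>2 / R\<^sup>2 * ou_gauss a b c s y" using cb pos by (intro mult_right_mono) auto
    also have "\<dots> = 3 / R\<^sup>2 * (y\<^sup>2 * ou_gauss a b c s y)" by simp
    also have "\<dots> \<le> 3 / R\<^sup>2 * C"
      using C(2)[of s y] that pos by (intro mult_left_mono) (auto simp: distrib_right)
    finally show ?thesis by simp
  qed
  have g0: "gauss a b c y = ou_gauss a b c 0 y" for y by (simp add: ou_gauss_def)
  have gm: "gauss a b c \<in> borel_measurable (borel_on UNIV)"
    using C2_derivs_continuous(1)[OF C2_derivs_gauss] by (rule borel_measurable_continuous_on_restrict)
  have gi: "integrable (P t x) (gauss a b c)"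
  proof (rule integrable_kernel[OF t UNIV_I gm])
    fix y
    have "gauss a b c y \<le> (1 + y\<^sup>2) * gauss a b c y" by (simp add: algebra_simps less_imp_le)
    moreover have "(1 + y\<^sup>2) * gauss a b c y \<le> C" using C(2)[of 0 y] t by (simp add: g0[symmetric])
    ultimately show "\<bar>gauss a b c y\<bar> \<le> C" using gauss_pos[of a b c y] by linarith
  qed
  \<comment> \<open>The Duhamel error plus \<open>3 C\<close> twice: once for cutting off the
    integrand, once for cutting off the evolved Gaussian at \<open>x\<close>.\<close>
  define K where "K = 48 * C * t + 6 * C"
  have bound: "\<bar>op t (gauss a b c) x - ou_gauss a b c t x\<bar> \<le> K / R\<^sup>2" if R: "R > 0" for R
  proof -
    have "(\<lambda>y. cutoff R y * gauss a b c y) \<in> C0_on UNIV"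
      using generator[OF C2c_real_cutoff_mult(1)[OF R C2_derivs_gauss]] by (simp add: has_generator_value_def)
    then have ci: "integrable (P t x) (\<lambda>y. cutoff R y * gauss a b c y)"
      using t by (intro integrable_C0) auto
    have c0: "\<bar>gauss a b c y - cutoff R y * gauss a b c y\<bar> \<le> 3 * C / R\<^sup>2" for y
      unfolding g0 by (rule cut) (use t R in auto)
    have "\<bar>op t (gauss a b c) x - op t (\<lambda>y. cutoff R y * gauss a b c y) x\<bar> \<le> 3 * C / R\<^sup>2"
      using gi ci t c0 by (intro op_diff_le) auto
    moreover have "\<bar>op t (\<lambda>x. cutoff R x * gauss a b c x) x - cutoff R x * ou_gauss a b c t x\<bar>
        \<le> 48 * C / R\<^sup>2 * t"
      by (rule op_cutoff_gauss_approx[OF a t R C(2,3,4)])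
    moreover have "\<bar>ou_gauss a b c t x - cutoff R x * ou_gauss a b c t x\<bar> \<le> 3 * C / R\<^sup>2"
      using t R by (intro cut) auto
    moreover have "K / R\<^sup>2 = 48 * C / R\<^sup>2 * t + 3 * C / R\<^sup>2 + 3 * C / R\<^sup>2"
      by (simp add: K_def add_divide_distrib)
    ultimately show ?thesis by linarith
  qed
  have "\<bar>op t (gauss a b c) x - ou_gauss a b c t x\<bar> \<le> 0"
  proof (rule field_le_epsilon)
    fix e :: real assume e: "e > 0"
    have K: "K > 0" using C(1) t by (simp add: K_def add_nonneg_pos)
    have "K / (sqrt (K / e))\<^sup>2 = e" using K e by simp
    then show "\<bar>op t (gauss a b c) x - ou_gauss a b c t x\<bar> \<le> 0 + e"
      using bound[of "sqrt (K / e)"] K e by simp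
  qed
  then show ?thesis by simp
qed

end

section \<open>Markov property and finite-dimensional distributions\<close>

locale feller_markov = feller E P + prob_space M
  for E :: "'a::topological_space set" and P and M :: "'w measure" +
  fixes X :: "real \<Rightarrow> 'w \<Rightarrow> 'a"
  assumes markov: "markov_process E P M X"
begin

lemma X_measurable: "0 \<le> t \<Longrightarrow> X t \<in> M \<rightarrow>\<^sub>M borel_on E"
  using markov by (simp add: markov_process_def)

lemma X_measurable_borel: "0 \<le> t \<Longrightarrow> X t \<in> M \<rightarrow>\<^sub>M borel"
  using X_measurable by (simp add: measurable_restrict_space2_iff)

lemma X_in_E: "0 \<le> t \<Longrightarrow> \<omega> \<in> space M \<Longrightarrow> X t \<omega> \<in> E"
  using measurable_space[OF X_measurable] by (simp add: space_restrict_space)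

lemma space_natural_filtration: "space (natural_filtration M X s) = space M"
  unfolding natural_filtration_def by (intro space_measure_of) auto

lemma subalgebra_natural_filtration: "subalgebra M (natural_filtration M X s)"
  unfolding subalgebra_def space_natural_filtration
proof
  have "sigma_sets (space M) {X r -` B \<inter> space M | r B. 0 \<le> r \<and> r \<le> s \<and> B \<in> sets borel} \<subseteq> sets M"
    by (intro sets.sigma_sets_subset) (auto intro: measurable_sets[OF X_measurable_borel])
  then show "sets (natural_filtration M X s) \<subseteq> sets M"
    unfolding natural_filtration_def by (subst sets_measure_of) auto
qed simp

lemma X_measurable_natural_filtration:
  assumes "0 \<le> r" "r \<le> s"
  shows "X r \<in> natural_filtration M X s \<rightarrow>\<^sub>M borel"
proof (rule measurableI)
  fix B :: "'a set" assume B: "B \<in> sets borel"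
  have "X r -` B \<inter> space M \<in> sigma_sets (space M) {X r -` B \<inter> space M | r B. 0 \<le> r \<and> r \<le> s \<and> B \<in> sets borel}"
    using assms B by (intro sigma_sets.Basic) auto
  then show "X r -` B \<inter> space (natural_filtration M X s) \<in> sets (natural_filtration M X s)"
    unfolding space_natural_filtration unfolding natural_filtration_def by (subst sets_measure_of) auto
qed simp

lemma op_measurable:
  assumes "0 \<le> t" "f \<in> borel_measurable (borel_on E)"
  shows "op t f \<in> borel_measurable (borel_on E)"
  unfolding semigroup_op_def
  by (rule measurable_compose[OF kernel_measurable_subprob integral_measurable_subprob_algebra]) fact+

text \<open>The weight \<open>H\<close> serves as a density and turns \<open>M\<close> into a finite
  measure. Under it, the law \<open>\<mu>1\<close> of \<open>X t\<close> and the image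
  \<open>\<mu>2\<close> of the law of \<open>X s\<close> under the kernel agree on every measurable
  set by the Markov property; equality of the two measures then covers all bounded \<open>f\<close>
  at once.\<close>

lemma markov_integral_nonneg:
  fixes f :: "'a \<Rightarrow> real"
  assumes st: "0 \<le> s" "s \<le> t"
    and H: "H \<in> borel_measurable (natural_filtration M X s)"
    and H0: "\<And>\<omega>. \<omega> \<in> space M \<Longrightarrow> 0 \<le> H \<omega>" and HB: "\<And>\<omega>. \<omega> \<in> space M \<Longrightarrow> H \<omega> \<le> B"
    and f: "f \<in> borel_measurable (borel_on E)" and fB: "\<And>x. x \<in> E \<Longrightarrow> \<bar>f x\<bar> \<le> C"
  shows "(\<integral>\<omega>. H \<omega> * f (X t \<omega>) \<partial>M) = (\<integral>\<omega>. H \<omega> * op (t - s) f (X s \<omega>) \<partial>M)"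
proof -
  note [measurable] = X_measurable[OF st(1)] X_measurable[OF order_trans[OF st]]
  have HM[measurable]: "H \<in> borel_measurable M"
    using measurable_from_subalg[OF subalgebra_natural_filtration H] .
  have iH: "integrable M H"
    using H0 HB by (intro integrable_const_bound[of _ B]) auto
  define \<nu> where "\<nu> = density M (\<lambda>\<omega>. ennreal (H \<omega>))"
  have \<nu>: "finite_measure \<nu>"
  proof
    have "emeasure \<nu> (space \<nu>) = (\<integral>\<^sup>+\<omega>. ennreal (H \<omega>) \<partial>M)"
      by (simp add: \<nu>_def emeasure_density cong: nn_integral_cong)
    also have "\<dots> = ennreal (\<integral>\<omega>. H \<omega> \<partial>M)" using iH H0 by (intro nn_integral_eq_integral) auto
    finally show "emeasure \<nu> (space \<nu>) \<noteq> \<infinity>" by simp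
  qed
  have sets_\<nu>: "sets \<nu> = sets M" by (simp add: \<nu>_def)
  have X\<nu>: "X t \<in> \<nu> \<rightarrow>\<^sub>M borel_on E" "X s \<in> \<nu> \<rightarrow>\<^sub>M borel_on E"
    using X_measurable st by (simp_all add: measurable_cong_sets[OF sets_\<nu> refl])
  define \<mu>1 where "\<mu>1 = distr \<nu> (borel_on E) (X t)"
  define \<mu>0 where "\<mu>0 = distr \<nu> (borel_on E) (X s)"
  define \<mu>2 where "\<mu>2 = \<mu>0 \<bind> P (t - s)"
  have fin1: "finite_measure \<mu>1" and fin0: "finite_measure \<mu>0"
    unfolding \<mu>1_def \<mu>0_def using X\<nu> by (auto intro: finite_measure.finite_measure_distr[OF \<nu>])
  have K: "P (t - s) \<in> \<mu>0 \<rightarrow>\<^sub>M subprob_algebra (borel_on E)"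
    unfolding \<mu>0_def using st kernel_measurable_subprob[of "t - s"] by simp
  have Eb: "emeasure (P (t - s) x) (space (P (t - s) x)) = 1" if "x \<in> E" for x
    using kernel_prob_space[OF _ that, of "t - s"] st by (simp add: prob_space.emeasure_space_1)
  have int_dens: "(\<integral>\<omega>. g \<omega> \<partial>\<nu>) = (\<integral>\<omega>. H \<omega> * g \<omega> \<partial>M)" if "g \<in> borel_measurable M" for g :: "'w \<Rightarrow> real"
    unfolding \<nu>_def using that H0 by (intro integral_real_density) auto
  have I1: "(\<integral>x. g x \<partial>\<mu>1) = (\<integral>\<omega>. H \<omega> * g (X t \<omega>) \<partial>M)"
    if g: "g \<in> borel_measurable (borel_on E)" for g :: "'a \<Rightarrow> real"
  proof -
    have "(\<integral>x. g x \<partial>\<mu>1) = (\<integral>\<omega>. g (X t \<omega>) \<partial>\<nu>)"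
      unfolding \<mu>1_def by (rule integral_distr[OF X\<nu>(1) g])
    also have "\<dots> = (\<integral>\<omega>. H \<omega> * g (X t \<omega>) \<partial>M)"
      using st by (intro int_dens measurable_compose[OF X_measurable g]) auto
    finally show ?thesis .
  qed
  have I2: "(\<integral>x. g x \<partial>\<mu>2) = (\<integral>\<omega>. H \<omega> * op (t - s) g (X s \<omega>) \<partial>M)"
    if g: "g \<in> borel_measurable (borel_on E)" and gB: "\<And>x. x \<in> E \<Longrightarrow> \<bar>g x\<bar> \<le> C" for g :: "'a \<Rightarrow> real" and C
  proof -
    have "(\<integral>x. g x \<partial>\<mu>2) = (\<integral>x. op (t - s) g x \<partial>\<mu>0)"
      unfolding \<mu>2_def semigroup_op_def
    proof (rule integral_bind[OF g _ K fin0, where B = C and B' = 1])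
      show "AE x in \<mu>0. emeasure (P (t - s) x) (space (P (t - s) x)) \<le> ennreal 1"
        using Eb by (intro AE_I2) (simp add: \<mu>0_def space_restrict_space)
    qed (use gB in \<open>simp add: space_restrict_space\<close>)
    also have "\<dots> = (\<integral>\<omega>. op (t - s) g (X s \<omega>) \<partial>\<nu>)"
      unfolding \<mu>0_def using st g by (intro integral_distr[OF X\<nu>(2)] op_measurable) auto
    also have "\<dots> = (\<integral>\<omega>. H \<omega> * op (t - s) g (X s \<omega>) \<partial>M)"
      using st by (intro int_dens measurable_compose[OF X_measurable op_measurable] g) auto
    finally show ?thesis .
  qed
  have sets2: "sets \<mu>2 = sets (borel_on E)" if "space \<mu>0 \<noteq> {}"
    unfolding \<mu>2_def by (rule sets_bind[OF sets_kernel[OF K] that])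
  \<comment> \<open>\<open>bind\<close> has the expected measurable sets only over a nonempty space,
    which a probability space provides.\<close>
  have spM: "space M \<noteq> {}" by (rule not_empty)
  have sp0: "space \<mu>0 \<noteq> {}"
    using spM X_in_E[OF st(1)] by (auto simp: \<mu>0_def space_restrict_space)
  have fin2: "finite_measure \<mu>2"
  proof
    have "emeasure \<mu>2 (space \<mu>2) = (\<integral>\<^sup>+x. emeasure (P (t - s) x) E \<partial>\<mu>0)"
    proof -
      have sp: "space \<mu>2 = E" using sets_eq_imp_space_eq[OF sets2[OF sp0]] by (simp add: space_restrict_space)
      have "E \<in> sets (borel_on E)" using sets.top[of "borel_on E"] by (simp add: space_restrict_space)
      then show ?thesis unfolding sp unfolding \<mu>2_def by (intro emeasure_bind[OF sp0 K])
    qed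
    also have "\<dots> = (\<integral>\<^sup>+x. 1 \<partial>\<mu>0)"
      using Eb st by (intro nn_integral_cong) (auto simp: \<mu>0_def space_restrict_space space_kernel)
    also have "\<dots> < \<infinity>" using finite_measure.emeasure_finite[OF fin0] by (simp add: top.not_eq_extremum)
    finally show "emeasure \<mu>2 (space \<mu>2) \<noteq> \<infinity>" by simp
  qed
  interpret F1: finite_measure \<mu>1 by fact
  interpret F2: finite_measure \<mu>2 by fact
  have "\<mu>1 = \<mu>2"
  proof (rule measure_eqI)
    show sets_eq: "sets \<mu>1 = sets \<mu>2" using sets2[OF sp0] by (simp add: \<mu>1_def)
    fix B assume "B \<in> sets \<mu>1"
    then have B[measurable]: "B \<in> sets (borel_on E)" by (simp add: \<mu>1_def)
    interpret sub: finite_measure_subalgebra M "natural_filtration M X s"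
      by unfold_locales (rule subalgebra_natural_filtration)
    have Bm: "(indicator B :: 'a \<Rightarrow> real) \<in> borel_measurable (borel_on E)" by simp
    have iM: "(\<lambda>\<omega>. indicator B (X t \<omega>) :: real) \<in> borel_measurable M" by measurable
    have "measure \<mu>1 B = (\<integral>x. indicator B x \<partial>\<mu>1)"
      using B by (simp add: \<mu>1_def)
    also have "\<dots> = (\<integral>\<omega>. H \<omega> * indicator B (X t \<omega>) \<partial>M)" by (rule I1[OF Bm])
    \<comment> \<open>Defining property of the conditional expectation: \<open>H\<close> is
      measurable with respect to the past up to \<open>s\<close>.\<close>
    also have "\<dots> = (\<integral>\<omega>. H \<omega> * real_cond_exp M (natural_filtration M X s) (\<lambda>\<omega>. indicator B (X t \<omega>)) \<omega> \<partial>M)"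
    proof (rule sub.real_cond_exp_intg(2)[symmetric])
      show "integrable M (\<lambda>\<omega>. H \<omega> * indicator B (X t \<omega>))"
        by (rule Bochner_Integration.integrable_bound[OF iH])
           (auto simp: indicator_def split: if_splits)
    qed (use H iM in auto)
    also have "\<dots> = (\<integral>\<omega>. H \<omega> * measure (P (t - s) (X s \<omega>)) B \<partial>M)"
    proof (rule integral_cong_AE)
      have "AE \<omega> in M. real_cond_exp M (natural_filtration M X s) (\<lambda>\<omega>. indicator B (X t \<omega>)) \<omega> =
           measure (P (t - s) (X s \<omega>)) B"
        using markov B st by (simp add: markov_process_def)
      then show "AE \<omega> in M. H \<omega> * real_cond_exp M (natural_filtration M X s) (\<lambda>\<omega>. indicator B (X t \<omega>)) \<omega> =
           H \<omega> * measure (P (t - s) (X s \<omega>)) B" by eventually_elim simp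
      show "(\<lambda>\<omega>. H \<omega> * measure (P (t - s) (X s \<omega>)) B) \<in> borel_measurable M"
        using st by (intro borel_measurable_times HM measurable_compose[OF X_measurable[OF st(1)]]
          measurable_compose[OF kernel_measurable_subprob measurable_measure_subprob_algebra[OF B]]) simp
    qed measurable
    also have "\<dots> = (\<integral>\<omega>. H \<omega> * op (t - s) (indicator B) (X s \<omega>) \<partial>M)"
    proof (intro Bochner_Integration.integral_cong refl)
      fix \<omega> assume "\<omega> \<in> space M"
      then have "X s \<omega> \<in> E" using X_in_E st by simp
      then show "H \<omega> * measure (P (t - s) (X s \<omega>)) B = H \<omega> * op (t - s) (indicator B) (X s \<omega>)"
        using sets_transition[of "t - s" "X s \<omega>"] st B by (simp add: semigroup_op_def)
    qed
    also have "\<dots> = (\<integral>x. indicator B x \<partial>\<mu>2)" by (rule I2[OF Bm, symmetric, of 1]) (simp add: indicator_def)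
    also have "\<dots> = measure \<mu>2 B" using B sets2[OF sp0] by simp
    finally show "emeasure \<mu>1 B = emeasure \<mu>2 B" by (simp add: F1.emeasure_eq_measure F2.emeasure_eq_measure)
  qed
  then show ?thesis using I1[OF f] I2[OF f fB] by simp
qed

text \<open>The identity for nonnegative weights is applied to \<open>H + B\<close> and to the
  constant \<open>B\<close>, and the results are subtracted.\<close>

lemma markov_integral:
  fixes f :: "'a \<Rightarrow> real"
  assumes st: "0 \<le> s" "s \<le> t"
    and H: "H \<in> borel_measurable (natural_filtration M X s)"
    and HB: "\<And>\<omega>. \<omega> \<in> space M \<Longrightarrow> \<bar>H \<omega>\<bar> \<le> B"
    and f: "f \<in> borel_measurable (borel_on E)" and fB: "\<And>x. x \<in> E \<Longrightarrow> \<bar>f x\<bar> \<le> C"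
  shows "(\<integral>\<omega>. H \<omega> * f (X t \<omega>) \<partial>M) = (\<integral>\<omega>. H \<omega> * op (t - s) f (X s \<omega>) \<partial>M)"
proof -
  have HM: "H \<in> borel_measurable M"
    using measurable_from_subalg[OF subalgebra_natural_filtration H] .
  have opB: "\<bar>op (t - s) f x\<bar> \<le> C" if x: "x \<in> E" for x
  proof -
    have "\<bar>op (t - s) f x - op (t - s) (\<lambda>_. 0) x\<bar> \<le> C"
      using st x fB by (intro op_diff_le integrable_kernel[OF _ x f fB]) auto
    then show ?thesis using op_const[of "t - s" x] st x by simp
  qed
  have i1: "integrable M (\<lambda>\<omega>. f (X t \<omega>))" and i2: "integrable M (\<lambda>\<omega>. op (t - s) f (X s \<omega>))"
    using st fB opB X_in_E
    by (auto intro!: integrable_const_bound[of _ C] AE_I2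
        intro: measurable_compose[OF X_measurable f] measurable_compose[OF X_measurable op_measurable[OF _ f]])
  have j: "integrable M (\<lambda>\<omega>. H \<omega> * g \<omega>)" if "integrable M g" for g :: "'w \<Rightarrow> real"
    by (rule Bochner_Integration.integrable_bound[OF integrable_mult_right[OF that, of B]])
       (use HM HB borel_measurable_integrable[OF that] in \<open>auto simp: abs_mult intro!: AE_I2 mult_mono order_trans[OF HB]\<close>)
  have B0: "B \<ge> 0" using HB not_empty by force
  have "(\<integral>\<omega>. (H \<omega> + B) * f (X t \<omega>) \<partial>M) = (\<integral>\<omega>. (H \<omega> + B) * op (t - s) f (X s \<omega>) \<partial>M)"
  proof (rule markov_integral_nonneg[OF st _ _ _ f fB])
    fix \<omega> assume "\<omega> \<in> space M"
    from HB[OF this] show "0 \<le> H \<omega> + B" "H \<omega> + B \<le> 2 * B" by (auto simp: abs_le_iff)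
  qed (use H in auto)
  moreover have "(\<integral>\<omega>. B * f (X t \<omega>) \<partial>M) = (\<integral>\<omega>. B * op (t - s) f (X s \<omega>) \<partial>M)"
    using B0 by (intro markov_integral_nonneg[OF st _ _ _ f fB]) auto
  ultimately show ?thesis
    using i1 i2 j[OF i1] j[OF i2] by (auto simp: distrib_right)
qed

end

section \<open>Products of Gaussians at finitely many times\<close>

definition gauss_prod :: "real set \<Rightarrow> (real \<Rightarrow> real) \<Rightarrow> (real \<Rightarrow> real) \<Rightarrow> (real \<Rightarrow> real) \<Rightarrow> real" where
  "gauss_prod S a b w = exp (\<Sum>r\<in>S. b r * w r - a r * (w r)\<^sup>2)"

lemma gauss_prod_pos [simp]: "0 < gauss_prod S a b w"
  by (simp add: gauss_prod_def)

lemma gauss_prod_insert: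
  "finite S \<Longrightarrow> t \<notin> S \<Longrightarrow> gauss_prod (insert t S) a b w = gauss_prod S a b w * gauss (a t) (b t) 0 (w t)"
  by (simp add: gauss_prod_def gauss_def exp_add[symmetric])

text \<open>A further Gaussian at a time already present adds its parameters to those of that time;
  so conditioning on the past does not leave the class of products.\<close>

lemma gauss_prod_absorb:
  assumes "finite S" "s \<in> S"
  shows "gauss_prod S a b w * gauss a' b' c (w s) = exp c * gauss_prod S (a(s := a s + a')) (b(s := b s + b')) w"
proof -
  have "(\<Sum>r\<in>S. (b(s := b s + b')) r * w r - (a(s := a s + a')) r * (w r)\<^sup>2) =
      (\<Sum>r\<in>S. b r * w r - a r * (w r)\<^sup>2) + (b' * w s - a' * (w s)\<^sup>2)"
    using assms by (simp add: sum.remove[of S s] algebra_simps)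
  then show ?thesis by (simp add: gauss_prod_def gauss_def exp_add[symmetric] algebra_simps)
qed

text \<open>Completing the square at each time; the bound does not depend on the path.\<close>

lemma gauss_prod_bounded:
  assumes "\<And>r. r \<in> S \<Longrightarrow> 0 < a r"
  shows "gauss_prod S a b w \<le> exp (\<Sum>r\<in>S. (b r)\<^sup>2 / (4 * a r))"
proof -
  have "b r * w r - a r * (w r)\<^sup>2 \<le> (b r)\<^sup>2 / (4 * a r)" if "r \<in> S" for r
  proof -
    have "0 \<le> (2 * a r * w r - b r)\<^sup>2 / (4 * a r)" using assms[OF that] by simp
    also have "\<dots> = (b r)\<^sup>2 / (4 * a r) - (b r * w r - a r * (w r)\<^sup>2)"
      using assms[OF that] by (simp add: power2_diff power_mult_distrib field_simps power2_eq_square)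
    finally show ?thesis by simp
  qed
  then show ?thesis by (simp add: gauss_prod_def sum_mono)
qed

text \<open>Conditioning on the past of the second largest time merges the Gaussian factor at the
  largest time into the one at the second largest.\<close>

lemma gauss_prod_expectation_limit:
  fixes Z :: "nat \<Rightarrow> real \<Rightarrow> 'w \<Rightarrow> real" and U :: "real \<Rightarrow> 'v \<Rightarrow> real"
  assumes step: "\<And>S a b a' b' s t. finite S \<Longrightarrow> S \<subseteq> {0..s} \<Longrightarrow> (\<And>r. r \<in> S \<Longrightarrow> 0 < a r) \<Longrightarrow> 0 < a' \<Longrightarrow>
      0 \<le> s \<Longrightarrow> s \<le> t \<Longrightarrow>
      (\<lambda>n. (\<integral>\<omega>. gauss_prod S a b (\<lambda>r. Z n r \<omega>) * gauss a' b' 0 (Z n t \<omega>) \<partial>M n)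
         - (\<integral>\<omega>. gauss_prod S a b (\<lambda>r. Z n r \<omega>) * ou_gauss a' b' 0 (t - s) (Z n s \<omega>) \<partial>M n)) \<longlonglongrightarrow> 0"
    and step_lim: "\<And>S a b a' b' s t. finite S \<Longrightarrow> S \<subseteq> {0..s} \<Longrightarrow> (\<And>r. r \<in> S \<Longrightarrow> 0 < a r) \<Longrightarrow> 0 < a' \<Longrightarrow>
      0 \<le> s \<Longrightarrow> s \<le> t \<Longrightarrow>
      (\<integral>\<omega>. gauss_prod S a b (\<lambda>r. U r \<omega>) * gauss a' b' 0 (U t \<omega>) \<partial>N)
         = (\<integral>\<omega>. gauss_prod S a b (\<lambda>r. U r \<omega>) * ou_gauss a' b' 0 (t - s) (U s \<omega>) \<partial>N)"
    and start: "\<And>a b c. 0 < a \<Longrightarrow>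
      (\<lambda>n. \<integral>\<omega>. gauss a b c (Z n 0 \<omega>) \<partial>M n) \<longlonglongrightarrow> (\<integral>\<omega>. gauss a b c (U 0 \<omega>) \<partial>N)"
    and one: "(\<lambda>n. measure (M n) (space (M n))) \<longlonglongrightarrow> measure N (space N)"
    and S: "finite S" "S \<subseteq> {0..}" "\<And>r. r \<in> S \<Longrightarrow> 0 < a r"
  shows "(\<lambda>n. \<integral>\<omega>. gauss_prod S a b (\<lambda>r. Z n r \<omega>) \<partial>M n) \<longlonglongrightarrow> (\<integral>\<omega>. gauss_prod S a b (\<lambda>r. U r \<omega>) \<partial>N)"
  using S
proof (induction S arbitrary: a b rule: finite_linorder_max_induct)
  case empty
  then show ?case using one by (simp add: gauss_prod_def)
next
  case (insert t A)
  have t: "t \<notin> A" "0 \<le> t" "0 < a t" using insert by auto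
  \<comment> \<open>The second largest time, or the starting time 0 when \<open>t\<close> is the
    only one.\<close>
  define s where "s = (if A = {} then 0 else Max A)"
  have s: "A \<subseteq> {0..s}" "0 \<le> s" "s \<le> t"
  proof -
    have "s \<in> A" if "A \<noteq> {}" using that insert(1) by (simp add: s_def)
    moreover have "s = 0" if "A = {}" using that by (simp add: s_def)
    ultimately have "s = 0 \<or> s \<in> A" by blast
    moreover have "A \<subseteq> {0..}" "\<forall>r\<in>A. r < t" using insert by auto
    ultimately show "0 \<le> s" "s \<le> t" using t(2) by (auto simp: less_imp_le)
    show "A \<subseteq> {0..s}" using insert by (cases "A = {}") (auto simp: s_def)
  qed
  have apos: "\<And>r. r \<in> A \<Longrightarrow> 0 < a r" using insert by auto
  have posA: "0 < ou_a (a t) (t - s)" using t s by (intro ou_a_pos) auto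
  have "(\<lambda>n. \<integral>\<omega>. gauss_prod A a b (\<lambda>r. Z n r \<omega>) * ou_gauss (a t) (b t) 0 (t - s) (Z n s \<omega>) \<partial>M n)
      \<longlonglongrightarrow> (\<integral>\<omega>. gauss_prod A a b (\<lambda>r. U r \<omega>) * ou_gauss (a t) (b t) 0 (t - s) (U s \<omega>) \<partial>N)"
  proof (cases "A = {}")
    case True
    \<comment> \<open>With no earlier factor the evolved Gaussian sits at time 0. It carries the
      constant \<open>ou_c\<close>, so \<open>start\<close> is used with a general
      \<open>c\<close>.\<close>
    then show ?thesis using start[OF posA] by (simp add: s_def ou_gauss_def gauss_prod_def)
  next
    case False
    then have sA: "s \<in> A" using insert(1) by (simp add: s_def)
    have "(\<lambda>n. \<integral>\<omega>. gauss_prod A (a(s := a s + ou_a (a t) (t - s))) (b(s := b s + ou_b (a t) (b t) (t - s)))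
          (\<lambda>r. Z n r \<omega>) \<partial>M n) \<longlonglongrightarrow>
        (\<integral>\<omega>. gauss_prod A (a(s := a s + ou_a (a t) (t - s))) (b(s := b s + ou_b (a t) (b t) (t - s)))
          (\<lambda>r. U r \<omega>) \<partial>N)"
      using apos posA s sA by (intro insert.IH) (auto simp: add_pos_pos)
    from tendsto_mult_left[OF this, of "exp (ou_c (a t) (b t) 0 (t - s))"]
    show ?thesis unfolding ou_gauss_def
      by (simp add: gauss_prod_absorb[OF insert(1) sA, where w = "\<lambda>r. _ r _"])
  qed
  moreover have "(\<lambda>n. (\<integral>\<omega>. gauss_prod A a b (\<lambda>r. Z n r \<omega>) * gauss (a t) (b t) 0 (Z n t \<omega>) \<partial>M n)
      - (\<integral>\<omega>. gauss_prod A a b (\<lambda>r. Z n r \<omega>) * ou_gauss (a t) (b t) 0 (t - s) (Z n s \<omega>) \<partial>M n)) \<longlonglongrightarrow> 0"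
    by (rule step) (fact insert(1) s apos t)+
  moreover have "(\<integral>\<omega>. gauss_prod A a b (\<lambda>r. U r \<omega>) * gauss (a t) (b t) 0 (U t \<omega>) \<partial>N)
      = (\<integral>\<omega>. gauss_prod A a b (\<lambda>r. U r \<omega>) * ou_gauss (a t) (b t) 0 (t - s) (U s \<omega>) \<partial>N)"
    by (rule step_lim) (fact insert(1) s apos t)+
  ultimately show ?case
    using tendsto_add by (fastforce simp: gauss_prod_insert[OF insert(1) t(1)])
qed

section \<open>Moments and modulus of continuity\<close>

lemma two_power4_sum_le:
  fixes u v :: real
  shows "(u + v) ^ 4 \<le> 8 * u ^ 4 + 8 * v ^ 4"
proof -
  have "(u + v)\<^sup>2 \<le> 2 * u\<^sup>2 + 2 * v\<^sup>2"
    using zero_le_power2[of "u - v"] by (simp add: power2_sum power2_diff)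
  then have "((u + v)\<^sup>2)\<^sup>2 \<le> (2 * u\<^sup>2 + 2 * v\<^sup>2)\<^sup>2" by (intro power_mono) auto
  also have "\<dots> \<le> 8 * (u\<^sup>2)\<^sup>2 + 8 * (v\<^sup>2)\<^sup>2"
    using zero_le_power2[of "u\<^sup>2 - v\<^sup>2"] by (simp add: power2_sum power2_diff power_mult_distrib)
  finally show ?thesis by (simp add: power_mult[symmetric])
qed

lemma integral_binomial4:
  fixes f0 :: "'a \<Rightarrow> real"
  assumes "integrable M f0" "integrable M f1" "integrable M f2" "integrable M f3" "integrable M f4"
  shows "(\<integral>x. f0 x - 4 * f1 x + 6 * f2 x - 4 * f3 x + f4 x \<partial>M) =
    (\<integral>x. f0 x \<partial>M) - 4 * (\<integral>x. f1 x \<partial>M) + 6 * (\<integral>x. f2 x \<partial>M) - 4 * (\<integral>x. f3 x \<partial>M) + (\<integral>x. f4 x \<partial>M)"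
  using assms by simp

context spherical_semigroup
begin

lemma C0_on_proj_poly: "(\<lambda>x. poly p (proj x)) \<in> C0_on E"
  by (rule C0_on_proj[OF C2_derivs_poly])

text \<open>With \<open>q = p - z\<close>, the projected generator maps \<open>q^4\<close> to at
  most \<open>k q^2\<close> and \<open>q^2\<close> to at most \<open>l\<close>. \<open>F\<close>
  combines them so that both excesses are cancelled: it equals \<open>q^4\<close> at time
  \<open>h\<close>, has time derivative \<open>- k q^2 - k l (h - s)\<close>, and takes the value
  \<open>k l h^2 / 2\<close> at time 0 and \<open>p = z\<close>. \<open>duhamel_le\<close> with
  error 0 then gives a bound free of \<open>d\<close>.\<close>

lemma op_fourth_moment_le:
  assumes h: "0 \<le> h" and x: "x \<in> E"
  shows "op h (\<lambda>y. (proj y - proj x) ^ 4) x \<le> (14 + 3 * (proj x) ^ 4) * h\<^sup>2"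
proof -
  define z where "z = proj x"
  define k where "k = 12 + z\<^sup>2"
  define l where "l = 2 + z\<^sup>2 / 2"
  have kl: "k > 0" "l > 0" by (auto simp: k_def l_def add_pos_nonneg)
  define F F' F'' where "F s p = (p - z) ^ 4 + k * (h - s) * (p - z)\<^sup>2 + k * l * (h - s)\<^sup>2 / 2"
    and "F' s p = 4 * (p - z) ^ 3 + 2 * k * (h - s) * (p - z)"
    and "F'' s p = 12 * (p - z)\<^sup>2 + 2 * k * (h - s)" for s p :: real
  have der: "C2_derivs (F s) (F' s) (F'' s)" for s
    unfolding C2_derivs_def
  proof (intro conjI allI)
    show "(F s has_real_derivative F' s p) (at p)" for p
      unfolding F_def[abs_def] F'_def by (auto intro!: derivative_eq_intros)
    show "(F' s has_real_derivative F'' s p) (at p)" for p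
      unfolding F'_def[abs_def] F''_def by (auto intro!: derivative_eq_intros)
    show "continuous_on UNIV (F'' s)"
      unfolding F''_def[abs_def] by (intro continuous_intros)
  qed
  obtain B where B: "\<And>y. y \<in> E \<Longrightarrow> \<bar>(proj y - z)\<^sup>2\<bar> \<le> B"
    using C0_on_bounded[OF C0_on_proj_poly[of "[:-z, 1:]\<^sup>2"]] by (auto simp: power2_eq_square algebra_simps)
  have "op h (\<lambda>y. F h (proj y)) x \<le> F 0 (proj x) + 0 * h"
  proof (rule duhamel_le[where D = "\<lambda>s y. - k * (proj y - z)\<^sup>2 - k * l * (h - s)"
        and B = "k * B + k * l * h", OF h x generator_proj[OF der]])
    fix s assume s: "0 \<le> s" "s \<le> h"
    have "(\<lambda>y. poly ([:- k:] * [:- z, 1:]\<^sup>2 - [:k * l * (h - s):]) (proj y)) \<in> C0_on E"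
      by (rule C0_on_proj_poly)
    then show "(\<lambda>y. - k * (proj y - z)\<^sup>2 - k * l * (h - s)) \<in> C0_on E"
      by (simp add: algebra_simps)
    fix y assume y: "y \<in> E"
    have "k * (proj y - z)\<^sup>2 \<le> k * B" using B[OF y] kl by (intro mult_left_mono) auto
    moreover have "0 \<le> k * (proj y - z)\<^sup>2" "0 \<le> k * l * (h - s)" "k * l * (h - s) \<le> k * l * h"
      using kl s by auto
    ultimately show "\<bar>- k * (proj y - z)\<^sup>2 - k * l * (h - s)\<bar> \<le> k * B + k * l * h"
      by (simp add: abs_le_iff)
    define q where "q = proj y - z"
    have p: "proj y = q + z" by (simp add: q_def)
    define c where "c = (real d - 1) / real d"
    have c: "0 \<le> c" "c \<le> 1" using d by (auto simp: c_def)
    define r where "r = (q + z)\<^sup>2 / real d"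
    have r: "r \<ge> 0" by (simp add: r_def)
    \<comment> \<open>Completing the square, with equality at \<open>q = - z / 2\<close> when
      \<open>c = 1\<close>. The drift pulls towards 0 and not towards \<open>z\<close>, so it may
      increase the distance from \<open>z\<close>; this is why \<open>k\<close> and \<open>l\<close>
      depend on \<open>z\<close>.\<close>
    have w: "- (c * ((q + z) * q)) \<le> z\<^sup>2 / 4"
    proof -
      have "- ((q + z) * q) \<le> z\<^sup>2 / 4"
        using zero_le_power2[of "q + z / 2"] by (simp add: power2_sum power2_eq_square algebra_simps)
      then have "c * (- ((q + z) * q)) \<le> c * (z\<^sup>2 / 4)" using c by (intro mult_left_mono)
      also have "\<dots> \<le> 1 * (z\<^sup>2 / 4)" using c by (intro mult_right_mono) auto
      finally show ?thesis by simp
    qed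
    have 1: "12 * q\<^sup>2 * (1 - r) \<le> 12 * q\<^sup>2" using r by (simp add: algebra_simps)
    have 2: "4 * q\<^sup>2 * (- (c * ((q + z) * q))) \<le> 4 * q\<^sup>2 * (z\<^sup>2 / 4)" using w by (intro mult_left_mono) auto
    have 3: "2 * k * (h - s) * (1 - r) \<le> 2 * k * (h - s)"
      using r kl s mult_nonneg_nonneg[of "k * (h - s)" r] by (simp add: algebra_simps)
    have 4: "2 * k * (h - s) * (- (c * ((q + z) * q))) \<le> 2 * k * (h - s) * (z\<^sup>2 / 4)"
      using w kl s by (intro mult_left_mono) auto
    have "F'' s (proj y) * (1 - (proj y)\<^sup>2 / real d) - (real d - 1) / real d * proj y * F' s (proj y)
        + (- k * (proj y - z)\<^sup>2 - k * l * (h - s)) =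
      12 * q\<^sup>2 * (1 - r) + 2 * k * (h - s) * (1 - r) + 4 * q\<^sup>2 * (- (c * ((q + z) * q)))
        + 2 * k * (h - s) * (- (c * ((q + z) * q))) - k * q\<^sup>2 - k * l * (h - s)"
      unfolding p F''_def F'_def c_def[symmetric] r_def[symmetric]
      by (simp add: algebra_simps power2_eq_square power3_eq_cube)
    also have "\<dots> \<le> 12 * q\<^sup>2 + 2 * k * (h - s) + 4 * q\<^sup>2 * (z\<^sup>2 / 4)
        + 2 * k * (h - s) * (z\<^sup>2 / 4) - k * q\<^sup>2 - k * l * (h - s)"
      using 1 2 3 4 by linarith
    also have "\<dots> = 0" by (simp add: k_def l_def field_simps)
    finally show "F'' s (proj y) * (1 - (proj y)\<^sup>2 / real d) - (real d - 1) / real d * proj y * F' s (proj y)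
        + (- k * (proj y - z)\<^sup>2 - k * l * (h - s)) \<le> 0" .
  next
    fix e :: real assume e: "e > 0"
    show "\<exists>\<delta>>0. \<forall>s r. 0 \<le> s \<longrightarrow> s \<le> r \<longrightarrow> r \<le> h \<longrightarrow> r \<le> s + \<delta> \<longrightarrow>
      (\<forall>y\<in>E. \<bar>F r (proj y) - F s (proj y) - (r - s) * (- k * (proj y - z)\<^sup>2 - k * l * (h - s))\<bar> \<le> e * (r - s))"
    \<comment> \<open>\<open>F\<close> is quadratic in time, so the remainder is exactly
      \<open>k l / 2\<close> times the squared step, which is at most \<open>e\<close> times the
      step up to this length.\<close>
    proof (intro exI[of _ "2 * e / (k * l)"] conjI allI impI ballI)
      show "2 * e / (k * l) > 0" using e kl by simp
      fix s r y assume "s \<le> r" "r \<le> s + 2 * e / (k * l)"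
      then have "k * l * (r - s) / 2 \<le> e" using kl by (simp add: field_simps)
      then have "k * l * (r - s) / 2 * (r - s) \<le> e * (r - s)" using \<open>s \<le> r\<close> by (intro mult_right_mono) auto
      moreover have "F r (proj y) - F s (proj y) - (r - s) * (- k * (proj y - z)\<^sup>2 - k * l * (h - s)) =
          k * l * (r - s) / 2 * (r - s)"
        unfolding F_def by (simp add: field_simps power2_eq_square)
      moreover have "0 \<le> k * l * (r - s) / 2 * (r - s)" using kl \<open>s \<le> r\<close> by simp
      ultimately show "\<bar>F r (proj y) - F s (proj y) - (r - s) * (- k * (proj y - z)\<^sup>2 - k * l * (h - s))\<bar> \<le> e * (r - s)"
        by simp
    qed
  qed
  then have "op h (\<lambda>y. (proj y - proj x) ^ 4) x \<le> k * l / 2 * h\<^sup>2"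
    by (simp add: F_def z_def)
  \<comment> \<open>The product is \<open>12 + 4 z^2 + z^4 / 4\<close>; trading \<open>z^2\<close>
    for \<open>z^4\<close> leaves a bound that integrates to a fourth moment.\<close>
  also have "k * l / 2 \<le> 14 + 3 * z ^ 4"
  proof -
    have "0 \<le> (z\<^sup>2 - 1)\<^sup>2" by simp
    then have "2 * z\<^sup>2 \<le> z ^ 4 + 1" by (simp add: power2_diff power_mult[symmetric])
    moreover have "k * l / 2 = 12 + 4 * z\<^sup>2 + z ^ 4 / 4"
      by (simp add: k_def l_def field_simps power2_eq_square power4_eq_xxxx)
    moreover have "z ^ 4 \<ge> 0" by simp
    ultimately show ?thesis by linarith
  qed
  finally show ?thesis by (simp add: z_def mult_right_mono)
qed

end

locale spherical_process = spherical_semigroup d P \<theta> +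
    feller_markov "sphere_sqrt d (real d)" P M X
  for d P \<theta> and M :: "'w measure" and X
begin

lemma continuous_on_proj: "continuous_on A proj"
  unfolding dotp_def[abs_def]
  by (intro continuous_intros continuous_on_subset[OF continuous_on_product_coordinates]) auto

lemma proj_measurable: "proj \<in> borel_measurable borel"
  by (rule borel_measurable_continuous_onI[OF continuous_on_proj])

lemma proj_X_natural_filtration:
  "0 \<le> r \<Longrightarrow> r \<le> s \<Longrightarrow> (\<lambda>\<omega>. proj (X r \<omega>)) \<in> borel_measurable (natural_filtration M X s)"
  by (rule measurable_compose[OF X_measurable_natural_filtration proj_measurable])

lemma proj_X_measurable [measurable]: "0 \<le> t \<Longrightarrow> (\<lambda>\<omega>. proj (X t \<omega>)) \<in> borel_measurable M"
  by (rule measurable_compose[OF X_measurable_borel proj_measurable])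

lemma proj_bounded: obtains B where "B \<ge> 0" "\<And>x. x \<in> E \<Longrightarrow> \<bar>proj x\<bar> \<le> B"
  using C0_on_bounded[OF C0_on_proj_poly[of "[:0, 1:]"]] by (auto simp: algebra_simps)

text \<open>\<open>markov_integral\<close> handles a product of a factor from the past and a
  function of \<open>X t\<close>, so the fourth power is expanded, each term is conditioned
  separately, and the terms are reassembled with \<open>proj (X s \<omega>)\<close> frozen.
  \<open>op_fourth_moment_le\<close> then applies at the starting point
  \<open>X s \<omega>\<close>.\<close>

lemma increment_fourth_moment_aux:
  assumes st: "0 \<le> s" "s \<le> t"
  shows "expectation (\<lambda>\<omega>. (proj (X t \<omega>) - proj (X s \<omega>)) ^ 4)
    \<le> (14 + 3 * expectation (\<lambda>\<omega>. (proj (X s \<omega>)) ^ 4)) * (t - s)\<^sup>2"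
proof -
  obtain B where B: "B \<ge> 0" "\<And>x. x \<in> E \<Longrightarrow> \<bar>proj x\<bar> \<le> B" using proj_bounded by metis
  have t: "0 \<le> t" using st by simp
  have pc: "(\<lambda>x. proj x ^ n) \<in> C0_on E" for n
    using C0_on_proj_poly[of "monom 1 n"] by (simp add: poly_monom)
  have Bn: "\<bar>proj x ^ n\<bar> \<le> B ^ n" if "x \<in> E" for x n
    using B(2)[OF that] by (simp add: power_abs power_mono)
  have int1: "integrable M (\<lambda>\<omega>. proj (X s \<omega>) ^ m * proj (X t \<omega>) ^ n)" for m n
  proof (rule integrable_const_bound[of _ "B ^ m * B ^ n"])
    show "AE \<omega> in M. norm (proj (X s \<omega>) ^ m * proj (X t \<omega>) ^ n) \<le> B ^ m * B ^ n"
    proof (rule AE_I2)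
      fix \<omega> assume "\<omega> \<in> space M"
      then show "norm (proj (X s \<omega>) ^ m * proj (X t \<omega>) ^ n) \<le> B ^ m * B ^ n"
        unfolding real_norm_def abs_mult[of "_ ^ m"] using X_in_E st t B(1)
        by (intro mult_mono Bn) auto
    qed
  qed (intro borel_measurable_times borel_measurable_power proj_X_measurable st t)
  have "\<exists>b. \<forall>x\<in>E. \<bar>op (t - s) (\<lambda>y. proj y ^ n) x\<bar> \<le> b" for n
  proof -
    have "op (t - s) (\<lambda>y. proj y ^ n) \<in> C0_on E" using op_C0[OF _ pc, of "t - s" n] st by simp
    then obtain b where "\<And>x. x \<in> E \<Longrightarrow> \<bar>op (t - s) (\<lambda>y. proj y ^ n) x\<bar> \<le> b"
      using C0_on_bounded by metis
    then show ?thesis by (intro exI[of _ b] ballI)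
  qed
  then obtain B' where B': "\<And>n x. x \<in> E \<Longrightarrow> \<bar>op (t - s) (\<lambda>y. proj y ^ n) x\<bar> \<le> B' n"
    by metis
  have opm: "(\<lambda>\<omega>. op (t - s) (\<lambda>y. proj y ^ n) (X s \<omega>)) \<in> borel_measurable M" for n
    using st by (intro measurable_compose[OF X_measurable op_measurable[OF _ C0_on_measurable[OF pc]]]) auto
  have int2: "integrable M (\<lambda>\<omega>. proj (X s \<omega>) ^ m * op (t - s) (\<lambda>y. proj y ^ n) (X s \<omega>))" for m n
  proof (rule integrable_const_bound[of _ "B ^ m * B' n"])
    show "AE \<omega> in M. norm (proj (X s \<omega>) ^ m * op (t - s) (\<lambda>y. proj y ^ n) (X s \<omega>)) \<le> B ^ m * B' n"
    proof (rule AE_I2)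
      fix \<omega> assume "\<omega> \<in> space M"
      then show "norm (proj (X s \<omega>) ^ m * op (t - s) (\<lambda>y. proj y ^ n) (X s \<omega>)) \<le> B ^ m * B' n"
        unfolding real_norm_def abs_mult[of "_ ^ m"] using X_in_E st t B(1)
        by (intro mult_mono Bn B') auto
    qed
  qed (intro borel_measurable_times borel_measurable_power proj_X_measurable opm st)
  have mk: "expectation (\<lambda>\<omega>. proj (X s \<omega>) ^ m * proj (X t \<omega>) ^ n) =
      expectation (\<lambda>\<omega>. proj (X s \<omega>) ^ m * op (t - s) (\<lambda>y. proj y ^ n) (X s \<omega>))" for m n
    using Bn X_in_E st
    by (intro markov_integral[OF st _ _ C0_on_measurable[OF pc], where B = "B ^ m" and C = "B ^ n"]
        borel_measurable_power proj_X_natural_filtration) auto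
  \<comment> \<open>The trivial powers 0 and 1 are kept, so that all five terms match the pattern of
    \<open>int1\<close>, \<open>int2\<close> and \<open>mk\<close>.\<close>
  have binom: "(u - v) ^ 4 =
      v ^ 0 * u ^ 4 - 4 * (v ^ 1 * u ^ 3) + 6 * (v ^ 2 * u ^ 2) - 4 * (v ^ 3 * u ^ 1) + v ^ 4 * u ^ 0"
    for u v :: real by (simp add: power4_eq_xxxx power3_eq_cube power2_eq_square algebra_simps)
  define G where "G \<omega> = proj (X s \<omega>) ^ 0 * op (t - s) (\<lambda>y. proj y ^ 4) (X s \<omega>)
      - 4 * (proj (X s \<omega>) ^ 1 * op (t - s) (\<lambda>y. proj y ^ 3) (X s \<omega>))
      + 6 * (proj (X s \<omega>) ^ 2 * op (t - s) (\<lambda>y. proj y ^ 2) (X s \<omega>))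
      - 4 * (proj (X s \<omega>) ^ 3 * op (t - s) (\<lambda>y. proj y ^ 1) (X s \<omega>))
      + proj (X s \<omega>) ^ 4 * op (t - s) (\<lambda>y. proj y ^ 0) (X s \<omega>)" for \<omega>
  have "expectation (\<lambda>\<omega>. (proj (X t \<omega>) - proj (X s \<omega>)) ^ 4) =
      expectation (\<lambda>\<omega>. proj (X s \<omega>) ^ 0 * proj (X t \<omega>) ^ 4)
      - 4 * expectation (\<lambda>\<omega>. proj (X s \<omega>) ^ 1 * proj (X t \<omega>) ^ 3)
      + 6 * expectation (\<lambda>\<omega>. proj (X s \<omega>) ^ 2 * proj (X t \<omega>) ^ 2)
      - 4 * expectation (\<lambda>\<omega>. proj (X s \<omega>) ^ 3 * proj (X t \<omega>) ^ 1)
      + expectation (\<lambda>\<omega>. proj (X s \<omega>) ^ 4 * proj (X t \<omega>) ^ 0)"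
    unfolding binom by (intro integral_binomial4 int1)
  also have "\<dots> = expectation G"
    unfolding mk G_def by (intro integral_binomial4[symmetric] int2)
  also have "expectation G \<le> expectation (\<lambda>\<omega>. (14 + 3 * (proj (X s \<omega>)) ^ 4) * (t - s)\<^sup>2)"
  proof (rule integral_mono)
    show "integrable M G" unfolding G_def
      by (intro Bochner_Integration.integrable_add Bochner_Integration.integrable_diff integrable_mult_right int2)
    have "integrable M (\<lambda>\<omega>. proj (X s \<omega>) ^ 4)" using int1[of 4 0] by simp
    then show "integrable M (\<lambda>\<omega>. (14 + 3 * proj (X s \<omega>) ^ 4) * (t - s)\<^sup>2)" by simp
    fix \<omega> assume "\<omega> \<in> space M"
    then have xE: "X s \<omega> \<in> E" using X_in_E st by simp
    define z where "z = proj (X s \<omega>)"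
    have i: "integrable (P (t - s) (X s \<omega>)) (\<lambda>y. proj y ^ n)" for n
      using st xE by (intro integrable_C0 pc) auto
    have "G \<omega> = op (t - s) (\<lambda>y. (proj y - z) ^ 4) (X s \<omega>)"
      unfolding binom G_def semigroup_op_def z_def[symmetric]
      by (subst integral_binomial4) ((intro integrable_mult_right i)+, simp only: integral_mult_right_zero)
    then show "G \<omega> \<le> (14 + 3 * proj (X s \<omega>) ^ 4) * (t - s)\<^sup>2"
      using op_fourth_moment_le[OF _ xE, of "t - s"] st by (simp add: z_def)
  qed
  also have "\<dots> = (14 + 3 * expectation (\<lambda>\<omega>. (proj (X s \<omega>)) ^ 4)) * (t - s)\<^sup>2"
    using int1[of 4 0] by (simp add: prob_space)
  finally show ?thesis .
qed

lemma integrable_increment: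
  assumes "0 \<le> r" "0 \<le> t"
  shows "integrable M (\<lambda>\<omega>. (proj (X t \<omega>) - proj (X r \<omega>)) ^ 4)"
proof -
  obtain B where B: "B \<ge> 0" "\<And>x. x \<in> E \<Longrightarrow> \<bar>proj x\<bar> \<le> B" using proj_bounded by metis
  show ?thesis
  proof (rule integrable_const_bound[of _ "(2 * B) ^ 4"])
    show "AE \<omega> in M. norm ((proj (X t \<omega>) - proj (X r \<omega>)) ^ 4) \<le> (2 * B) ^ 4"
    proof (rule AE_I2)
      fix \<omega> assume "\<omega> \<in> space M"
      then have "\<bar>proj (X t \<omega>) - proj (X r \<omega>)\<bar> \<le> 2 * B"
        using B(2)[OF X_in_E[of t \<omega>]] B(2)[OF X_in_E[of r \<omega>]] assms by simp
      then show "norm ((proj (X t \<omega>) - proj (X r \<omega>)) ^ 4) \<le> (2 * B) ^ 4"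
        unfolding real_norm_def power_abs by (intro power_mono) auto
    qed
  qed (use assms in measurable)
qed

text \<open>The previous bound is used twice: from time 0 to \<open>s\<close> it controls the fourth
  moment at \<open>s\<close> by the deterministic starting value, and this is fed into the bound
  from \<open>s\<close> to \<open>t\<close>. The factor 24 is 3 times the 8 of
  \<open>two_power4_sum_le\<close>.\<close>

lemma increment_fourth_moment:
  assumes x0: "AE \<omega> in M. proj (X 0 \<omega>) = y0" and st: "0 \<le> s" "s \<le> t" "t \<le> T"
  shows "expectation (\<lambda>\<omega>. (proj (X t \<omega>) - proj (X s \<omega>)) ^ 4)
    \<le> (14 + 24 * (y0 ^ 4 + (14 + 3 * y0 ^ 4) * T\<^sup>2)) * (t - s)\<^sup>2"
proof -
  obtain B where B: "B \<ge> 0" "\<And>x. x \<in> E \<Longrightarrow> \<bar>proj x\<bar> \<le> B" using proj_bounded by metis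
  have i: "integrable M (\<lambda>\<omega>. proj (X r \<omega>) ^ 4)" if "0 \<le> r" for r
  proof (rule integrable_const_bound[of _ "B ^ 4"])
    show "AE \<omega> in M. norm (proj (X r \<omega>) ^ 4) \<le> B ^ 4"
      unfolding real_norm_def power_abs using B X_in_E that by (intro AE_I2 power_mono) auto
  qed (use that in measurable)
  have i2: "integrable M (\<lambda>\<omega>. (proj (X s \<omega>) - proj (X 0 \<omega>)) ^ 4)"
    using st by (intro integrable_increment) auto
  have e0: "expectation (\<lambda>\<omega>. (proj (X 0 \<omega>)) ^ 4) = y0 ^ 4"
  proof -
    have "expectation (\<lambda>\<omega>. (proj (X 0 \<omega>)) ^ 4) = expectation (\<lambda>\<omega>. y0 ^ 4)"
      using x0 by (intro integral_cong_AE) (auto elim: eventually_mono)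
    then show ?thesis by (simp add: prob_space)
  qed
  have "expectation (\<lambda>\<omega>. (proj (X s \<omega>)) ^ 4) \<le>
      expectation (\<lambda>\<omega>. 8 * (proj (X s \<omega>) - proj (X 0 \<omega>)) ^ 4 + 8 * (proj (X 0 \<omega>)) ^ 4)"
    using two_power4_sum_le[of "proj (X s \<omega>) - proj (X 0 \<omega>)" "proj (X 0 \<omega>)" for \<omega>] i i2 st
    by (intro integral_mono) auto
  also have "\<dots> = 8 * expectation (\<lambda>\<omega>. (proj (X s \<omega>) - proj (X 0 \<omega>)) ^ 4) + 8 * y0 ^ 4"
    using i2 i[of 0] e0 by simp
  also have "expectation (\<lambda>\<omega>. (proj (X s \<omega>) - proj (X 0 \<omega>)) ^ 4) \<le> (14 + 3 * y0 ^ 4) * s\<^sup>2"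
    using increment_fourth_moment_aux[of 0 s] st e0 by simp
  also have "(14 + 3 * y0 ^ 4) * s\<^sup>2 \<le> (14 + 3 * y0 ^ 4) * T\<^sup>2"
    using st by (intro mult_left_mono power_mono) auto
  finally have "expectation (\<lambda>\<omega>. (proj (X s \<omega>)) ^ 4) \<le> 8 * (y0 ^ 4 + (14 + 3 * y0 ^ 4) * T\<^sup>2)" by simp
  then have "(14 + 3 * expectation (\<lambda>\<omega>. (proj (X s \<omega>)) ^ 4)) * (t - s)\<^sup>2 \<le>
      (14 + 24 * (y0 ^ 4 + (14 + 3 * y0 ^ 4) * T\<^sup>2)) * (t - s)\<^sup>2"
    by (intro mult_right_mono) auto
  then show ?thesis using increment_fourth_moment_aux[OF st(1,2)] by linarith
qed

end

text \<open>Chaining along dyadic points starting at the left end point; the thresholds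
  \<open>e / 10 * (9 / 10) ^ n\<close> sum up to \<open>e\<close>, and \<open>2 * (1 / 4) / (9 / 10) ^ 4 < 1\<close>.\<close>

lemma (in prob_space) maximal_inequality:
  fixes Z :: "real \<Rightarrow> 'a \<Rightarrow> real"
  assumes h: "h > 0" and e: "e > 0" and C: "C \<ge> 0"
    and meas: "\<And>t. t \<in> {s..s + h} \<Longrightarrow> Z t \<in> borel_measurable M"
    and cont: "\<And>\<omega>. \<omega> \<in> space M \<Longrightarrow> continuous_on {s..s + h} (\<lambda>t. Z t \<omega>)"
    and int: "\<And>r t. s \<le> r \<Longrightarrow> r \<le> t \<Longrightarrow> t \<le> s + h \<Longrightarrow> integrable M (\<lambda>\<omega>. (Z t \<omega> - Z r \<omega>) ^ 4)"
    and mom: "\<And>r t. s \<le> r \<Longrightarrow> r \<le> t \<Longrightarrow> t \<le> s + h \<Longrightarrow>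
      expectation (\<lambda>\<omega>. (Z t \<omega> - Z r \<omega>) ^ 4) \<le> C * (t - r)\<^sup>2"
  obtains A where "A \<in> sets M" "prob A \<le> 50000 * C * h\<^sup>2 / e ^ 4"
    "\<And>\<omega> t. \<omega> \<in> space M - A \<Longrightarrow> t \<in> {s..s + h} \<Longrightarrow> \<bar>Z t \<omega> - Z s \<omega>\<bar> \<le> e"
proof -
  define pt where "pt n k = s + real k * h / 2 ^ n" for n k :: nat
  define thr where "thr n = e / 10 * (9 / 10) ^ n" for n :: nat
  have thr_pos: "thr n > 0" for n using e by (simp add: thr_def)
  define A where "A n k = {\<omega> \<in> space M. thr n ^ 4 \<le> (Z (pt n (Suc k)) \<omega> - Z (pt n k) \<omega>) ^ 4}" for n k
  have pt_mem: "pt n k \<in> {s..s + h}" if "k \<le> 2 ^ n" for n k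
  proof -
    have "real k \<le> real (2 ^ n)" using that by (rule of_nat_mono)
    then have "real k * h \<le> 2 ^ n * h" using h by (intro mult_right_mono) auto
    then show ?thesis using h by (simp add: pt_def field_simps)
  qed
  have pt_le: "pt n k \<le> pt n (Suc k)" for n k using h by (simp add: pt_def divide_right_mono mult_right_mono)
  have pt_diff: "pt n (Suc k) - pt n k = h / 2 ^ n" for n k
    by (simp add: pt_def field_simps)
  have A_sets: "A n k \<in> sets M" if "k < 2 ^ n" for n k
  proof -
    have [measurable]: "Z (pt n (Suc k)) \<in> borel_measurable M" "Z (pt n k) \<in> borel_measurable M"
      using pt_mem that by (auto intro!: meas)
    show ?thesis unfolding A_def by measurable
  qed
  \<comment> \<open>Level \<open>n\<close> has \<open>2 ^ n\<close> increments, and with these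
    values each is bad with probability at most \<open>K q^n / 2^n\<close>. The factor
    \<open>10000\<close> in \<open>K\<close> is the fourth power of the 10 in
    \<open>thr 0 = e / 10\<close>.\<close>
  define q :: real where "q = 5000 / 6561"
  define K where "K = 10000 * C * h\<^sup>2 / e ^ 4"
  have K: "K \<ge> 0" using C e by (simp add: K_def)
  have A_prob: "prob (A n k) \<le> K * q ^ n / 2 ^ n" if k: "k < 2 ^ n" for n k
  proof -
    have m: "s \<le> pt n k" "pt n (Suc k) \<le> s + h" using pt_mem[of k n] pt_mem[of "Suc k" n] k by auto
    have "prob (A n k) \<le> expectation (\<lambda>\<omega>. (Z (pt n (Suc k)) \<omega> - Z (pt n k) \<omega>) ^ 4) / thr n ^ 4"
      unfolding A_def using thr_pos[of n] m pt_le
      by (intro integral_Markov_inequality_measure[of _ _ "{}"] int) auto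
    also have "\<dots> \<le> C * (h / 2 ^ n)\<^sup>2 / thr n ^ 4"
      using mom[OF m(1) pt_le m(2)] thr_pos[of n] by (intro divide_right_mono) (auto simp: pt_diff)
    also have "\<dots> = K * q ^ n / 2 ^ n"
    proof -
      have p1: "(2::real) ^ n * 2 ^ n = 4 ^ n" by (simp add: power_mult_distrib[symmetric])
      have p2: "((9 / 10 :: real) ^ n) ^ 4 = (6561 / 10000) ^ n"
        by (simp add: power_mult[symmetric] mult.commute[of n]) (simp add: power_mult power_divide)
      have p3: "(5000 / 6561 :: real) ^ n / 2 ^ n = 1 / (4 ^ n * (6561 / 10000) ^ n)"
        by (simp add: power_divide[symmetric] power_mult_distrib[symmetric] power_one_over[symmetric])
      have "thr n ^ 4 = e ^ 4 / 10000 * (6561 / 10000) ^ n"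
        unfolding thr_def power_mult_distrib p2 by (simp add: power_divide)
      moreover have "C * (h / 2 ^ n)\<^sup>2 = C * h\<^sup>2 / 4 ^ n" using p1 by (simp add: power2_eq_square)
      moreover have "C * h\<^sup>2 / u / (e ^ 4 / 10000 * v) = K * (1 / (u * v))" for u v
        by (simp add: K_def mult_ac)
      ultimately have "C * (h / 2 ^ n)\<^sup>2 / thr n ^ 4 = K * (1 / (4 ^ n * (6561 / 10000) ^ n))"
        by (simp only:)
      then show ?thesis by (simp only: p3[symmetric] q_def times_divide_eq_right)
    qed
    finally show ?thesis .
  qed
  define Bn where "Bn n = (\<Union>k<2 ^ n. A n k)" for n :: nat
  have Bn_sets: "Bn n \<in> sets M" for n unfolding Bn_def using A_sets by (intro sets.finite_UN) auto
  have Bn_prob: "prob (Bn n) \<le> K * q ^ n" for n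
  proof -
    have "prob (Bn n) \<le> (\<Sum>k<2 ^ n. prob (A n k))"
      unfolding Bn_def using A_sets by (intro finite_measure_subadditive_finite) auto
    also have "\<dots> \<le> (\<Sum>k<(2::nat) ^ n. K * q ^ n / 2 ^ n)"
      using A_prob by (intro sum_mono) auto
    also have "\<dots> = K * q ^ n" by simp
    finally show ?thesis .
  qed
  have q: "0 \<le> q" "q < 1" by (auto simp: q_def)
  have geo: "(\<lambda>n. K * q ^ n) sums (K * (1 / (1 - q)))"
    using q by (intro sums_mult geometric_sums) auto
  have sum_Bn: "summable (\<lambda>n. prob (Bn n))"
    by (rule summable_comparison_test'[OF sums_summable[OF geo], of 0]) (use Bn_prob in auto)
  have "prob (\<Union>n. Bn n) \<le> (\<Sum>n. prob (Bn n))"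
    using Bn_sets sum_Bn by (intro finite_measure_subadditive_countably) auto
  also have "\<dots> \<le> (\<Sum>n. K * q ^ n)"
    by (rule suminf_le[OF Bn_prob sum_Bn sums_summable[OF geo]])
  also have "\<dots> = K * (1 / (1 - q))" using geo by (simp add: sums_iff)
  \<comment> \<open>\<open>1 / (1 - q) = 6561 / 1561 \<le> 5\<close>, whence the constant
    \<open>50000\<close>.\<close>
  also have "\<dots> \<le> K * 5" using K by (intro mult_left_mono) (simp_all add: q_def)
  finally have prob: "prob (\<Union>n. Bn n) \<le> 50000 * C * h\<^sup>2 / e ^ 4" by (simp add: K_def)
  have good: "\<bar>Z t \<omega> - Z s \<omega>\<bar> \<le> e" if \<omega>: "\<omega> \<in> space M - (\<Union>n. Bn n)" and t: "t \<in> {s..s + h}" for \<omega> t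
  proof -
    have step: "\<bar>Z (pt n (Suc k)) \<omega> - Z (pt n k) \<omega>\<bar> \<le> thr n" if "k < 2 ^ n" for n k
    proof (rule ccontr)
      assume "\<not> ?thesis"
      then have "thr n ^ 4 \<le> \<bar>Z (pt n (Suc k)) \<omega> - Z (pt n k) \<omega>\<bar> ^ 4"
        using thr_pos[of n] by (intro power_mono) auto
      then have "\<omega> \<in> A n k" using \<omega> by (simp add: A_def)
      then show False using \<omega> that by (auto simp: Bn_def)
    qed
    have dyadic: "\<bar>Z (pt n k) \<omega> - Z s \<omega>\<bar> \<le> (\<Sum>i\<le>n. thr i)" if "k \<le> 2 ^ n" for n k
      using that
    \<comment> \<open>An even point of level \<open>n + 1\<close> already belongs to level
      \<open>n\<close>; an odd one is a single increment to the right of such a point, which costs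
      \<open>thr (Suc n)\<close>.\<close>
    proof (induction n arbitrary: k)
      case 0
      then have "k = 0 \<or> k = 1" by auto
      then show ?case using step[of 0 0] thr_pos[of 0] by (auto simp: pt_def)
    next
      case (Suc n)
      have half: "pt (Suc n) (2 * j) = pt n j" for j by (simp add: pt_def)
      show ?case
      proof (cases "even k")
        case True
        then obtain j where j: "k = 2 * j" by auto
        then have "j \<le> 2 ^ n" using Suc.prems by simp
        then show ?thesis using Suc.IH[of j] thr_pos[of "Suc n"] by (simp add: j half)
      next
        case False
        then obtain j where j: "k = Suc (2 * j)" by (auto elim: oddE)
        then have "j \<le> 2 ^ n" "2 * j < 2 ^ Suc n" using Suc.prems by auto
        then show ?thesis using Suc.IH[of j] step[of "2 * j" "Suc n"] by (simp add: j half)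
      qed
    qed
    have thr_sum: "(\<Sum>i\<le>n. thr i) \<le> e" for n
    proof -
      have "(\<Sum>i\<le>n. thr i) = e / 10 * (\<Sum>i<Suc n. (9 / 10) ^ i)"
        by (simp only: thr_def sum_distrib_left lessThan_Suc_atMost)
      also have "(\<Sum>i<Suc n. (9 / 10 :: real) ^ i) = 10 * (1 - (9 / 10) ^ Suc n)"
        by (subst geometric_sum) auto
      also have "e / 10 * \<dots> \<le> e / 10 * 10"
        using e by (intro mult_left_mono) auto
      finally show ?thesis by simp
    qed
    \<comment> \<open>The dyadic point just to the left of \<open>t\<close>; continuity of the path
      carries the bound from these points to \<open>t\<close>.\<close>
    define k where "k n = nat \<lfloor>(t - s) / h * 2 ^ n\<rfloor>" for n :: nat
    have ts: "0 \<le> (t - s) / h" "(t - s) / h \<le> 1" using t h by auto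
    have k_le: "k n \<le> 2 ^ n" for n
    proof -
      have "(t - s) / h * 2 ^ n \<le> 1 * 2 ^ n" using ts by (intro mult_right_mono) auto
      then have "\<lfloor>(t - s) / h * 2 ^ n\<rfloor> \<le> 2 ^ n" by (simp add: floor_le_iff)
      then show ?thesis unfolding k_def by (simp add: nat_le_iff)
    qed
    have pt_close: "\<bar>pt n (k n) - t\<bar> \<le> h * (1 / 2) ^ n" for n
    proof -
      define w where "w = (t - s) / h * 2 ^ n"
      have w0: "w \<ge> 0" unfolding w_def by (rule mult_nonneg_nonneg[OF ts(1)]) simp
      have "real (k n) = of_int \<lfloor>w\<rfloor>" using w0 unfolding k_def w_def[symmetric] by (intro of_nat_nat) simp
      then have kr: "real (k n) \<le> w" "w \<le> real (k n) + 1" by linarith+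
      have tw: "t = s + w * h / 2 ^ n" using h by (simp add: w_def)
      have "pt n (k n) - t = (real (k n) - w) * (h / 2 ^ n)"
        unfolding pt_def by (subst tw) (simp add: field_simps)
      then have "\<bar>pt n (k n) - t\<bar> = \<bar>real (k n) - w\<bar> * (h / 2 ^ n)" using h by (simp add: abs_mult)
      also have "\<dots> \<le> 1 * (h / 2 ^ n)" using kr h by (intro mult_right_mono) auto
      finally show ?thesis by (simp add: power_one_over)
    qed
    have "(\<lambda>n. h * (1 / 2) ^ n) \<longlonglongrightarrow> h * 0" by (intro tendsto_mult_left LIMSEQ_power_zero) auto
    then have "(\<lambda>n. h * (1 / 2) ^ n) \<longlonglongrightarrow> 0" by simp
    then have "(\<lambda>n. pt n (k n) - t) \<longlonglongrightarrow> 0"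
      by (rule Lim_null_comparison[rotated]) (use pt_close in auto)
    then have "(\<lambda>n. pt n (k n)) \<longlonglongrightarrow> t" by (simp add: LIM_zero_iff)
    then have "(\<lambda>n. Z (pt n (k n)) \<omega>) \<longlonglongrightarrow> Z t \<omega>"
      using continuous_on_tendsto_compose[OF cont, of \<omega> "\<lambda>n. pt n (k n)" t] \<omega> t pt_mem k_le by auto
    then have "(\<lambda>n. \<bar>Z (pt n (k n)) \<omega> - Z s \<omega>\<bar>) \<longlonglongrightarrow> \<bar>Z t \<omega> - Z s \<omega>\<bar>"
      by (intro tendsto_intros)
    then show ?thesis
      by (rule LIMSEQ_le_const2) (use dyadic[OF k_le] thr_sum in \<open>meson order_trans\<close>)
  qed
  show ?thesis
    using Bn_sets by (intro that[of "\<Union>n. Bn n"] prob good) auto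
qed

text \<open>A modulus of continuity on \<open>[0, j]\<close>, recorded relative to the left end
  points of cells of length \<open>1 / n\<close>. It consists of non-strict inequalities between
  evaluations, hence is closed under pointwise convergence, and it is the form that chaining
  delivers.\<close>

definition cells :: "nat \<Rightarrow> nat \<Rightarrow> real \<Rightarrow> (real \<Rightarrow> real) \<Rightarrow> bool" where
  "cells j n e w \<longleftrightarrow> (\<forall>i<j * n. \<forall>t\<in>{real i / n .. real (Suc i) / n}. \<bar>w t - w (real i / n)\<bar> \<le> e)"

lemma cell_bounds:
  fixes i j n :: nat and t :: real
  assumes i: "i < j * n" and t: "t \<in> {real i / n .. real (Suc i) / n}"
  shows "0 \<le> real i / n" "real i / n \<le> t" "t \<le> real i / n + 1 / real n" "real i / n + 1 / real n \<le> real j"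
    and "0 \<le> t"
proof -
  have n: "n > 0" using i by (cases n) auto
  show "0 \<le> real i / n" "real i / n \<le> t" "t \<le> real i / n + 1 / n"
    using t by (auto simp: add_divide_distrib)
  have "0 \<le> real i / n" by simp
  then show "0 \<le> t" using t unfolding atLeastAtMost_iff by linarith
  have "real (Suc i) \<le> real (j * n)" using i by (intro of_nat_mono) simp
  then show "real i / n + 1 / n \<le> real j" using n by (simp add: field_simps)
qed

text \<open>There are \<open>j n\<close> cells of length \<open>1 / n\<close>, each failing with
  probability \<open>O(1 / n^2)\<close> by \<open>maximal_inequality\<close>; the union bound leaves
  \<open>O(1 / n)\<close>. The dimension enters the constant only through \<open>y0\<close>.\<close>

lemma (in spherical_process) cells_prob:
  assumes x0: "AE \<omega> in M. proj (X 0 \<omega>) = y0"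
    and cont: "\<And>\<omega>. \<omega> \<in> space M \<Longrightarrow> continuous_on {0..} (\<lambda>t. X t \<omega>)"
    and e: "e > 0" and n: "n > 0"
  obtains A where "A \<in> sets M"
    "prob A \<le> 50000 * (14 + 24 * (y0 ^ 4 + (14 + 3 * y0 ^ 4) * (real j)\<^sup>2)) * real j / (real n * e ^ 4)"
    "\<And>\<omega>. \<omega> \<in> space M - A \<Longrightarrow> cells j n e (\<lambda>t. proj (X t \<omega>))"
proof -
  define C where "C = 14 + 24 * (y0 ^ 4 + (14 + 3 * y0 ^ 4) * (real j)\<^sup>2)"
  have C: "C \<ge> 0" by (simp add: C_def)
  have "\<exists>A. A \<in> sets M \<and> prob A \<le> 50000 * C * (1 / real n)\<^sup>2 / e ^ 4 \<and>
      (\<forall>\<omega>\<in>space M - A. \<forall>t\<in>{real i / n .. real (Suc i) / n}. \<bar>proj (X t \<omega>) - proj (X (real i / n) \<omega>)\<bar> \<le> e)"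
    if i: "i < j * n" for i
  proof -
    have s0: "0 \<le> real i / real n" by simp
    have sj: "real i / real n + 1 / real n \<le> real j"
      by (rule cell_bounds(4)[OF i, of "real i / n"]) (simp add: divide_right_mono)
    have sS: "real (Suc i) / real n = real i / real n + 1 / real n" by (simp add: add_divide_distrib)
    obtain A where "A \<in> sets M" "prob A \<le> 50000 * C * (1 / real n)\<^sup>2 / e ^ 4"
      "\<And>\<omega> t. \<omega> \<in> space M - A \<Longrightarrow> t \<in> {real i / n .. real i / n + 1 / n} \<Longrightarrow>
        \<bar>proj (X t \<omega>) - proj (X (real i / n) \<omega>)\<bar> \<le> e"
    proof (rule maximal_inequality[where Z = "\<lambda>t \<omega>. proj (X t \<omega>)" and s = "real i / n" and h = "1 / n", OF _ e C])
      show "1 / real n > 0" using n by simp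
      fix \<omega> assume "\<omega> \<in> space M"
      then have "continuous_on {real i / real n..real i / real n + 1 / real n} (\<lambda>t. X t \<omega>)"
        using s0 by (intro continuous_on_subset[OF cont]) (auto intro: order_trans)
      then show "continuous_on {real i / real n..real i / real n + 1 / real n} (\<lambda>t. proj (X t \<omega>))"
        by (rule continuous_on_compose2[OF continuous_on_proj[of UNIV]]) auto
    next
      fix t assume "t \<in> {real i / real n..real i / real n + 1 / real n}"
      then show "(\<lambda>\<omega>. proj (X t \<omega>)) \<in> borel_measurable M"
        using s0 by (intro proj_X_measurable) (simp only: atLeastAtMost_iff, linarith)
    next
      fix r t assume rt: "real i / real n \<le> r" "r \<le> t" "t \<le> real i / real n + 1 / real n"
      have r0: "0 \<le> r" "0 \<le> t" using s0 rt by linarith+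
      show "expectation (\<lambda>\<omega>. (proj (X t \<omega>) - proj (X r \<omega>)) ^ 4) \<le> C * (t - r)\<^sup>2"
        unfolding C_def using rt r0 sj by (intro increment_fourth_moment[OF x0]) auto
      show "integrable M (\<lambda>\<omega>. (proj (X t \<omega>) - proj (X r \<omega>)) ^ 4)" by (rule integrable_increment[OF r0])
    qed blast
    then show ?thesis unfolding sS by blast
  qed
  then obtain A where A: "\<And>i. i < j * n \<Longrightarrow> A i \<in> sets M"
    "\<And>i. i < j * n \<Longrightarrow> prob (A i) \<le> 50000 * C * (1 / real n)\<^sup>2 / e ^ 4"
    "\<And>i \<omega> t. i < j * n \<Longrightarrow> \<omega> \<in> space M - A i \<Longrightarrow> t \<in> {real i / n .. real (Suc i) / n} \<Longrightarrow>
      \<bar>proj (X t \<omega>) - proj (X (real i / n) \<omega>)\<bar> \<le> e"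
    by metis
  show ?thesis
  proof (rule that[of "\<Union>i<j * n. A i"])
    show "(\<Union>i<j * n. A i) \<in> sets M" using A(1) by (intro sets.finite_UN) auto
    have "prob (\<Union>i<j * n. A i) \<le> (\<Sum>i<j * n. prob (A i))"
      using A(1) by (intro finite_measure_subadditive_finite) auto
    also have "\<dots> \<le> (\<Sum>i<j * n. 50000 * C * (1 / real n)\<^sup>2 / e ^ 4)" using A(2) by (intro sum_mono) auto
    also have "\<dots> = 50000 * C * real j / (real n * e ^ 4)"
      using n by (simp add: field_simps power2_eq_square)
    finally show "prob (\<Union>i<j * n. A i) \<le>
      50000 * (14 + 24 * (y0 ^ 4 + (14 + 3 * y0 ^ 4) * (real j)\<^sup>2)) * real j / (real n * e ^ 4)"
      by (simp add: C_def)
    show "cells j n e (\<lambda>t. proj (X t \<omega>))" if "\<omega> \<in> space M - (\<Union>i<j * n. A i)" for \<omega>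
      unfolding cells_def using that A(3) by blast
  qed
qed

section \<open>Path space\<close>

lemma topspace_path_topology: "topspace path_topology = path_space"
proof -
  have "v \<in> \<Union>{{v \<in> path_space. \<forall>t\<in>K. \<bar>v t - w t\<bar> < \<epsilon>} | w K \<epsilon>.
        w \<in> path_space \<and> compact K \<and> K \<subseteq> {0..} \<and> \<epsilon> > 0}" if "v \<in> path_space" for v
  proof (rule UnionI)
    \<comment> \<open>With an empty compact set the constraint is void, so the whole path space is a
      generating set.\<close>
    show "{u \<in> path_space. \<forall>t\<in>{}. \<bar>u t - v t\<bar> < 1} \<in> {{v \<in> path_space. \<forall>t\<in>K. \<bar>v t - w t\<bar> < \<epsilon>} | w K \<epsilon>.
        w \<in> path_space \<and> compact K \<and> K \<subseteq> {0..} \<and> \<epsilon> > 0}"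
      using that by (intro CollectI exI[of _ v] exI[of _ "{}"] exI[of _ 1]) auto
  qed (use that in simp)
  then show ?thesis unfolding path_topology_def topology_generated_by_topspace by blast
qed

text \<open>Generating sets have arbitrary centres and compact sets; here they are recentred at
  \<open>v\<close> and replaced by intervals \<open>[0, n]\<close>. Only the generating sets need an
  argument.\<close>

lemma path_topology_nbhd:
  assumes "openin path_topology O'" "v \<in> O'"
  shows "\<exists>n::nat. \<exists>e>0. \<forall>u\<in>path_space. (\<forall>t\<in>{0..real n}. \<bar>u t - v t\<bar> < e) \<longrightarrow> u \<in> O'"
proof -
  have "generate_topology_on {{v \<in> path_space. \<forall>t\<in>K. \<bar>v t - w t\<bar> < \<epsilon>} | w K \<epsilon>.
        w \<in> path_space \<and> compact K \<and> K \<subseteq> {0..} \<and> \<epsilon> > 0} O'"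
    using assms(1) unfolding path_topology_def by (rule openin_topology_generated_by)
  then show ?thesis using assms(2)
  proof (induction arbitrary: v rule: generate_topology_on.induct)
    case Empty
    then show ?case by simp
  next
    case (Int a b)
    then have va: "v \<in> a" and vb: "v \<in> b" by auto
    obtain n e where 1: "e > 0" "\<forall>u\<in>path_space. (\<forall>t\<in>{0..real n}. \<bar>u t - v t\<bar> < e) \<longrightarrow> u \<in> a"
      using Int.IH(1)[OF va] by blast
    obtain n' e' where 2: "e' > 0" "\<forall>u\<in>path_space. (\<forall>t\<in>{0..real n'}. \<bar>u t - v t\<bar> < e') \<longrightarrow> u \<in> b"
      using Int.IH(2)[OF vb] by blast
    show ?case
    proof (intro exI[of _ "max n n'"] exI[of _ "min e e'"] conjI ballI impI)
      fix u assume u: "u \<in> path_space" "\<forall>t\<in>{0..real (max n n')}. \<bar>u t - v t\<bar> < min e e'"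
      then show "u \<in> a \<inter> b" using 1(2)[rule_format, of u] 2(2)[rule_format, of u] by force
    qed (use 1 2 in simp)
  next
    case (UN K)
    then obtain k where k: "k \<in> K" "v \<in> k" by blast
    show ?case using UN.IH[OF k] k(1) by blast
  next
    case (Basis s)
    then obtain w K \<epsilon> where s: "s = {v \<in> path_space. \<forall>t\<in>K. \<bar>v t - w t\<bar> < \<epsilon>}"
      and w: "w \<in> path_space" "compact K" "K \<subseteq> {0..}" "\<epsilon> > 0" by blast
    have v: "v \<in> path_space" "\<forall>t\<in>K. \<bar>v t - w t\<bar> < \<epsilon>" using Basis s by auto
    have "continuous_on K (\<lambda>t. \<bar>v t - w t\<bar>)"
      using v w by (intro continuous_intros) (auto simp: path_space_def intro: continuous_on_subset)
    \<comment> \<open>By compactness the distance of \<open>v\<close> from the centre stays strictly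
      below \<open>\<epsilon>\<close>, leaving the positive radius \<open>\<epsilon> - m\<close>
      around \<open>v\<close>.\<close>
    then obtain m where m: "m < \<epsilon>" "\<forall>t\<in>K. \<bar>v t - w t\<bar> \<le> m"
    proof (cases "K = {}")
      case False
      assume c: "continuous_on K (\<lambda>t. \<bar>v t - w t\<bar>)" and that: "\<And>m. m < \<epsilon> \<Longrightarrow> \<forall>t\<in>K. \<bar>v t - w t\<bar> \<le> m \<Longrightarrow> thesis"
      obtain x where "x \<in> K" "\<forall>t\<in>K. \<bar>v t - w t\<bar> \<le> \<bar>v x - w x\<bar>"
        using continuous_attains_sup[OF w(2) False c] by blast
      then show thesis using v(2) by (intro that[of "\<bar>v x - w x\<bar>"]) auto
    qed (use w in auto)
    obtain B where B: "\<forall>t\<in>K. \<bar>t\<bar> \<le> B"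
      using compact_imp_bounded[OF w(2)] by (auto simp: bounded_iff)
    show ?case
    proof (intro exI[of _ "nat \<lceil>B\<rceil>"] exI[of _ "\<epsilon> - m"] conjI ballI impI)
      show "\<epsilon> - m > 0" using m by simp
      fix u assume u: "u \<in> path_space" "\<forall>t\<in>{0..real (nat \<lceil>B\<rceil>)}. \<bar>u t - v t\<bar> < \<epsilon> - m"
      have "\<bar>u t - w t\<bar> < \<epsilon>" if t: "t \<in> K" for t
      proof -
        have "0 \<le> t" "t \<le> B" using t B w(3) by force+
        moreover have "B \<le> real (nat \<lceil>B\<rceil>)" by (rule real_nat_ceiling_ge)
        ultimately have "t \<in> {0..real (nat \<lceil>B\<rceil>)}" unfolding atLeastAtMost_iff by linarith
        then have "\<bar>u t - v t\<bar> < \<epsilon> - m" using u(2) by blast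
        then show ?thesis using m(2) t by force
      qed
      then show "u \<in> s" using u(1) by (simp add: s)
    qed
  qed
qed

section \<open>Measurability of path-valued maps\<close>

lemma ball_rational_imp_ball:
  fixes f :: "real \<Rightarrow> real"
  assumes "a < b" and cont: "continuous_on {a..b} f"
    and le: "\<And>t. t \<in> {a..b} \<Longrightarrow> t \<in> \<rat> \<Longrightarrow> \<bar>f t - c\<bar> \<le> e"
    and t: "t \<in> {a..b}"
  shows "\<bar>f t - c\<bar> \<le> e"
proof (rule field_le_epsilon)
  fix \<epsilon> :: real assume "\<epsilon> > 0"
  then obtain \<delta> where \<delta>: "\<delta> > 0" "\<And>x. x \<in> {a..b} \<Longrightarrow> dist x t < \<delta> \<Longrightarrow> dist (f x) (f t) < \<epsilon>"
    using cont t unfolding continuous_on_iff by metis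
  have "max a (t - \<delta>) < min b (t + \<delta>)" using \<open>a < b\<close> t \<delta>(1) by auto
  then obtain x where x: "x \<in> \<rat>" "max a (t - \<delta>) < x" "x < min b (t + \<delta>)"
    using Rats_dense_in_real by blast
  then have "x \<in> {a..b}" "dist x t < \<delta>" by (auto simp: dist_real_def)
  then show "\<bar>f t - c\<bar> \<le> e + \<epsilon>" using \<delta>(2)[of x] le[of x] x(1) by (simp add: dist_real_def)
qed

text \<open>By continuity of the paths, rational times decide the condition, and countably many
  events remain.\<close>

lemma interval_event_measurable:
  fixes Z :: "real \<Rightarrow> 'a \<Rightarrow> real"
  assumes ab: "a < b" and Z: "\<And>t. t \<in> {a..b} \<Longrightarrow> Z t \<in> borel_measurable M"
    and cont: "\<And>\<omega>. \<omega> \<in> space M \<Longrightarrow> continuous_on {a..b} (\<lambda>t. Z t \<omega> :: real)"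
    and V: "V \<in> borel_measurable M"
  shows "{\<omega> \<in> space M. \<forall>t\<in>{a..b}. \<bar>Z t \<omega> - V \<omega>\<bar> \<le> e} \<in> sets M"
proof -
  have "{\<omega> \<in> space M. \<forall>t\<in>{a..b}. \<bar>Z t \<omega> - V \<omega>\<bar> \<le> e} =
      {\<omega> \<in> space M. \<forall>t\<in>{a..b} \<inter> \<rat>. \<bar>Z t \<omega> - V \<omega>\<bar> \<le> e}"
    using ball_rational_imp_ball[OF ab cont] by (auto simp del: atLeastAtMost_iff)
  also have "\<dots> \<in> sets M"
  proof (intro sets.sets_Collect_countable_All')
    show "countable ({a..b} \<inter> \<rat>)" by (intro countable_Int2 countable_rat)
    fix t assume "t \<in> {a..b} \<inter> \<rat>"
    then have [measurable]: "Z t \<in> borel_measurable M" using Z by simp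
    note V[measurable]
    show "{\<omega> \<in> space M. \<bar>Z t \<omega> - V \<omega>\<bar> \<le> e} \<in> sets M" by measurable
  qed
  finally show ?thesis .
qed

lemma cell_event_measurable:
  fixes Z :: "real \<Rightarrow> 'a \<Rightarrow> real" and i n :: nat
  assumes Z: "\<And>t. 0 \<le> t \<Longrightarrow> Z t \<in> borel_measurable M"
    and cont: "\<And>\<omega>. \<omega> \<in> space M \<Longrightarrow> continuous_on {0..} (\<lambda>t. Z t \<omega>)"
    and n: "n > 0" and V: "V \<in> borel_measurable M"
  shows "{\<omega> \<in> space M. \<forall>t\<in>{real i / n .. real (Suc i) / n}. \<bar>Z t \<omega> - V \<omega>\<bar> \<le> e} \<in> sets M"
proof (rule interval_event_measurable[OF _ _ _ V])
  show "real i / n < real (Suc i) / n" using n by (simp add: divide_strict_right_mono)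
  have i0: "0 \<le> real i / real n" by simp
  show "Z t \<in> borel_measurable M" if "t \<in> {real i / n .. real (Suc i) / n}" for t
    using i0 that by (intro Z) (simp only: atLeastAtMost_iff, linarith)
  show "continuous_on {real i / n .. real (Suc i) / n} (\<lambda>t. Z t \<omega>)" if "\<omega> \<in> space M" for \<omega>
    by (rule continuous_on_subset[OF cont[OF that]]) (auto intro: order_trans[OF i0])
qed

lemma cells_event_measurable:
  assumes Z: "\<And>t. 0 \<le> t \<Longrightarrow> Z t \<in> borel_measurable M"
    and cont: "\<And>\<omega>. \<omega> \<in> space M \<Longrightarrow> continuous_on {0..} (\<lambda>t. Z t \<omega>)"
    and n: "n > 0"
  shows "{\<omega> \<in> space M. cells j n e (\<lambda>t. Z t \<omega>)} \<in> sets M"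
proof -
  have "{\<omega> \<in> space M. cells j n e (\<lambda>t. Z t \<omega>)} = {\<omega> \<in> space M. \<forall>i\<in>{..<j * n}.
      \<forall>t\<in>{real i / n .. real (Suc i) / n}. \<bar>Z t \<omega> - Z (real i / n) \<omega>\<bar> \<le> e}"
    by (simp add: cells_def Ball_def)
  also have "\<dots> \<in> sets M"
    using Z n by (intro sets.sets_Collect_countable_Ball cell_event_measurable cont) auto
  finally show ?thesis .
qed

lemma real_in_cell:
  fixes t :: real and n :: nat
  assumes "0 \<le> t" "t \<le> real j" "n > 0" "j > 0"
  obtains i where "i < j * n" "t \<in> {real i / n .. real (Suc i) / n}"
\<comment> \<open>At the right end the floor would give the index \<open>j * n\<close>, one too
  many; that point is assigned to the last cell.\<close>
proof (cases "t = real j")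
  case True
  have "real (j * n - 1) \<le> real j * real n" by (simp flip: of_nat_mult)
  moreover have "real (Suc (j * n - 1)) = real j * real n" using assms by (simp flip: of_nat_mult)
  ultimately show thesis using True assms
    by (intro that[of "j * n - 1"]) (simp_all add: field_simps del: of_nat_Suc)
next
  case False
  define i where "i = nat \<lfloor>t * n\<rfloor>"
  have "real i = of_int \<lfloor>t * n\<rfloor>" using assms unfolding i_def by (intro of_nat_nat) simp
  then have i: "real i \<le> t * n" "t * n < real i + 1" by linarith+
  have "t * n < real j * real n" using False assms by simp
  then have "real i < real (j * n)" using i by simp
  then have "i < j * n" by (simp only: of_nat_less_iff)
  then show thesis using i assms by (intro that[of i]) (auto simp: field_simps)
qed

text \<open>Every open set of paths is a countable union of tubes around rational step functions on
  a grid, and the preimage of a tube is an event by \<open>cell_event_measurable\<close>.\<close>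

lemma path_map_measurable:
  assumes Z: "\<And>t. 0 \<le> t \<Longrightarrow> Z t \<in> borel_measurable M"
    and cont: "\<And>\<omega>. \<omega> \<in> space M \<Longrightarrow> continuous_on {0..} (\<lambda>t. Z t \<omega> :: real)"
  shows "(\<lambda>\<omega>. \<lambda>t\<in>{0..}. Z t \<omega>) \<in> M \<rightarrow>\<^sub>M borel_sigma path_topology"
  unfolding borel_sigma_def topspace_path_topology
proof (rule measurable_measure_of)
  show "{U. openin path_topology U} \<subseteq> Pow path_space"
    using openin_subset[of path_topology] by (auto simp: topspace_path_topology)
  have path: "(\<lambda>t\<in>{0..}. Z t \<omega>) \<in> path_space" if "\<omega> \<in> space M" for \<omega>
    using continuous_on_eq[OF cont[OF that], of "\<lambda>t\<in>{0..}. Z t \<omega>"] by (simp add: path_space_def)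
  then show "(\<lambda>\<omega>. \<lambda>t\<in>{0..}. Z t \<omega>) \<in> space M \<rightarrow> path_space" by auto
  fix O' assume "O' \<in> {U. openin path_topology U}"
  then have O': "openin path_topology O'" by simp
  define tube where "tube n l k = {v \<in> path_space. \<forall>i<length l. \<forall>t\<in>{real i / n .. real (Suc i) / n}.
      \<bar>v t - of_rat (l ! i)\<bar> \<le> 1 / real k}" for n :: nat and l :: "rat list" and k :: nat
  define I where "I = {(n, l, k). n > 0 \<and> tube n l k \<subseteq> O'}"
  have "O' = (\<Union>(n, l, k)\<in>I. tube n l k)"
  proof (intro equalityI subsetI)
    fix v assume v: "v \<in> O'"
    then have vp: "v \<in> path_space" using openin_subset[OF O'] by (auto simp: topspace_path_topology)
    obtain m e where me: "e > 0" "\<forall>u\<in>path_space. (\<forall>t\<in>{0..real m}. \<bar>u t - v t\<bar> < e) \<longrightarrow> u \<in> O'"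
      using path_topology_nbhd[OF O' v] by blast
    \<comment> \<open>\<open>Suc\<close> makes \<open>j\<close> positive, so that every time in
      \<open>[0, m]\<close> lies in some cell.\<close>
    define j where "j = Suc m"
    obtain k :: nat where k: "k > 0" "1 / real k < e / 2"
      using me(1) by (metis half_gt_zero nat_approx_posE of_nat_0_less_iff zero_less_Suc)
    have "uniformly_continuous_on {0..real j} v"
      using vp by (intro compact_uniformly_continuous)
        (auto simp: path_space_def intro: continuous_on_subset)
    \<comment> \<open>The tube width \<open>1 / k\<close> is split in half between the oscillation
      of \<open>v\<close> over a cell and the rational approximation; since
      \<open>2 / k < e\<close>, two paths of one tube are closer than \<open>e\<close>.\<close>
    then obtain \<delta> where \<delta>: "\<delta> > 0" "\<And>s t. s \<in> {0..real j} \<Longrightarrow> t \<in> {0..real j} \<Longrightarrow> dist t s < \<delta> \<Longrightarrow>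
        dist (v t) (v s) < 1 / (2 * real k)"
      using k(1) unfolding uniformly_continuous_on_def
      by (metis divide_pos_pos mult_pos_pos of_nat_0_less_iff zero_less_numeral zero_less_one)
    obtain n :: nat where n: "n > 0" "1 / real n < \<delta>"
      using \<delta>(1) by (metis nat_approx_posE of_nat_0_less_iff zero_less_Suc)
    have "\<exists>q::rat. \<bar>v (real i / n) - of_rat q\<bar> < 1 / (2 * real k)" for i :: nat
    proof -
      have "v (real i / n) - 1 / (2 * real k) < v (real i / n) + 1 / (2 * real k)" using k by simp
      then obtain q :: rat where "v (real i / n) - 1 / (2 * real k) < of_rat q"
        "of_rat q < v (real i / n) + 1 / (2 * real k)" using of_rat_dense by blast
      then show ?thesis by (intro exI[of _ q]) (simp add: abs_less_iff)
    qed
    then obtain q :: "nat \<Rightarrow> rat" where q: "\<And>i. \<bar>v (real i / n) - of_rat (q i)\<bar> < 1 / (2 * real k)" by metis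
    define l where "l = map q [0..<j * n]"
    have "v \<in> tube n l k"
      unfolding tube_def
    proof (intro CollectI conjI vp allI impI ballI)
      fix i t assume "i < length l" and t: "t \<in> {real i / n .. real (Suc i) / n}"
      then have i: "i < j * n" by (simp add: l_def)
      have "real i / n \<in> {0..real j}" "t \<in> {0..real j}" "dist t (real i / n) < \<delta>"
        using cell_bounds[OF i t] n(2) by (simp_all add: dist_real_def)
      then have "dist (v t) (v (real i / n)) < 1 / (2 * real k)" by (intro \<delta>(2))
      moreover have "1 / (2 * real k) + 1 / (2 * real k) = 1 / real k" by simp
      ultimately have "\<bar>v t - of_rat (q i)\<bar> \<le> 1 / real k" using q[of i] unfolding dist_real_def by linarith
      then show "\<bar>v t - of_rat (l ! i)\<bar> \<le> 1 / real k" using i by (simp add: l_def)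
    qed
    moreover have "tube n l k \<subseteq> O'"
    proof
      fix u assume u: "u \<in> tube n l k"
      have "\<bar>u t - v t\<bar> < e" if "t \<in> {0..real m}" for t
      proof -
        have tj: "0 \<le> t" "t \<le> real j" "j > 0" using that by (auto simp: j_def)
        obtain i where i: "i < j * n" "t \<in> {real i / n .. real (Suc i) / n}"
          by (rule real_in_cell[OF tj(1,2) n(1) tj(3)])
        have il: "i < length l" using i by (simp add: l_def)
        have "\<bar>u t - of_rat (l ! i)\<bar> \<le> 1 / real k" "\<bar>v t - of_rat (l ! i)\<bar> \<le> 1 / real k"
          using u \<open>v \<in> tube n l k\<close> il i(2) unfolding tube_def by blast+
        then show ?thesis using k(2) by linarith
      qed
      then show "u \<in> O'" using me(2) u by (auto simp: tube_def)
    qed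
    ultimately show "v \<in> (\<Union>(n, l, k)\<in>I. tube n l k)" using n by (auto simp: I_def)
  qed (auto simp: I_def)
  then have "(\<lambda>\<omega>. \<lambda>t\<in>{0..}. Z t \<omega>) -` O' \<inter> space M =
      (\<Union>(n, l, k)\<in>I. {\<omega> \<in> space M. (\<lambda>t\<in>{0..}. Z t \<omega>) \<in> tube n l k})" by auto
  also have "\<dots> \<in> sets M"
  proof (intro sets.countable_UN')
    show "countable I" by (rule countable_subset[OF subset_UNIV]) simp
    show "(\<lambda>(n, l, k). {\<omega> \<in> space M. (\<lambda>t\<in>{0..}. Z t \<omega>) \<in> tube n l k}) ` I \<subseteq> sets M"
    proof (clarsimp simp: I_def)
      fix n k :: nat and l :: "rat list" assume n: "n > 0"
      have "{\<omega> \<in> space M. (\<lambda>t\<in>{0..}. Z t \<omega>) \<in> tube n l k} = {\<omega> \<in> space M. \<forall>i\<in>{..<length l}.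
          \<forall>t\<in>{real i / n .. real (Suc i) / n}. \<bar>Z t \<omega> - of_rat (l ! i)\<bar> \<le> 1 / real k}"
      proof -
        have "0 \<le> t" if "t \<in> {real i / n .. real (Suc i) / n}" for t and i :: nat
          using that order_trans[of 0 "real i / real n" t] by simp
        then show ?thesis using path by (auto simp: tube_def)
      qed
      also have "\<dots> \<in> sets M"
        using Z n by (intro sets.sets_Collect_countable_Ball cell_event_measurable cont) auto
      finally show "{\<omega> \<in> space M. (\<lambda>t\<in>{0..}. Z t \<omega>) \<in> tube n l k} \<in> sets M" .
    qed
  qed
  finally show "(\<lambda>\<omega>. \<lambda>t\<in>{0..}. Z t \<omega>) -` O' \<inter> space M \<in> sets M" .
qed

section \<open>Compact sets of paths and approximation of functionals\<close>

lemma fun_hausdorff: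
  fixes f g :: "'a \<Rightarrow> 'b :: t2_space"
  assumes "f \<noteq> g"
  shows "\<exists>U V. open U \<and> open V \<and> f \<in> U \<and> g \<in> V \<and> U \<inter> V = {}"
proof -
  obtain i where "f i \<noteq> g i" using assms by blast
  then obtain U V where UV: "open U" "open V" "f i \<in> U" "g i \<in> V" "U \<inter> V = {}"
    using hausdorff by metis
  have "open ((\<lambda>h. h i) -` U)" "open ((\<lambda>h. h i) -` V)"
    using UV by (auto intro: open_vimage)
  then show ?thesis
    using UV by (intro exI[of _ "(\<lambda>h. h i) -` U"] exI[of _ "(\<lambda>h. h i) -` V"]) auto
qed

text \<open>The library has these instances only for countable index types, through metrizability.\<close>

instance "fun" :: (type, t2_space) t0_space
  using fun_hausdorff by intro_classes blast

instance "fun" :: (type, t2_space) t1_space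
  using fun_hausdorff by intro_classes blast

instance "fun" :: (type, t2_space) t2_space
  using fun_hausdorff by intro_classes

lemma continuous_on_evaluation: "continuous_on A (\<lambda>w :: 'a \<Rightarrow> 'b::topological_space. w t)"
  by (rule continuous_on_subset[OF continuous_on_product_coordinates]) simp

text \<open>On this compact set of paths the topology of pointwise convergence and the path topology
  agree, so that Tychonoff's theorem replaces the Arzela-Ascoli theorem.\<close>

definition tight_set :: "real \<Rightarrow> (nat \<Rightarrow> nat) \<Rightarrow> (real \<Rightarrow> real) set" where
  "tight_set R N = {w \<in> extensional {0..}. \<bar>w 0\<bar> \<le> R \<and> (\<forall>j. cells j (N j) (1 / real (Suc j)) w)}"

lemma cellsD:
  "cells j n e w \<Longrightarrow> i < j * n \<Longrightarrow> t \<in> {real i / n .. real (Suc i) / n} \<Longrightarrow> \<bar>w t - w (real i / n)\<bar> \<le> e"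
  by (simp add: cells_def)

text \<open>Times at most \<open>1 / n\<close> apart lie in the same cell or in adjacent ones, so at
  most three comparisons with left end points are needed.\<close>

lemma cells_modulus:
  assumes c: "cells j n e w" and n: "n > 0" and e: "e \<ge> 0"
    and st: "0 \<le> s" "s \<le> t" "t \<le> real j" "t - s \<le> 1 / real n"
  shows "\<bar>w t - w s\<bar> \<le> 3 * e"
proof (cases "j = 0")
  case True
  then have "s = 0" "t = 0" using st by auto
  then show ?thesis using e by simp
next
  case False
  then have j: "j > 0" by simp
  have sj: "s \<le> real j" using st by simp
  obtain i where i: "i < j * n" "s \<in> {real i / n .. real (Suc i) / n}"
    by (rule real_in_cell[OF st(1) sj n j])
  have d: "real (Suc k) / n = real k / n + 1 / n" for k by (simp add: add_divide_distrib)
  have s1: "\<bar>w s - w (real i / n)\<bar> \<le> e" by (rule cellsD[OF c i])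
  show ?thesis
  proof (cases "t \<le> real (Suc i) / n")
    case True
    then have "t \<in> {real i / n .. real (Suc i) / n}" using i st by simp
    from cellsD[OF c i(1) this] show ?thesis using s1 e by linarith
  next
    case False
    have "real (Suc i) < real (j * n)"
    proof -
      have "real (Suc i) / n < real j" using False st by simp
      then show ?thesis using n by (simp add: field_simps)
    qed
    then have Si: "Suc i < j * n" by (simp only: of_nat_less_iff)
    have "t \<in> {real (Suc i) / n .. real (Suc (Suc i)) / n}"
    proof -
      have "t \<le> s + 1 / real n" using st(4) by simp
      also have "\<dots> \<le> real (Suc i) / real n + 1 / real n" using i(2) by (intro add_mono) auto
      also have "\<dots> = real (Suc (Suc i)) / n" by (rule d[symmetric])
      finally show ?thesis using False unfolding atLeastAtMost_iff by (simp only: not_le less_imp_le simp_thms)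
    qed
    from cellsD[OF c Si this] have 1: "\<bar>w t - w (real (Suc i) / n)\<bar> \<le> e" .
    have "real (Suc i) / n \<in> {real i / n .. real (Suc i) / n}"
      by (simp add: divide_right_mono)
    from cellsD[OF c i(1) this] show ?thesis using 1 s1 by linarith
  qed
qed

text \<open>Continuity is not imposed in \<open>tight_set\<close>, where it would spoil closedness
  under pointwise convergence; the cell conditions for all \<open>j\<close> imply it.\<close>

lemma tight_set_subset_path_space:
  assumes N: "\<And>j. N j > 0"
  shows "tight_set R N \<subseteq> path_space"
proof
  fix w assume w: "w \<in> tight_set R N"
  have "continuous_on {0..} w"
    unfolding continuous_on_iff
  proof (intro ballI allI impI)
    fix t e :: real assume t: "t \<in> {0..}" and e: "e > 0"
    obtain j0 where j0: "1 / real (Suc j0) < e / 3" using nat_approx_posE[of "e / 3"] e by auto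
    \<comment> \<open>Large enough for the accuracy \<open>e\<close> and for \<open>[0, j]\<close>
      to contain a neighbourhood of \<open>t\<close> in the half line.\<close>
    define j where "j = max j0 (nat \<lceil>t\<rceil> + 1)"
    have "1 / real (Suc j) \<le> 1 / real (Suc j0)" by (simp add: j_def frac_le)
    then have je: "3 * (1 / real (Suc j)) < e" using j0 by linarith
    have "t \<le> real (nat \<lceil>t\<rceil>)" by (rule real_nat_ceiling_ge)
    then have tj: "t + 1 \<le> real j" by (simp add: j_def)
    have c: "cells j (N j) (1 / real (Suc j)) w" using w by (simp add: tight_set_def)
    have N1: "1 / real (N j) \<le> 1" "1 / real (N j) > 0" using N[of j] by auto
    have e0: "1 / real (Suc j) \<ge> 0" by simp
    show "\<exists>d>0. \<forall>s\<in>{0..}. dist s t < d \<longrightarrow> dist (w s) (w t) < e"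
    proof (intro exI[of _ "1 / real (N j)"] conjI ballI impI)
      fix s assume s: "s \<in> {0..}" "dist s t < 1 / real (N j)"
      then have d: "0 \<le> s" "\<bar>s - t\<bar> < 1 / real (N j)" "0 \<le> t" using t by (auto simp: dist_real_def)
      have "\<bar>w s - w t\<bar> \<le> 3 * (1 / real (Suc j))"
      proof (cases "t \<le> s")
        case True
        show ?thesis by (rule cells_modulus[OF c N e0 d(3) True]) (use d tj N1 in linarith)+
      next
        case False
        have "\<bar>w t - w s\<bar> \<le> 3 * (1 / real (Suc j))"
          by (rule cells_modulus[OF c N e0 d(1)]) (use d False tj N1 in linarith)+
        then show ?thesis by (simp add: abs_minus_commute)
      qed
      then show "dist (w s) (w t) < e" using je by (simp add: dist_real_def)
    qed (use N1 in simp)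
  qed
  then show "w \<in> path_space" using w by (simp add: path_space_def tight_set_def)
qed

text \<open>From time 0, where the path is bounded by \<open>R\<close>, at most
  \<open>j * N j\<close> grid steps of size at most 1 lead to the cell of \<open>t\<close>.\<close>

lemma tight_set_bounded:
  assumes w: "w \<in> tight_set R N" and N: "\<And>j. N j > 0" and t: "0 \<le> t" "t \<le> real j"
  shows "\<bar>w t\<bar> \<le> R + real (j * N j) + 1"
proof (cases "j = 0")
  case True
  then show ?thesis using w t by (simp add: tight_set_def)
next
  case False
  have c: "cells j (N j) (1 / real (Suc j)) w" using w by (simp add: tight_set_def)
  have e1: "1 / real (Suc j) \<le> 1" by simp
  have grid: "\<bar>w (real i / N j)\<bar> \<le> R + real i" if "i \<le> j * N j" for i
    using that
  proof (induction i)
    case 0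
    then show ?case using w by (simp add: tight_set_def)
  next
    case (Suc i)
    have "real (Suc i) / N j \<in> {real i / N j .. real (Suc i) / N j}" by (simp add: divide_right_mono)
    then have "\<bar>w (real (Suc i) / N j) - w (real i / N j)\<bar> \<le> 1 / real (Suc j)"
      using Suc.prems by (intro cellsD[OF c]) auto
    moreover have "\<bar>w (real i / N j)\<bar> \<le> R + real i" using Suc by simp
    moreover have "real (Suc i) = real i + 1" by simp
    ultimately show ?case using e1 by linarith
  qed
  obtain i where i: "i < j * N j" "t \<in> {real i / N j .. real (Suc i) / N j}"
    by (rule real_in_cell[OF t N]) (use False in simp)
  have "\<bar>w t - w (real i / N j)\<bar> \<le> 1" using cellsD[OF c i] e1 by linarith
  moreover have "\<bar>w (real i / N j)\<bar> \<le> R + real i" using i by (intro grid) simp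
  moreover have "real i \<le> real (j * N j)" using i by (intro of_nat_mono) simp
  ultimately show ?thesis by linarith
qed

text \<open>All conditions are closed conditions on finitely many evaluations, so the set is closed
  in the product topology, and \<open>tight_set_bounded\<close> puts it into a product of compact
  intervals.\<close>

lemma compact_tight_set:
  assumes N: "\<And>j. N j > 0"
  shows "compact (tight_set R N)"
proof -
  define j :: "real \<Rightarrow> nat" where "j t = nat \<lceil>t\<rceil>" for t
  \<comment> \<open>Paths are extensional, so a negative time contributes a singleton.\<close>
  define D where "D t = (if t < 0 then {undefined}
    else {- (R + real (j t * N (j t)) + 1) .. R + real (j t * N (j t)) + 1})" for t
  have "compactin (product_topology (\<lambda>_::real. euclidean :: real topology) UNIV) (PiE UNIV D)"
    unfolding compactin_PiE by (auto simp: D_def)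
  then have comp: "compact (PiE UNIV D)"
    by (simp add: euclidean_product_topology)
  have sub: "tight_set R N \<subseteq> PiE UNIV D"
  proof
    fix w assume w: "w \<in> tight_set R N"
    have "w t \<in> D t" for t
    proof (cases "t < 0")
      case True
      then show ?thesis using w by (auto simp: D_def tight_set_def extensional_def)
    next
      case False
      moreover have "t \<le> real (j t)" unfolding j_def by (rule real_nat_ceiling_ge)
      ultimately show ?thesis using tight_set_bounded[OF w N, of t "j t"] by (auto simp: D_def abs_le_iff)
    qed
    then show "w \<in> PiE UNIV D" by (simp add: PiE_UNIV_domain)
  qed
  have "tight_set R N = {w. (\<forall>t. t \<notin> {0..} \<longrightarrow> w t = undefined) \<and> \<bar>w 0\<bar> \<le> R \<and>
      (\<forall>j i t. i < j * N j \<and> t \<in> {real i / N j .. real (Suc i) / N j} \<longrightarrow>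
        \<bar>w t - w (real i / N j)\<bar> \<le> 1 / real (Suc j))}"
    by (auto simp: tight_set_def extensional_def cells_def)
  also have "closed \<dots>"
    by (intro closed_Collect_conj closed_Collect_all closed_Collect_imp closed_Collect_eq
        closed_Collect_le open_Collect_const continuous_intros continuous_on_evaluation)
  finally have "closed (tight_set R N)" .
  then show ?thesis using comp sub by (metis compact_Int_closed inf.absorb_iff2)
qed

text \<open>On the tight set, closeness at the finitely many points of one grid gives uniform
  closeness on \<open>[0, n]\<close>, with \<open>e / 3\<close> for the grid point and
  \<open>e / 3\<close> for the oscillation of each path. Hence pointwise neighbourhoods are fine
  enough for \<open>\<Phi>\<close>.\<close>

lemma continuous_on_tight_set:
  assumes N: "\<And>j. N j > 0" and \<Phi>: "continuous_map path_topology euclideanreal \<Phi>"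
  shows "continuous_on (tight_set R N) \<Phi>"
  unfolding continuous_on_topological
proof (intro ballI allI impI)
  fix x B assume x: "x \<in> tight_set R N" and B: "open B" "\<Phi> x \<in> B"
  have xp: "x \<in> path_space" using x tight_set_subset_path_space[of N R] N by blast
  have "openin path_topology {v \<in> topspace path_topology. \<Phi> v \<in> B}"
    using B(1) by (intro openin_continuous_map_preimage[OF \<Phi>]) simp
  then obtain n e where e: "e > 0" "\<forall>u\<in>path_space. (\<forall>t\<in>{0..real n}. \<bar>u t - x t\<bar> < e) \<longrightarrow> \<Phi> u \<in> B"
    using path_topology_nbhd[of "{v \<in> topspace path_topology. \<Phi> v \<in> B}" x] B(2) xp
    by (auto simp: topspace_path_topology)
  obtain j0 where j0: "1 / real (Suc j0) < e / 3" using nat_approx_posE[of "e / 3"] e(1) by auto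
  define j where "j = max j0 (n + 1)"
  have "1 / real (Suc j) \<le> 1 / real (Suc j0)" by (simp add: j_def frac_le)
  then have je: "1 / real (Suc j) < e / 3" using j0 by linarith
  have jn: "j > 0" "real n \<le> real j" by (auto simp: j_def)
  define V where "V = (\<Inter>i<j * N j. {v :: real \<Rightarrow> real. \<bar>v (real i / N j) - x (real i / N j)\<bar> < e / 3})"
  have "open V" unfolding V_def
    by (intro open_INT ballI open_Collect_less continuous_intros continuous_on_evaluation) auto
  moreover have "x \<in> V" using e(1) by (simp add: V_def)
  moreover have "\<Phi> u \<in> B" if u: "u \<in> tight_set R N" "u \<in> V" for u
  proof -
    have "\<bar>u t - x t\<bar> < e" if t: "t \<in> {0..real n}" for t
    proof -
      have t': "0 \<le> t" "t \<le> real j" using t jn by auto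
      obtain i where i: "i < j * N j" "t \<in> {real i / N j .. real (Suc i) / N j}"
        by (rule real_in_cell[OF t' N jn(1)])
      have "cells j (N j) (1 / real (Suc j)) u" "cells j (N j) (1 / real (Suc j)) x"
        using u(1) x by (simp_all add: tight_set_def)
      from cellsD[OF this(1) i] cellsD[OF this(2) i]
      have "\<bar>u t - u (real i / N j)\<bar> \<le> 1 / real (Suc j)" "\<bar>x t - x (real i / N j)\<bar> \<le> 1 / real (Suc j)" .
      moreover have "\<bar>u (real i / N j) - x (real i / N j)\<bar> < e / 3" using u(2) i(1) by (auto simp: V_def)
      ultimately show ?thesis using je by linarith
    qed
    moreover have "u \<in> path_space" using u(1) tight_set_subset_path_space[of N R] N by blast
    ultimately show ?thesis using e(2) by blast
  qed
  ultimately show "\<exists>A. open A \<and> x \<in> A \<and> (\<forall>y\<in>tight_set R N. y \<in> A \<longrightarrow> \<Phi> y \<in> B)" by blast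
qed

section \<open>The algebra of Gaussian functionals\<close>

inductive_set gauss_alg :: "((real \<Rightarrow> real) \<Rightarrow> real) set" where
  prod: "finite S \<Longrightarrow> S \<subseteq> {0..} \<Longrightarrow> (\<And>r. r \<in> S \<Longrightarrow> 0 < a r) \<Longrightarrow> (\<lambda>w. c * gauss_prod S a b w) \<in> gauss_alg"
| add: "f \<in> gauss_alg \<Longrightarrow> g \<in> gauss_alg \<Longrightarrow> (\<lambda>w. f w + g w) \<in> gauss_alg"

lemma gauss_alg_const: "(\<lambda>_. c) \<in> gauss_alg"
  using gauss_alg.prod[of "{}" _ c] by (simp add: gauss_prod_def)

text \<open>The time sets may overlap: coefficients are extended by 0 and added, so quadratic
  coefficients positive on \<open>S\<close> and on \<open>S'\<close> stay positive on the
  union.\<close>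

lemma gauss_prod_mult:
  assumes "finite S" "finite S'"
  shows "gauss_prod S a b w * gauss_prod S' a' b' w =
    gauss_prod (S \<union> S') (\<lambda>r. (if r \<in> S then a r else 0) + (if r \<in> S' then a' r else 0))
      (\<lambda>r. (if r \<in> S then b r else 0) + (if r \<in> S' then b' r else 0)) w"
proof -
  have 1: "(\<Sum>r\<in>S. b r * w r - a r * (w r)\<^sup>2) =
      (\<Sum>r\<in>S \<union> S'. (if r \<in> S then b r else 0) * w r - (if r \<in> S then a r else 0) * (w r)\<^sup>2)"
    using assms by (intro sum.mono_neutral_cong_left) auto
  have 2: "(\<Sum>r\<in>S'. b' r * w r - a' r * (w r)\<^sup>2) =
      (\<Sum>r\<in>S \<union> S'. (if r \<in> S' then b' r else 0) * w r - (if r \<in> S' then a' r else 0) * (w r)\<^sup>2)"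
    using assms by (intro sum.mono_neutral_cong_left) auto
  show ?thesis
    unfolding gauss_prod_def exp_add[symmetric] 1 2 sum.distrib[symmetric]
    by (intro arg_cong[of _ _ exp] sum.cong refl) (simp add: algebra_simps)
qed

text \<open>Multiplication is derived and is not a constructor, so elements remain finite sums of
  scaled products and convergence of expectations needs only the cases \<open>prod\<close> and
  \<open>add\<close>; the ring structure asked for by Stone-Weierstrass comes from here.\<close>

lemma gauss_alg_mult:
  assumes "f \<in> gauss_alg" "g \<in> gauss_alg"
  shows "(\<lambda>w. f w * g w) \<in> gauss_alg"
  using assms(1)
proof induction
  case (prod S a c b)
  show ?case using assms(2)
  proof induction
    case (prod S' a' c' b')
    have "(\<lambda>w. (c * c') * gauss_prod (S \<union> S') (\<lambda>r. (if r \<in> S then a r else 0) + (if r \<in> S' then a' r else 0))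
      (\<lambda>r. (if r \<in> S then b r else 0) + (if r \<in> S' then b' r else 0)) w) \<in> gauss_alg"
      using prod \<open>finite S\<close> \<open>S \<subseteq> {0..}\<close> \<open>\<And>r. r \<in> S \<Longrightarrow> 0 < a r\<close>
      by (intro gauss_alg.prod) (auto simp: add_pos_pos)
    then show ?case
      unfolding gauss_prod_mult[OF \<open>finite S\<close> prod(1), symmetric] by (simp add: mult_ac)
  next
    case (add f' g')
    then show ?case using gauss_alg.add[OF add.IH] by (simp add: distrib_left)
  qed
next
  case (add f' g')
  then show ?case using gauss_alg.add[OF add.IH] by (simp add: distrib_right)
qed

lemma gauss_alg_bounded:
  assumes "f \<in> gauss_alg"
  shows "\<exists>B. \<forall>w. \<bar>f w\<bar> \<le> B"
  using assms
proof induction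
  case (prod S a c b)
  have "\<bar>c * gauss_prod S a b w\<bar> \<le> \<bar>c\<bar> * exp (\<Sum>r\<in>S. (b r)\<^sup>2 / (4 * a r))" for w
  proof -
    have "gauss_prod S a b w \<le> exp (\<Sum>r\<in>S. (b r)\<^sup>2 / (4 * a r))" by (rule gauss_prod_bounded) (rule prod)
    then show ?thesis by (simp add: abs_mult mult_left_mono less_imp_le)
  qed
  then show ?case by blast
next
  case (add f g)
  then obtain B B' where "\<forall>w. \<bar>f w\<bar> \<le> B" "\<forall>w. \<bar>g w\<bar> \<le> B'" by blast
  then have "\<forall>w. \<bar>f w + g w\<bar> \<le> B + B'" by (meson abs_triangle_ineq add_mono order_trans)
  then show ?case by blast
qed

lemma gauss_alg_continuous:
  assumes "f \<in> gauss_alg"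
  shows "continuous_on A f"
  using assms
proof induction
  case (prod S a c b)
  show ?case unfolding gauss_prod_def by (intro continuous_intros continuous_on_evaluation)
qed (intro continuous_intros)

text \<open>Only nonnegative times are evaluated, so the functional has the same value on a process
  path and on its extensional version in path space.\<close>

lemma gauss_alg_restrict:
  assumes "f \<in> gauss_alg"
  shows "f (\<lambda>t\<in>{0..}. w t) = f w"
  using assms
proof induction
  case (prod S a c b)
  then show ?case unfolding gauss_prod_def
    by (intro arg_cong[of _ _ "\<lambda>x. c * exp x"] sum.cong refl) auto
qed simp

lemma gauss_alg_measurable:
  assumes "f \<in> gauss_alg" and Z: "\<And>t. 0 \<le> t \<Longrightarrow> Z t \<in> borel_measurable M"
  shows "(\<lambda>\<omega>. f (\<lambda>t. Z t \<omega>)) \<in> borel_measurable M"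
  using assms(1)
proof induction
  case (prod S a c b)
  then have [measurable]: "r \<in> S \<Longrightarrow> Z r \<in> borel_measurable M" for r using Z by auto
  show ?case unfolding gauss_prod_def by measurable
qed measurable

lemma gauss_alg_polynomial:
  assumes "real_polynomial_function p" "f \<in> gauss_alg"
  shows "(\<lambda>w. p (f w :: real)) \<in> gauss_alg"
  using assms(1)
proof induction
  case (linear h)
  then obtain c where "h = (\<lambda>x. x * c)" by (auto simp: real_bounded_linear)
  then show ?case using gauss_alg_mult[OF assms(2) gauss_alg_const[of c]] by simp
qed (auto intro: gauss_alg_const gauss_alg.add gauss_alg_mult)

lemma gauss_alg_approx:
  assumes N: "\<And>j. N j > 0" and \<Phi>: "continuous_map path_topology euclideanreal \<Phi>"
    and B: "\<And>w. w \<in> path_space \<Longrightarrow> \<bar>\<Phi> w\<bar> \<le> B" and e: "0 < e" "e \<le> 1"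
  obtains f where "f \<in> gauss_alg" "\<And>w. \<bar>f w\<bar> \<le> B + 1" "\<And>w. w \<in> tight_set R N \<Longrightarrow> \<bar>\<Phi> w - f w\<bar> \<le> 2 * e"
proof -
  interpret function_ring_on gauss_alg "tight_set R N"
  proof
    show "compact (tight_set R N)" by (rule compact_tight_set[OF N])
    fix x y :: "real \<Rightarrow> real" assume xy: "x \<in> tight_set R N" "y \<in> tight_set R N" "x \<noteq> y"
    then obtain t where t: "x t \<noteq> y t" by blast
    have t0: "0 \<le> t" using t xy by (force simp: tight_set_def extensional_def)
    \<comment> \<open>With \<open>b = x t + y t + 1\<close> the exponents at \<open>x\<close> and
      \<open>y\<close> are \<open>x t * y t + x t\<close> and \<open>x t * y t + y t\<close>, which
      differ.\<close>
    define g where "g = (\<lambda>w. 1 * gauss_prod {t} (\<lambda>_. 1) (\<lambda>_. x t + y t + 1) w)"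
    have "g \<in> gauss_alg" unfolding g_def using t0 by (intro gauss_alg.prod) auto
    moreover have "g x \<noteq> g y"
    proof
      assume "g x = g y"
      then have "(x t + y t + 1) * x t - (x t)\<^sup>2 = (x t + y t + 1) * y t - (y t)\<^sup>2"
        by (simp add: g_def gauss_prod_def)
      then have "x t = y t" by (simp add: algebra_simps power2_eq_square)
      then show False using t by simp
    qed
    ultimately show "\<exists>g\<in>gauss_alg. g x \<noteq> g y" by blast
  qed (auto intro: gauss_alg_continuous gauss_alg.add gauss_alg_mult gauss_alg_const)
  obtain g where g: "g \<in> gauss_alg" "\<And>w. w \<in> tight_set R N \<Longrightarrow> \<bar>\<Phi> w - g w\<bar> < e"
    using Stone_Weierstrass_basic[OF continuous_on_tight_set[OF N \<Phi>] e(1)] by blast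
  obtain L where L: "\<And>w. \<bar>g w\<bar> \<le> L" using gauss_alg_bounded[OF g(1)] by blast
  \<comment> \<open>It fixes \<open>[- B, B]\<close>, where \<open>\<Phi>\<close> takes its values.
    As \<open>g\<close> is bounded by \<open>L\<close> on all paths, a polynomial close to
    \<open>clamp\<close> on \<open>[- L, L]\<close> is enough.\<close>
  define clamp where "clamp x = max (- B) (min x B)" for x
  have "continuous_on {-L..L} clamp" unfolding clamp_def by (intro continuous_intros)
  then obtain p where p: "real_polynomial_function p" "\<And>x. x \<in> {-L..L} \<Longrightarrow> \<bar>clamp x - p x\<bar> < e"
    using Stone_Weierstrass_real_polynomial_function[of "{-L..L}" clamp e] e by (metis compact_Icc)
  have pg: "\<bar>clamp (g w) - p (g w)\<bar> < e" for w
    using L[of w] by (intro p(2)) (auto simp: abs_le_iff)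
  have "(\<lambda>t\<in>{0..}. 0) \<in> path_space"
  proof -
    have "continuous_on {0..} (\<lambda>t\<in>{0..}. 0 :: real)"
      by (rule continuous_on_eq[OF continuous_on_const[of _ 0]]) simp
    then show ?thesis by (simp add: path_space_def)
  qed
  then have B0: "B \<ge> 0" using B by force
  show ?thesis
  proof (rule that[OF gauss_alg_polynomial[OF p(1) g(1)]])
    fix w
    have "\<bar>clamp (g w)\<bar> \<le> B" using B0 by (auto simp: clamp_def)
    then show "\<bar>p (g w)\<bar> \<le> B + 1" using pg[of w] e by linarith
    assume w: "w \<in> tight_set R N"
    then have "\<bar>\<Phi> w\<bar> \<le> B" using B tight_set_subset_path_space[of N R] N by blast
    \<comment> \<open>Truncation moves \<open>g w\<close> towards any point of
      \<open>[- B, B]\<close>, so the approximation does not get worse.\<close>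
    then have "\<bar>\<Phi> w - clamp (g w)\<bar> \<le> \<bar>\<Phi> w - g w\<bar>" by (auto simp: clamp_def)
    then show "\<bar>\<Phi> w - p (g w)\<bar> \<le> 2 * e" using g(2)[OF w] pg[of w] by linarith
  qed
qed

section \<open>Weak convergence\<close>

lemma borel_measurable_path_functional:
  assumes "continuous_map path_topology euclideanreal \<Phi>"
  shows "\<Phi> \<in> borel_measurable (borel_sigma path_topology)"
proof (rule borel_measurableI)
  fix S :: "real set" assume "open S"
  then have "openin path_topology {v \<in> topspace path_topology. \<Phi> v \<in> S}"
    by (intro openin_continuous_map_preimage[OF assms]) simp
  then have "{v \<in> topspace path_topology. \<Phi> v \<in> S} \<in> sets (borel_sigma path_topology)"
    unfolding borel_sigma_def using openin_subset[of path_topology] by (subst sets_measure_of) auto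
  moreover have "space (borel_sigma path_topology) = topspace path_topology"
    unfolding borel_sigma_def using openin_subset[of path_topology] by (intro space_measure_of) auto
  ultimately show "\<Phi> -` S \<inter> space (borel_sigma path_topology) \<in> sets (borel_sigma path_topology)"
    by (simp add: vimage_def Int_def conj_commute)
qed

text \<open>Off \<open>A\<close> the two integrands differ by at most \<open>e\<close>; on
  \<open>A\<close> the trivial bounds \<open>B\<close> and \<open>B + 1\<close> add up to
  \<open>2 B + 1\<close>.\<close>

lemma (in prob_space) path_law_integral_approx:
  fixes Z :: "real \<Rightarrow> 'a \<Rightarrow> real"
  assumes Z: "\<And>t. 0 \<le> t \<Longrightarrow> Z t \<in> borel_measurable M"
    and cont: "\<And>\<omega>. \<omega> \<in> space M \<Longrightarrow> continuous_on {0..} (\<lambda>t. Z t \<omega>)"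
    and \<Phi>: "continuous_map path_topology euclideanreal \<Phi>"
    and B: "B \<ge> 0" "\<And>w. w \<in> path_space \<Longrightarrow> \<bar>\<Phi> w\<bar> \<le> B"
    and f: "f \<in> gauss_alg" "\<And>w. \<bar>f w\<bar> \<le> B + 1" "\<And>w. w \<in> tight_set R N \<Longrightarrow> \<bar>\<Phi> w - f w\<bar> \<le> e"
    and A: "A \<in> sets M" "\<And>\<omega>. \<omega> \<in> space M - A \<Longrightarrow> (\<lambda>t\<in>{0..}. Z t \<omega>) \<in> tight_set R N"
    and e: "e \<ge> 0"
  shows "\<bar>(\<integral>w. \<Phi> w \<partial>path_law M Z) - expectation (\<lambda>\<omega>. f (\<lambda>t. Z t \<omega>))\<bar> \<le> e + (2 * B + 1) * prob A"
proof -
  define W where "W \<omega> = (\<lambda>t\<in>{0..}. Z t \<omega>)" for \<omega>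
  have W: "W \<in> M \<rightarrow>\<^sub>M borel_sigma path_topology"
    unfolding W_def using path_map_measurable[of Z M] Z cont by simp
  have \<Phi>m: "\<Phi> \<in> borel_measurable (borel_sigma path_topology)"
    by (rule borel_measurable_path_functional[OF \<Phi>])
  have Wp: "W \<omega> \<in> path_space" if "\<omega> \<in> space M" for \<omega>
    using continuous_on_eq[OF cont[OF that], of "\<lambda>t\<in>{0..}. Z t \<omega>"] by (simp add: path_space_def W_def)
  have law: "(\<integral>w. \<Phi> w \<partial>path_law M Z) = expectation (\<lambda>\<omega>. \<Phi> (W \<omega>))"
    unfolding path_law_def W_def[symmetric] by (rule integral_distr[OF W \<Phi>m])
  have i1: "integrable M (\<lambda>\<omega>. \<Phi> (W \<omega>))"
    using B Wp by (intro integrable_const_bound[of _ B] AE_I2 measurable_compose[OF W \<Phi>m]) auto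
  have i2: "integrable M (\<lambda>\<omega>. f (\<lambda>t. Z t \<omega>))"
    using f(2) by (intro integrable_const_bound[of _ "B + 1"] AE_I2 gauss_alg_measurable[OF f(1) Z]) auto
  have pw: "\<bar>\<Phi> (W \<omega>) - f (\<lambda>t. Z t \<omega>)\<bar> \<le> e + (2 * B + 1) * indicator A \<omega>" if "\<omega> \<in> space M" for \<omega>
  proof (cases "\<omega> \<in> A")
    case True
    have "\<bar>\<Phi> (W \<omega>)\<bar> \<le> B" "\<bar>f (\<lambda>t. Z t \<omega>)\<bar> \<le> B + 1" using B Wp[OF that] f(2) by auto
    then show ?thesis using True e by simp
  next
    case False
    then have "\<bar>\<Phi> (W \<omega>) - f (W \<omega>)\<bar> \<le> e" using A(2)[of \<omega>] f(3) that by (simp add: W_def)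
    moreover have "f (W \<omega>) = f (\<lambda>t. Z t \<omega>)" unfolding W_def by (rule gauss_alg_restrict[OF f(1)])
    ultimately show ?thesis using False by simp
  qed
  have "\<bar>expectation (\<lambda>\<omega>. \<Phi> (W \<omega>)) - expectation (\<lambda>\<omega>. f (\<lambda>t. Z t \<omega>))\<bar> =
      \<bar>expectation (\<lambda>\<omega>. \<Phi> (W \<omega>) - f (\<lambda>t. Z t \<omega>))\<bar>"
    using i1 i2 by simp
  also have "\<dots> \<le> expectation (\<lambda>\<omega>. \<bar>\<Phi> (W \<omega>) - f (\<lambda>t. Z t \<omega>)\<bar>)" by (rule integral_abs_bound)
  also have "\<dots> \<le> expectation (\<lambda>\<omega>. e + (2 * B + 1) * indicator A \<omega>)"
    using i1 i2 A(1) pw by (intro integral_mono) (auto simp: integrable_indicator_iff emeasure_eq_measure)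
  also have "\<dots> = e + (2 * B + 1) * prob A"
    using A(1) by (simp add: prob_space emeasure_eq_measure)
  finally show ?thesis by (simp add: law)
qed

lemma (in prob_space) gauss_alg_integrable:
  assumes f: "f \<in> gauss_alg" and Z: "\<And>t. 0 \<le> t \<Longrightarrow> Z t \<in> borel_measurable M"
  shows "integrable M (\<lambda>\<omega>. f (\<lambda>t. Z t \<omega>))"
proof -
  obtain C where "\<And>w. \<bar>f w\<bar> \<le> C" using gauss_alg_bounded[OF f] by blast
  then show ?thesis
    by (intro integrable_const_bound[of _ C] AE_I2 gauss_alg_measurable[OF f Z]) auto
qed

text \<open>Phrased through an exceptional event in \<open>sets M\<close>, so that
  \<open>measure\<close> is applied to a measurable set.\<close>

definition mostly_in_tight_set ::
    "'w measure \<Rightarrow> (real \<Rightarrow> 'w \<Rightarrow> real) \<Rightarrow> real \<Rightarrow> real \<Rightarrow> (nat \<Rightarrow> nat) \<Rightarrow> bool" where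
  "mostly_in_tight_set M Z e R N \<longleftrightarrow>
     (\<exists>A\<in>sets M. measure M A \<le> e \<and> (\<forall>\<omega>\<in>space M - A. (\<lambda>t\<in>{0..}. Z t \<omega>) \<in> tight_set R N))"

text \<open>One pair \<open>R\<close>, \<open>K\<close> serves all \<open>d\<close> and the limit,
  so a single \<open>f\<close> approximates \<open>\<Phi>\<close> under every law and only the
  convergence of one expectation remains.\<close>

lemma weak_convergence_criterion:
  fixes M :: "nat \<Rightarrow> 'w measure" and Z :: "nat \<Rightarrow> real \<Rightarrow> 'w \<Rightarrow> real"
    and N :: "'v measure" and U :: "real \<Rightarrow> 'v \<Rightarrow> real"
  assumes M: "\<And>d. d \<ge> 1 \<Longrightarrow> prob_space (M d)" and N: "prob_space N"
    and Z: "\<And>d t. d \<ge> 1 \<Longrightarrow> 0 \<le> t \<Longrightarrow> Z d t \<in> borel_measurable (M d)"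
    and Zc: "\<And>d \<omega>. d \<ge> 1 \<Longrightarrow> \<omega> \<in> space (M d) \<Longrightarrow> continuous_on {0..} (\<lambda>t. Z d t \<omega>)"
    and U: "\<And>t. 0 \<le> t \<Longrightarrow> U t \<in> borel_measurable N"
    and Uc: "\<And>\<omega>. \<omega> \<in> space N \<Longrightarrow> continuous_on {0..} (\<lambda>t. U t \<omega>)"
    and fdd: "\<And>S a b. finite S \<Longrightarrow> S \<subseteq> {0..} \<Longrightarrow> (\<And>r. r \<in> S \<Longrightarrow> 0 < a r) \<Longrightarrow>
      (\<lambda>d. \<integral>\<omega>. gauss_prod S a b (\<lambda>t. Z d t \<omega>) \<partial>M d) \<longlonglongrightarrow> (\<integral>\<omega>. gauss_prod S a b (\<lambda>t. U t \<omega>) \<partial>N)"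
    and tight: "\<And>e. e > 0 \<Longrightarrow> \<exists>R K. (\<forall>j. K j > 0) \<and>
      (\<forall>d\<ge>1. mostly_in_tight_set (M d) (Z d) e R K) \<and> mostly_in_tight_set N U e R K"
  shows "converge_weakly_as_processes M Z N U"
  unfolding converge_weakly_as_processes_def weakly_converges_def topspace_path_topology
proof (intro allI impI)
  fix \<Phi> :: "(real \<Rightarrow> real) \<Rightarrow> real"
  assume "continuous_map path_topology euclideanreal \<Phi> \<and> (\<exists>B. \<forall>w\<in>path_space. \<bar>\<Phi> w\<bar> \<le> B)"
  then obtain B' where \<Phi>: "continuous_map path_topology euclideanreal \<Phi>"
    and B': "\<And>w. w \<in> path_space \<Longrightarrow> \<bar>\<Phi> w\<bar> \<le> B'" by blast
  define B where "B = max 0 B'"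
  have B: "B \<ge> 0" "\<And>w. w \<in> path_space \<Longrightarrow> \<bar>\<Phi> w\<bar> \<le> B" using B' by (auto simp: B_def le_max_iff_disj)
  have alg: "(\<lambda>d. \<integral>\<omega>. f (\<lambda>t. Z d t \<omega>) \<partial>M d) \<longlonglongrightarrow> (\<integral>\<omega>. f (\<lambda>t. U t \<omega>) \<partial>N)" if "f \<in> gauss_alg" for f
    using that
  proof induction
    case (prod S a c b)
    show ?case
      unfolding integral_mult_right_zero by (intro tendsto_mult_left fdd prod)
  next
    case (add f g)
    have iM: "integrable (M d) (\<lambda>\<omega>. h (\<lambda>t. Z d t \<omega>))" if "h \<in> gauss_alg" "d \<ge> 1" for h d
      using prob_space.gauss_alg_integrable[OF M[OF that(2)] that(1) Z[OF that(2)]] .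
    have iN: "integrable N (\<lambda>\<omega>. h (\<lambda>t. U t \<omega>))" if "h \<in> gauss_alg" for h
      using prob_space.gauss_alg_integrable[OF N that U] .
    have "\<forall>\<^sub>F d in sequentially. (\<integral>\<omega>. f (\<lambda>t. Z d t \<omega>) \<partial>M d) + (\<integral>\<omega>. g (\<lambda>t. Z d t \<omega>) \<partial>M d) =
        (\<integral>\<omega>. f (\<lambda>t. Z d t \<omega>) + g (\<lambda>t. Z d t \<omega>) \<partial>M d)"
      using iM add.hyps by (intro eventually_sequentiallyI[of 1] Bochner_Integration.integral_add[symmetric]) auto
    moreover have "(\<integral>\<omega>. f (\<lambda>t. U t \<omega>) + g (\<lambda>t. U t \<omega>) \<partial>N) = (\<integral>\<omega>. f (\<lambda>t. U t \<omega>) \<partial>N) + (\<integral>\<omega>. g (\<lambda>t. U t \<omega>) \<partial>N)"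
      using iN add.hyps by (intro Bochner_Integration.integral_add) auto
    ultimately show ?case
      using Lim_transform_eventually[OF tendsto_add[OF add.IH]] by simp
  qed
  show "(\<lambda>d. \<integral>w. \<Phi> w \<partial>path_law (M d) (Z d)) \<longlonglongrightarrow> (\<integral>w. \<Phi> w \<partial>path_law N U)"
  proof (rule tendstoI)
    fix \<epsilon> :: real assume \<epsilon>: "\<epsilon> > 0"
    \<comment> \<open>\<open>2 e\<close> and \<open>(2 B + 1) p\<close> are each at most
      \<open>\<epsilon> / 8\<close>. Replacing \<open>\<Phi>\<close> by \<open>f\<close> thus costs
      \<open>\<epsilon> / 4\<close> on either side, and the convergence for \<open>f\<close> another
      \<open>\<epsilon> / 4\<close>.\<close>
    define e where "e = min 1 (\<epsilon> / 16)"
    have e: "0 < e" "e \<le> 1" "2 * e \<le> \<epsilon> / 8" using \<epsilon> by (auto simp: e_def)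
    define p where "p = \<epsilon> / (8 * (2 * B + 1))"
    have p: "p > 0" "(2 * B + 1) * p = \<epsilon> / 8" using \<epsilon> B(1) by (auto simp: p_def field_simps)
    obtain R K where K: "\<And>j. K j > 0"
      and tM: "\<And>d. d \<ge> 1 \<Longrightarrow> mostly_in_tight_set (M d) (Z d) p R K"
      and tN: "mostly_in_tight_set N U p R K"
      using tight[OF p(1)] by metis
    obtain f where f: "f \<in> gauss_alg" "\<And>w. \<bar>f w\<bar> \<le> B + 1" "\<And>w. w \<in> tight_set R K \<Longrightarrow> \<bar>\<Phi> w - f w\<bar> \<le> 2 * e"
      using gauss_alg_approx[of K \<Phi> B e R] K \<Phi> B(2) e by metis
    have e0: "2 * e \<ge> 0" using e by simp
    have bound: "2 * e + (2 * B + 1) * q \<le> \<epsilon> / 4" if "q \<le> p" for q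
      using mult_left_mono[OF that, of "2 * B + 1"] B(1) p e by simp
    have closeM: "\<bar>(\<integral>w. \<Phi> w \<partial>path_law (M d) (Z d)) - (\<integral>\<omega>. f (\<lambda>t. Z d t \<omega>) \<partial>M d)\<bar> \<le> \<epsilon> / 4" if d: "d \<ge> 1" for d
    proof -
      interpret prob_space "M d" using M[OF d] .
      obtain A where A: "A \<in> sets (M d)" "measure (M d) A \<le> p"
        "\<And>\<omega>. \<omega> \<in> space (M d) - A \<Longrightarrow> (\<lambda>t\<in>{0..}. Z d t \<omega>) \<in> tight_set R K"
        using tM[OF d] unfolding mostly_in_tight_set_def by blast
      show ?thesis
        using path_law_integral_approx[OF Z[OF d] Zc[OF d] \<Phi> B f A(1,3) e0] bound[OF A(2)] by simp
    qed
    have closeN: "\<bar>(\<integral>w. \<Phi> w \<partial>path_law N U) - (\<integral>\<omega>. f (\<lambda>t. U t \<omega>) \<partial>N)\<bar> \<le> \<epsilon> / 4"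
    proof -
      interpret prob_space N by fact
      obtain A where A: "A \<in> sets N" "measure N A \<le> p"
        "\<And>\<omega>. \<omega> \<in> space N - A \<Longrightarrow> (\<lambda>t\<in>{0..}. U t \<omega>) \<in> tight_set R K"
        using tN unfolding mostly_in_tight_set_def by blast
      show ?thesis
        using path_law_integral_approx[OF U Uc \<Phi> B f A(1,3) e0] bound[OF A(2)] by simp
    qed
    have "\<forall>\<^sub>F d in sequentially. dist (\<integral>\<omega>. f (\<lambda>t. Z d t \<omega>) \<partial>M d) (\<integral>\<omega>. f (\<lambda>t. U t \<omega>) \<partial>N) < \<epsilon> / 4"
      using \<epsilon> by (intro tendstoD[OF alg[OF f(1)]]) simp
    then show "\<forall>\<^sub>F d in sequentially. dist (\<integral>w. \<Phi> w \<partial>path_law (M d) (Z d)) (\<integral>w. \<Phi> w \<partial>path_law N U) < \<epsilon>"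
      using eventually_ge_at_top[of 1]
    proof eventually_elim
      case (elim d)
      then show ?case using closeM[of d] closeN \<epsilon> unfolding dist_real_def by linarith
    qed
  qed
qed

text \<open>Each path is uniformly continuous on \<open>[0, j]\<close>, so it satisfies the
  condition for all sufficiently fine grids, and continuity of the measure does the rest. That all
  large \<open>n\<close> are admissible allows the same grid to meet a second requirement.\<close>

lemma (in prob_space) cells_eventually:
  fixes Z :: "real \<Rightarrow> 'a \<Rightarrow> real"
  assumes Z: "\<And>t. 0 \<le> t \<Longrightarrow> Z t \<in> borel_measurable M"
    and cont: "\<And>\<omega>. \<omega> \<in> space M \<Longrightarrow> continuous_on {0..} (\<lambda>t. Z t \<omega>)"
    and e: "e > 0" and \<eta>: "\<eta> > 0"
  shows "\<exists>n0. \<forall>n\<ge>n0. n > 0 \<longrightarrow> (\<exists>A\<in>sets M. prob A \<le> \<eta> \<and> (\<forall>\<omega>\<in>space M - A. cells j n e (\<lambda>t. Z t \<omega>)))"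
proof -
  define C where "C n = {\<omega> \<in> space M. \<not> cells j n e (\<lambda>t. Z t \<omega>)}" for n
  have C: "C n \<in> sets M" if "n > 0" for n
    unfolding C_def using cells_event_measurable[of Z M n j e] Z cont that by (intro sets.sets_Collect_neg) auto
  \<comment> \<open>Collecting the failures over all finer grids makes the events decreasing;
    \<open>Suc n\<close> excludes the grid number 0.\<close>
  define D where "D n = (\<Union>m\<in>{m. m \<ge> Suc n}. C m)" for n
  have D: "D n \<in> sets M" for n unfolding D_def using C by (intro sets.countable_UN') auto
  have "decseq D" unfolding D_def by (intro decseq_SucI UN_mono) auto
  moreover have "(\<Inter>n. D n) = {}"
  proof -
    have "\<exists>n. \<omega> \<notin> D n" if \<omega>: "\<omega> \<in> space M" for \<omega>
    proof -
      have "uniformly_continuous_on {0..real j} (\<lambda>t. Z t \<omega>)"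
        by (intro compact_uniformly_continuous continuous_on_subset[OF cont[OF \<omega>]]) auto
      then obtain \<delta> where \<delta>: "\<delta> > 0" "\<And>s t. s \<in> {0..real j} \<Longrightarrow> t \<in> {0..real j} \<Longrightarrow> dist t s < \<delta> \<Longrightarrow>
          dist (Z t \<omega>) (Z s \<omega>) < e"
        using e unfolding uniformly_continuous_on_def by metis
      obtain n :: nat where n: "1 / real (Suc n) < \<delta>" using nat_approx_posE[OF \<delta>(1)] by metis
      have "cells j m e (\<lambda>t. Z t \<omega>)" if m: "m \<ge> Suc n" for m
        unfolding cells_def
      proof (intro allI impI ballI)
        fix i t assume i: "i < j * m" and t: "t \<in> {real i / m .. real (Suc i) / m}"
        have "1 / real m \<le> 1 / real (Suc n)" using m by (intro frac_le) auto
        then have "1 / real m < \<delta>" using n by simp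
        then have "real i / m \<in> {0..real j}" "t \<in> {0..real j}" "dist t (real i / m) < \<delta>"
          using cell_bounds[OF i t] by (simp_all add: dist_real_def)
        then have "dist (Z t \<omega>) (Z (real i / m) \<omega>) < e" by (intro \<delta>(2))
        then show "\<bar>Z t \<omega> - Z (real i / m) \<omega>\<bar> \<le> e" by (simp add: dist_real_def)
      qed
      then show ?thesis by (intro exI[of _ n]) (auto simp: D_def C_def)
    qed
    then show ?thesis using sets.sets_into_space[OF D] by blast
  qed
  ultimately have "(\<lambda>n. prob (D n)) \<longlonglongrightarrow> 0"
    using finite_Lim_measure_decseq[of D] D by auto
  then have "\<forall>\<^sub>F n in sequentially. prob (D n) < \<eta>" using \<eta> by (rule order_tendstoD(2))
  then obtain n0 where n0: "\<And>n. n \<ge> n0 \<Longrightarrow> prob (D n) < \<eta>" by (auto simp: eventually_sequentially)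
  show ?thesis
  proof (intro exI[of _ "Suc n0"] allI impI bexI[of _ "D n0"] conjI ballI D)
    show "prob (D n0) \<le> \<eta>" using n0[of n0] by simp
    fix n \<omega> assume "n \<ge> Suc n0" "\<omega> \<in> space M - D n0"
    then show "cells j n e (\<lambda>t. Z t \<omega>)" by (auto simp: D_def C_def)
  qed
qed

text \<open>The failure probabilities \<open>e / 2^(j + 1)\<close> sum to \<open>e\<close>, and the
  condition at time 0 costs nothing as it holds almost surely.\<close>

lemma (in prob_space) tight_set_prob:
  fixes Z :: "real \<Rightarrow> 'a \<Rightarrow> real"
  assumes Z0: "Z 0 \<in> borel_measurable M" "AE \<omega> in M. \<bar>Z 0 \<omega>\<bar> \<le> R"
    and N: "\<And>j. N j > 0" and e: "e > 0"
    and A: "\<And>j. \<exists>A\<in>sets M. prob A \<le> e * (1 / 2) ^ Suc j \<and>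
      (\<forall>\<omega>\<in>space M - A. cells j (N j) (1 / real (Suc j)) (\<lambda>t. Z t \<omega>))"
  shows "mostly_in_tight_set M Z e R N"
proof -
  obtain A where A: "\<And>j. A j \<in> sets M" "\<And>j. prob (A j) \<le> e * (1 / 2) ^ Suc j"
    "\<And>j \<omega>. \<omega> \<in> space M - A j \<Longrightarrow> cells j (N j) (1 / real (Suc j)) (\<lambda>t. Z t \<omega>)"
    using A by metis
  define A0 where "A0 = {\<omega> \<in> space M. \<not> \<bar>Z 0 \<omega>\<bar> \<le> R}"
  have A0: "A0 \<in> sets M" unfolding A0_def using Z0(1) by measurable
  have pA0: "prob A0 = 0"
    using Z0(2) A0 unfolding A0_def by (subst (asm) AE_iff_measurable[OF _ refl]) (auto simp: measure_def)
  have geo: "(\<lambda>j. e * (1 / 2) ^ Suc j) sums e"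
    using sums_mult[OF power_half_series, of e] by simp
  have sumA: "summable (\<lambda>j. prob (A j))"
    by (rule summable_comparison_test'[OF sums_summable[OF geo], of 0]) (use A(2) in auto)
  have "prob (\<Union>j. A j) \<le> (\<Sum>j. prob (A j))"
    using A(1) sumA by (intro finite_measure_subadditive_countably) auto
  also have "\<dots> \<le> (\<Sum>j. e * (1 / 2) ^ Suc j)" by (rule suminf_le[OF A(2) sumA sums_summable[OF geo]])
  also have "\<dots> = e" using geo by (simp add: sums_iff)
  finally have pA: "prob (\<Union>j. A j) \<le> e" .
  have "prob (A0 \<union> (\<Union>j. A j)) \<le> prob A0 + prob (\<Union>j. A j)"
    using A0 A(1) by (intro measure_Un_le) auto
  then have "prob (A0 \<union> (\<Union>j. A j)) \<le> e" using pA pA0 by simp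
  moreover have "(\<lambda>t\<in>{0..}. Z t \<omega>) \<in> tight_set R N" if \<omega>: "\<omega> \<in> space M - (A0 \<union> (\<Union>j. A j))" for \<omega>
  proof -
    have "cells j (N j) (1 / real (Suc j)) (\<lambda>t\<in>{0..}. Z t \<omega>)" for j
      unfolding cells_def
    proof (intro allI impI ballI)
      fix i t assume i: "i < j * N j" and t: "t \<in> {real i / N j .. real (Suc i) / N j}"
      have i0: "0 \<le> real i / N j" by simp
      then have t0: "0 \<le> t" using t unfolding atLeastAtMost_iff by linarith
      have "cells j (N j) (1 / real (Suc j)) (\<lambda>t. Z t \<omega>)" using \<omega> by (intro A(3)) auto
      from cellsD[OF this i t]
      show "\<bar>(\<lambda>t\<in>{0..}. Z t \<omega>) t - (\<lambda>t\<in>{0..}. Z t \<omega>) (real i / N j)\<bar> \<le> 1 / real (Suc j)"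
        using t0 i0 by simp
    qed
    moreover have "\<bar>Z 0 \<omega>\<bar> \<le> R" using \<omega> by (auto simp: A0_def)
    ultimately show ?thesis by (simp add: tight_set_def)
  qed
  moreover have "A0 \<union> (\<Union>j. A j) \<in> sets M" using A0 A(1) by auto
  ultimately show ?thesis unfolding mostly_in_tight_set_def by blast
qed

section \<open>Conditioning steps for both processes, and the conclusion\<close>

lemma gauss_prod_measurable:
  "(\<And>r. r \<in> S \<Longrightarrow> Z r \<in> borel_measurable F) \<Longrightarrow> (\<lambda>\<omega>. gauss_prod S a b (\<lambda>r. Z r \<omega>)) \<in> borel_measurable F"
  unfolding gauss_prod_def by (intro borel_measurable_exp[THEN measurable_compose[rotated]] borel_measurable_sum
    borel_measurable_diff borel_measurable_times borel_measurable_const borel_measurable_power)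

text \<open>Conditioning at time \<open>s\<close> replaces the last Gaussian by its image under the
  semigroup, which \<open>op_gauss_approx\<close> compares pointwise with the evolved Gaussian; the
  earlier factors only contribute their bound. \<open>C\<close> is a parameter, so that it can be
  fixed before the dimension.\<close>

lemma (in spherical_process) gauss_prod_step:
  assumes S: "finite S" "S \<subseteq> {0..s}" "\<And>r. r \<in> S \<Longrightarrow> 0 < a r" and a': "0 < a'" and st: "0 \<le> s" "s \<le> t"
    and C': "\<And>r x. 0 \<le> r \<Longrightarrow> r \<le> t - s \<Longrightarrow> (1 + x\<^sup>2) * \<bar>ou_gauss' a' b' 0 r x\<bar> \<le> C"
    and C'': "\<And>r x. 0 \<le> r \<Longrightarrow> r \<le> t - s \<Longrightarrow> (1 + x\<^sup>2) * \<bar>ou_gauss'' a' b' 0 r x\<bar> \<le> C"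
    and CL: "\<And>r x. 0 \<le> r \<Longrightarrow> r \<le> t - s \<Longrightarrow> (1 + x\<^sup>2) * \<bar>ou_gaussL a' b' 0 r x\<bar> \<le> C"
  shows "\<bar>expectation (\<lambda>\<omega>. gauss_prod S a b (\<lambda>r. proj (X r \<omega>)) * gauss a' b' 0 (proj (X t \<omega>)))
      - expectation (\<lambda>\<omega>. gauss_prod S a b (\<lambda>r. proj (X r \<omega>)) * ou_gauss a' b' 0 (t - s) (proj (X s \<omega>)))\<bar>
    \<le> exp (\<Sum>r\<in>S. (b r)\<^sup>2 / (4 * a r)) * (2 * C / real d * (t - s))"
proof -
  define H where "H \<omega> = gauss_prod S a b (\<lambda>r. proj (X r \<omega>))" for \<omega>
  define B where "B = exp (\<Sum>r\<in>S. (b r)\<^sup>2 / (4 * a r))"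
  have HB: "0 < H \<omega>" "H \<omega> \<le> B" for \<omega>
    unfolding H_def B_def using gauss_prod_bounded[of S a b] S(3) by auto
  have Hm: "H \<in> borel_measurable (natural_filtration M X s)"
    unfolding H_def using S(2) by (intro gauss_prod_measurable proj_X_natural_filtration) auto
  have gC0: "(\<lambda>x. gauss a' b' 0 (proj x)) \<in> C0_on E" by (rule C0_on_proj[OF C2_derivs_gauss])
  have oC0: "(\<lambda>x. ou_gauss a' b' 0 (t - s) (proj x)) \<in> C0_on E"
    unfolding ou_gauss_def by (rule C0_on_proj[OF C2_derivs_gauss])
  obtain G where G: "\<And>x. x \<in> E \<Longrightarrow> \<bar>gauss a' b' 0 (proj x)\<bar> \<le> G" using C0_on_bounded[OF gC0] by metis
  have mk: "expectation (\<lambda>\<omega>. H \<omega> * gauss a' b' 0 (proj (X t \<omega>))) =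
      expectation (\<lambda>\<omega>. H \<omega> * op (t - s) (\<lambda>x. gauss a' b' 0 (proj x)) (X s \<omega>))"
    using HB G by (intro markov_integral[OF st Hm _ C0_on_measurable[OF gC0], of B G]) (auto simp: less_imp_le)
  have int: "integrable M (\<lambda>\<omega>. H \<omega> * f (X s \<omega>))" if f: "f \<in> C0_on E" for f
  proof -
    obtain F where F: "F \<ge> 0" "\<And>x. x \<in> E \<Longrightarrow> \<bar>f x\<bar> \<le> F" using C0_on_bounded[OF f] by metis
    show ?thesis
    proof (rule integrable_const_bound[of _ "B * F"])
      show "AE \<omega> in M. norm (H \<omega> * f (X s \<omega>)) \<le> B * F"
      proof (rule AE_I2)
        fix \<omega> assume "\<omega> \<in> space M"
        then have "\<bar>H \<omega>\<bar> * \<bar>f (X s \<omega>)\<bar> \<le> B * F"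
          using HB[of \<omega>] F X_in_E[OF st(1)] by (intro mult_mono) auto
        then show "norm (H \<omega> * f (X s \<omega>)) \<le> B * F" by (simp add: abs_mult)
      qed
      show "(\<lambda>\<omega>. H \<omega> * f (X s \<omega>)) \<in> borel_measurable M"
        by (intro borel_measurable_times measurable_from_subalg[OF subalgebra_natural_filtration Hm]
          measurable_compose[OF X_measurable[OF st(1)] C0_on_measurable[OF f]])
    qed
  qed
  have i1: "integrable M (\<lambda>\<omega>. H \<omega> * op (t - s) (\<lambda>x. gauss a' b' 0 (proj x)) (X s \<omega>))"
    using st by (intro int op_C0 gC0) simp
  have i2: "integrable M (\<lambda>\<omega>. H \<omega> * ou_gauss a' b' 0 (t - s) (proj (X s \<omega>)))"
    by (rule int[OF oC0])
  define D where "D \<omega> = op (t - s) (\<lambda>x. gauss a' b' 0 (proj x)) (X s \<omega>) - ou_gauss a' b' 0 (t - s) (proj (X s \<omega>))" for \<omega>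
  have ts: "0 \<le> t - s" using st by simp
  have D: "\<bar>D \<omega>\<bar> \<le> 2 * C / real d * (t - s)" if "\<omega> \<in> space M" for \<omega>
    unfolding D_def using X_in_E[OF st(1) that] C' C'' CL by (intro op_gauss_approx[OF a' ts]) auto
  have "\<bar>expectation (\<lambda>\<omega>. H \<omega> * gauss a' b' 0 (proj (X t \<omega>)))
      - expectation (\<lambda>\<omega>. H \<omega> * ou_gauss a' b' 0 (t - s) (proj (X s \<omega>)))\<bar> =
      \<bar>expectation (\<lambda>\<omega>. H \<omega> * op (t - s) (\<lambda>x. gauss a' b' 0 (proj x)) (X s \<omega>)
        - H \<omega> * ou_gauss a' b' 0 (t - s) (proj (X s \<omega>)))\<bar>"
    unfolding mk using i1 i2 by simp
  also have "\<dots> \<le> expectation (\<lambda>\<omega>. \<bar>H \<omega> * op (t - s) (\<lambda>x. gauss a' b' 0 (proj x)) (X s \<omega>)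
        - H \<omega> * ou_gauss a' b' 0 (t - s) (proj (X s \<omega>))\<bar>)" by (rule integral_abs_bound)
  also have "\<dots> \<le> expectation (\<lambda>_. B * (2 * C / real d * (t - s)))"
  proof (intro integral_mono)
    fix \<omega> assume \<omega>: "\<omega> \<in> space M"
    have "\<bar>H \<omega>\<bar> * \<bar>D \<omega>\<bar> \<le> B * (2 * C / real d * (t - s))"
      using HB[of \<omega>] D[OF \<omega>] by (intro mult_mono) auto
    then show "\<bar>H \<omega> * op (t - s) (\<lambda>x. gauss a' b' 0 (proj x)) (X s \<omega>)
        - H \<omega> * ou_gauss a' b' 0 (t - s) (proj (X s \<omega>))\<bar> \<le> B * (2 * C / real d * (t - s))"
      by (simp add: D_def abs_mult[symmetric] right_diff_distrib)
  qed (use i1 i2 in auto)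
  also have "\<dots> = B * (2 * C / real d * (t - s))" by (simp add: prob_space)
  finally show ?thesis by (simp add: H_def B_def)
qed

locale ou_markov = ou_semigroup P + feller_markov "UNIV :: real set" P M X
  for P and M :: "'w measure" and X
begin

lemma gauss_prod_step:
  assumes S: "finite S" "S \<subseteq> {0..s}" "\<And>r. r \<in> S \<Longrightarrow> 0 < a r" and a': "0 < a'" and st: "0 \<le> s" "s \<le> t"
  shows "expectation (\<lambda>\<omega>. gauss_prod S a b (\<lambda>r. X r \<omega>) * gauss a' b' 0 (X t \<omega>))
      = expectation (\<lambda>\<omega>. gauss_prod S a b (\<lambda>r. X r \<omega>) * ou_gauss a' b' 0 (t - s) (X s \<omega>))"
proof -
  have gm: "gauss a' b' 0 \<in> borel_measurable (borel_on UNIV)"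
    by (rule borel_measurable_continuous_on_restrict[OF C2_derivs_continuous(1)[OF C2_derivs_gauss]])
  have gB: "\<bar>gauss a' b' 0 x\<bar> \<le> exp (b'\<^sup>2 / (4 * a'))" for x
    using gauss_prod_bounded[of "{0}" "\<lambda>_. a'" "\<lambda>_. b'" "\<lambda>_. x"] a'
    by (simp add: gauss_prod_def gauss_def)
  have "expectation (\<lambda>\<omega>. gauss_prod S a b (\<lambda>r. X r \<omega>) * gauss a' b' 0 (X t \<omega>))
      = expectation (\<lambda>\<omega>. gauss_prod S a b (\<lambda>r. X r \<omega>) * op (t - s) (gauss a' b' 0) (X s \<omega>))"
  proof (rule markov_integral[OF st _ _ gm gB])
    show "(\<lambda>\<omega>. gauss_prod S a b (\<lambda>r. X r \<omega>)) \<in> borel_measurable (natural_filtration M X s)"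
      using S(2) by (intro gauss_prod_measurable X_measurable_natural_filtration) auto
    show "\<bar>gauss_prod S a b (\<lambda>r. X r \<omega>)\<bar> \<le> exp (\<Sum>r\<in>S. (b r)\<^sup>2 / (4 * a r))" for \<omega>
      using gauss_prod_bounded[of S a b] S(3) by (simp add: less_imp_le)
  qed
  also have "\<dots> = expectation (\<lambda>\<omega>. gauss_prod S a b (\<lambda>r. X r \<omega>) * ou_gauss a' b' 0 (t - s) (X s \<omega>))"
    using op_gauss[OF a', of "t - s"] st by simp
  finally show ?thesis .
qed

end

theorem theorem2p1:
  fixes \<theta> x :: "nat \<Rightarrow> nat \<Rightarrow> real"
    and M :: "nat \<Rightarrow> 'w measure" and X :: "nat \<Rightarrow> real \<Rightarrow> 'w \<Rightarrow> nat \<Rightarrow> real"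
    and Y :: "nat \<Rightarrow> real \<Rightarrow> 'w \<Rightarrow> real" and y :: "nat \<Rightarrow> real"
    and u :: real and N :: "'v measure" and U :: "real \<Rightarrow> 'v \<Rightarrow> real"
  assumes "\<And>d. d \<ge> 1 \<Longrightarrow> \<theta> d \<in> sphere_sqrt d 1"
    and "\<And>d. d \<ge> 1 \<Longrightarrow> x d \<in> sphere_sqrt d (real d)"
    and "\<And>d. d \<ge> 1 \<Longrightarrow> spherical_BM d (x d) (M d) (X d)"
    and "\<And>d t \<omega>. d \<ge> 1 \<Longrightarrow> Y d t \<omega> = dotp d (\<theta> d) (X d t \<omega>)"
    and "\<And>d. d \<ge> 1 \<Longrightarrow> y d = dotp d (\<theta> d) (x d)"
    and "OU_process u N U"
    and "y \<longlonglongrightarrow> u"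
  shows "converge_weakly_as_processes M Y N U"
proof -
  have dp: "diffusion_process (sphere_sqrt d (real d)) (C2_Rn d) (spherical_generator d) (x d) (M d) (X d)"
    if "d \<ge> 1" for d using assms(3)[OF that] by (simp add: spherical_BM_def)
  have "\<exists>P. spherical_process d P (\<theta> d) (M d) (X d)" if d: "d \<ge> 1" for d
  proof -
    obtain P where P: "feller_semigroup (sphere_sqrt d (real d)) P"
      "\<forall>f\<in>C2_Rn d. has_generator_value (sphere_sqrt d (real d)) P f (spherical_generator d f)"
      "markov_process (sphere_sqrt d (real d)) P (M d) (X d)"
      using dp[OF d] unfolding diffusion_process_def by blast
    interpret prob_space "M d" using dp[OF d] by (simp add: diffusion_process_def)
    have "spherical_process d P (\<theta> d) (M d) (X d)"
      by unfold_locales (use P assms(1)[OF d] d in auto)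
    then show ?thesis by blast
  qed
  then obtain P where sp: "\<And>d. d \<ge> 1 \<Longrightarrow> spherical_process d (P d) (\<theta> d) (M d) (X d)" by metis
  have Xc: "continuous_on {0..} (\<lambda>t. X d t \<omega>)" if "d \<ge> 1" "\<omega> \<in> space (M d)" for d \<omega>
    using dp[OF that(1)] that(2) by (simp add: diffusion_process_def)
  have pM: "prob_space (M d)" if "d \<ge> 1" for d using dp[OF that] by (simp add: diffusion_process_def)
  have Yeq: "Y d = (\<lambda>t \<omega>. dotp d (\<theta> d) (X d t \<omega>))" if "d \<ge> 1" for d
    using assms(4)[OF that] by (simp add: fun_eq_iff)
  have Ym: "Y d t \<in> borel_measurable (M d)" if d: "d \<ge> 1" and t: "0 \<le> t" for d t
  proof -
    interpret spherical_process d "P d" "\<theta> d" "M d" "X d" by (rule sp[OF d])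
    show ?thesis unfolding Yeq[OF d] by (rule proj_X_measurable[OF t])
  qed
  have Yc: "continuous_on {0..} (\<lambda>t. Y d t \<omega>)" if d: "d \<ge> 1" and \<omega>: "\<omega> \<in> space (M d)" for d \<omega>
  proof -
    interpret spherical_process d "P d" "\<theta> d" "M d" "X d" by (rule sp[OF d])
    show ?thesis unfolding Yeq[OF d]
      by (rule continuous_on_compose2[OF continuous_on_proj[of UNIV] Xc[OF d \<omega>]]) simp
  qed
  have Y0: "AE \<omega> in M d. dotp d (\<theta> d) (X d 0 \<omega>) = y d" if d: "d \<ge> 1" for d
  proof -
    have "AE \<omega> in M d. X d 0 \<omega> = x d" using dp[OF d] by (simp add: diffusion_process_def)
    then show ?thesis by eventually_elim (simp add: assms(5)[OF d])
  qed
  have ou: "diffusion_process UNIV C2c_real OU_generator u N U"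
    using assms(6) by (simp add: OU_process_def)
  then obtain Q where Q: "feller_semigroup (UNIV :: real set) Q"
    "\<forall>f\<in>C2c_real. has_generator_value UNIV Q f (OU_generator f)" "markov_process UNIV Q N U"
    unfolding diffusion_process_def by blast
  interpret N: prob_space N using ou by (simp add: diffusion_process_def)
  interpret U: ou_markov Q N U
    by unfold_locales (use Q in auto)
  have Uc: "continuous_on {0..} (\<lambda>t. U t \<omega>)" if "\<omega> \<in> space N" for \<omega>
    using ou that by (simp add: diffusion_process_def)
  have U0: "AE \<omega> in N. U 0 \<omega> = u" using ou by (simp add: diffusion_process_def)
  show ?thesis
  proof (rule weak_convergence_criterion[OF pM N.prob_space_axioms Ym Yc U.X_measurable_borel Uc])
    fix S :: "real set" and a b :: "real \<Rightarrow> real"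
    assume "finite S" "S \<subseteq> {0..}" "\<And>r. r \<in> S \<Longrightarrow> 0 < a r"
    then show "(\<lambda>d. \<integral>\<omega>. gauss_prod S a b (\<lambda>t. Y d t \<omega>) \<partial>M d) \<longlonglongrightarrow> (\<integral>\<omega>. gauss_prod S a b (\<lambda>t. U t \<omega>) \<partial>N)"
    proof (rule gauss_prod_expectation_limit[rotated 4])
      fix S :: "real set" and a b :: "real \<Rightarrow> real" and a' b' s t :: real
      assume S: "finite S" "S \<subseteq> {0..s}" "\<And>r. r \<in> S \<Longrightarrow> 0 < a r" and a': "0 < a'" and st: "0 \<le> s" "s \<le> t"
      \<comment> \<open>These bounds concern the limiting semigroup only and are chosen before
        \<open>d\<close>; the discrepancy is then \<open>K / d\<close> with a fixed
        \<open>K\<close>.\<close>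
      obtain C where C: "C > 0"
        "\<And>r x. 0 \<le> r \<Longrightarrow> r \<le> t - s \<Longrightarrow> (1 + x\<^sup>2) * \<bar>ou_gauss' a' b' 0 r x\<bar> \<le> C"
        "\<And>r x. 0 \<le> r \<Longrightarrow> r \<le> t - s \<Longrightarrow> (1 + x\<^sup>2) * \<bar>ou_gauss'' a' b' 0 r x\<bar> \<le> C"
        "\<And>r x. 0 \<le> r \<Longrightarrow> r \<le> t - s \<Longrightarrow> (1 + x\<^sup>2) * \<bar>ou_gaussL a' b' 0 r x\<bar> \<le> C"
        using ou_gauss_bounds[OF a'] by metis
      define K where "K = exp (\<Sum>r\<in>S. (b r)\<^sup>2 / (4 * a r)) * (2 * C * (t - s))"
      have "\<bar>(\<integral>\<omega>. gauss_prod S a b (\<lambda>r. Y d r \<omega>) * gauss a' b' 0 (Y d t \<omega>) \<partial>M d)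
         - (\<integral>\<omega>. gauss_prod S a b (\<lambda>r. Y d r \<omega>) * ou_gauss a' b' 0 (t - s) (Y d s \<omega>) \<partial>M d)\<bar> \<le> K / real d"
        if d: "d \<ge> 1" for d
      proof -
        interpret spherical_process d "P d" "\<theta> d" "M d" "X d" by (rule sp[OF d])
        have "\<bar>(\<integral>\<omega>. gauss_prod S a b (\<lambda>r. proj (X d r \<omega>)) * gauss a' b' 0 (proj (X d t \<omega>)) \<partial>M d)
           - (\<integral>\<omega>. gauss_prod S a b (\<lambda>r. proj (X d r \<omega>)) * ou_gauss a' b' 0 (t - s) (proj (X d s \<omega>)) \<partial>M d)\<bar>
           \<le> exp (\<Sum>r\<in>S. (b r)\<^sup>2 / (4 * a r)) * (2 * C / real d * (t - s))"
        proof (rule gauss_prod_step)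
          show "0 < a r" if "r \<in> S" for r using that by (rule S(3))
          show "(1 + z\<^sup>2) * \<bar>ou_gauss' a' b' 0 r z\<bar> \<le> C" if "0 \<le> r" "r \<le> t - s" for r z
            using that by (rule C(2))
          show "(1 + z\<^sup>2) * \<bar>ou_gauss'' a' b' 0 r z\<bar> \<le> C" if "0 \<le> r" "r \<le> t - s" for r z
            using that by (rule C(3))
          show "(1 + z\<^sup>2) * \<bar>ou_gaussL a' b' 0 r z\<bar> \<le> C" if "0 \<le> r" "r \<le> t - s" for r z
            using that by (rule C(4))
        qed (use S a' st in simp_all)
        then show ?thesis by (simp add: Yeq[OF d] K_def)
      qed
      then have "\<forall>\<^sub>F d in sequentially. norm ((\<integral>\<omega>. gauss_prod S a b (\<lambda>r. Y d r \<omega>) * gauss a' b' 0 (Y d t \<omega>) \<partial>M d)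
         - (\<integral>\<omega>. gauss_prod S a b (\<lambda>r. Y d r \<omega>) * ou_gauss a' b' 0 (t - s) (Y d s \<omega>) \<partial>M d)) \<le> K / real d"
        by (intro eventually_sequentiallyI[of 1]) simp
      then show "(\<lambda>d. (\<integral>\<omega>. gauss_prod S a b (\<lambda>r. Y d r \<omega>) * gauss a' b' 0 (Y d t \<omega>) \<partial>M d)
         - (\<integral>\<omega>. gauss_prod S a b (\<lambda>r. Y d r \<omega>) * ou_gauss a' b' 0 (t - s) (Y d s \<omega>) \<partial>M d)) \<longlonglongrightarrow> 0"
        by (rule Lim_null_comparison[OF _ lim_const_over_n])
    next
      fix S :: "real set" and a b :: "real \<Rightarrow> real" and a' b' s t :: real
      assume "finite S" "S \<subseteq> {0..s}" "\<And>r. r \<in> S \<Longrightarrow> 0 < a r" "0 < a'" "0 \<le> s" "s \<le> t"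
      then show "(\<integral>\<omega>. gauss_prod S a b (\<lambda>r. U r \<omega>) * gauss a' b' 0 (U t \<omega>) \<partial>N)
         = (\<integral>\<omega>. gauss_prod S a b (\<lambda>r. U r \<omega>) * ou_gauss a' b' 0 (t - s) (U s \<omega>) \<partial>N)"
        by (rule U.gauss_prod_step)
    next
      fix a b c :: real assume "0 < a"
      have gc: "isCont (gauss a b c) z" for z by (rule DERIV_isCont[OF DERIV_gauss])
      have gm: "gauss a b c \<in> borel_measurable borel"
        by (rule borel_measurable_continuous_onI[OF C2_derivs_continuous(1)[OF C2_derivs_gauss]])
      have "(\<integral>\<omega>. gauss a b c (Y d 0 \<omega>) \<partial>M d) = gauss a b c (y d)" if d: "d \<ge> 1" for d
      proof -
        interpret prob_space "M d" by (rule pM[OF d])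
        have "(\<integral>\<omega>. gauss a b c (Y d 0 \<omega>) \<partial>M d) = (\<integral>\<omega>. gauss a b c (y d) \<partial>M d)"
          using Y0[OF d] by (intro integral_cong_AE measurable_compose[OF Ym[OF d] gm])
            (auto simp: Yeq[OF d] elim: eventually_mono)
        then show ?thesis by (simp add: prob_space)
      qed
      then have "\<forall>\<^sub>F d in sequentially. gauss a b c (y d) = (\<integral>\<omega>. gauss a b c (Y d 0 \<omega>) \<partial>M d)"
        by (intro eventually_sequentiallyI[of 1]) simp
      moreover have "(\<lambda>d. gauss a b c (y d)) \<longlonglongrightarrow> gauss a b c u"
        by (rule isCont_tendsto_compose[OF gc assms(7)])
      moreover have "(\<integral>\<omega>. gauss a b c (U 0 \<omega>) \<partial>N) = gauss a b c u"
      proof -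
        have "(\<integral>\<omega>. gauss a b c (U 0 \<omega>) \<partial>N) = (\<integral>\<omega>. gauss a b c u \<partial>N)"
          using U0 by (intro integral_cong_AE measurable_compose[OF U.X_measurable_borel gm])
            (auto elim: eventually_mono)
        then show ?thesis by (simp add: N.prob_space)
      qed
      ultimately show "(\<lambda>d. \<integral>\<omega>. gauss a b c (Y d 0 \<omega>) \<partial>M d) \<longlonglongrightarrow> (\<integral>\<omega>. gauss a b c (U 0 \<omega>) \<partial>N)"
        by (simp only: Lim_transform_eventually)
    next
      have "\<forall>\<^sub>F d in sequentially. 1 = measure (M d) (space (M d))"
        using prob_space.prob_space[OF pM] by (intro eventually_sequentiallyI[of 1]) simp
      then show "(\<lambda>d. measure (M d) (space (M d))) \<longlonglongrightarrow> measure N (space N)"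
        unfolding N.prob_space by (rule Lim_transform_eventually[OF tendsto_const])
    qed
  next
    fix e :: real assume e: "e > 0"
    \<comment> \<open>A convergent sequence is bounded, so one \<open>R\<close> covers all starting
      values and that of the limit.\<close>
    obtain R where R: "\<bar>u\<bar> \<le> R" "\<And>d. \<bar>y d\<bar> \<le> R"
    proof -
      obtain R' where "\<And>d. norm (y d) \<le> R'"
        using convergent_imp_Bseq[of y] assms(7) by (auto simp: convergent_def Bseq_def)
      then show thesis by (intro that[of "max \<bar>u\<bar> R'"]) (auto simp: le_max_iff_disj)
    qed
    define C where "C j = 50000 * (14 + 24 * (R ^ 4 + (14 + 3 * R ^ 4) * (real j)\<^sup>2)) * real j" for j :: nat
    have C: "C j \<ge> 0" for j by (simp add: C_def)
    define e' where "e' j = 1 / real (Suc j)" for j :: nat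
    define \<eta> where "\<eta> j = e * (1 / 2) ^ Suc j" for j :: nat
    have pos: "e' j > 0" "\<eta> j > 0" for j using e by (auto simp: e'_def \<eta>_def)
    \<comment> \<open>The common grid at level \<open>j\<close>: the first condition makes the
      moment bound sufficient for every \<open>d\<close>, the second is what continuity of the paths
      of \<open>U\<close> provides. Both hold for all large \<open>n\<close>.\<close>
    have "\<exists>n>0. C j / (real n * e' j ^ 4) \<le> \<eta> j \<and>
        (\<exists>A\<in>sets N. measure N A \<le> \<eta> j \<and> (\<forall>\<omega>\<in>space N - A. cells j n (e' j) (\<lambda>t. U t \<omega>)))" for j
    proof -
      have "\<exists>n0. \<forall>n\<ge>n0. n > 0 \<longrightarrow> (\<exists>A\<in>sets N. measure N A \<le> \<eta> j \<and>
          (\<forall>\<omega>\<in>space N - A. cells j n (e' j) (\<lambda>t. U t \<omega>)))"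
        by (rule N.cells_eventually) (use U.X_measurable_borel Uc pos in auto)
      then obtain n0 where n0: "\<forall>n\<ge>n0. n > 0 \<longrightarrow> (\<exists>A\<in>sets N. measure N A \<le> \<eta> j \<and>
          (\<forall>\<omega>\<in>space N - A. cells j n (e' j) (\<lambda>t. U t \<omega>)))" by blast
      define n where "n = max (Suc n0) (nat \<lceil>C j / (e' j ^ 4 * \<eta> j)\<rceil>)"
      have "C j / (e' j ^ 4 * \<eta> j) \<le> real (nat \<lceil>C j / (e' j ^ 4 * \<eta> j)\<rceil>)" by (rule real_nat_ceiling_ge)
      also have "\<dots> \<le> real n" by (simp add: n_def)
      finally have "C j / (real n * e' j ^ 4) \<le> \<eta> j"
        using pos[of j] by (simp add: n_def field_simps)
      moreover have "n > 0" "n \<ge> n0" by (auto simp: n_def)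
      ultimately show ?thesis using n0 by blast
    qed
    then obtain K where K: "\<And>j. K j > 0" "\<And>j. C j / (real (K j) * e' j ^ 4) \<le> \<eta> j"
      "\<And>j. \<exists>A\<in>sets N. measure N A \<le> \<eta> j \<and> (\<forall>\<omega>\<in>space N - A. cells j (K j) (e' j) (\<lambda>t. U t \<omega>))"
      by metis
    have "mostly_in_tight_set (M d) (Y d) e R K"
      if d: "d \<ge> 1" for d
    proof -
      interpret spherical_process d "P d" "\<theta> d" "M d" "X d" by (rule sp[OF d])
      show ?thesis
      proof (rule tight_set_prob[where Z = "Y d", OF Ym[OF d order_refl] _ K(1) e])
        show "AE \<omega> in M d. \<bar>Y d 0 \<omega>\<bar> \<le> R"
          using Y0[OF d] by eventually_elim (simp add: Yeq[OF d] R)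
        fix j
        obtain A where A: "A \<in> sets (M d)"
          "prob A \<le> 50000 * (14 + 24 * (y d ^ 4 + (14 + 3 * y d ^ 4) * (real j)\<^sup>2)) * real j / (real (K j) * e' j ^ 4)"
          "\<And>\<omega>. \<omega> \<in> space (M d) - A \<Longrightarrow> cells j (K j) (e' j) (\<lambda>t. proj (X d t \<omega>))"
          using cells_prob[OF Y0[OF d] Xc[OF d] pos(1) K(1)] by metis
        \<comment> \<open>This removes the last dependence on \<open>d\<close> from the bound of
          \<open>cells_prob\<close>.\<close>
        have "y d ^ 4 \<le> R ^ 4"
        proof -
          have "\<bar>y d\<bar> ^ 4 \<le> R ^ 4" using R(2)[of d] by (intro power_mono) auto
          then show ?thesis by simp
        qed
        then have "50000 * (14 + 24 * (y d ^ 4 + (14 + 3 * y d ^ 4) * (real j)\<^sup>2)) * real j / (real (K j) * e' j ^ 4) \<le>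
            C j / (real (K j) * e' j ^ 4)"
          unfolding C_def using pos[of j]
          by (intro divide_right_mono mult_right_mono mult_left_mono add_mono) auto
        then have "prob A \<le> e * (1 / 2) ^ Suc j" using A(2) K(2)[of j] unfolding \<eta>_def by linarith
        then show "\<exists>A\<in>sets (M d). prob A \<le> e * (1 / 2) ^ Suc j \<and>
            (\<forall>\<omega>\<in>space (M d) - A. cells j (K j) (1 / real (Suc j)) (\<lambda>t. Y d t \<omega>))"
          using A(1,3) unfolding Yeq[OF d] e'_def by blast
      qed
    qed
    moreover have "mostly_in_tight_set N U e R K"
    proof (rule N.tight_set_prob[where Z = U, OF U.X_measurable_borel[OF order_refl] _ K(1) e])
      show "AE \<omega> in N. \<bar>U 0 \<omega>\<bar> \<le> R" using U0 by eventually_elim (simp add: R)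
      show "\<exists>A\<in>sets N. measure N A \<le> e * (1 / 2) ^ Suc j \<and>
          (\<forall>\<omega>\<in>space N - A. cells j (K j) (1 / real (Suc j)) (\<lambda>t. U t \<omega>))" for j
        using K(3)[of j] unfolding \<eta>_def e'_def .
    qed
    ultimately show "\<exists>R K. (\<forall>j. K j > 0) \<and>
      (\<forall>d\<ge>1. mostly_in_tight_set (M d) (Y d) e R K) \<and> mostly_in_tight_set N U e R K"
      using K(1) by blast
  qed
qed

end
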